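(* Let $f\in C^2(\mathbb{R}^d)$ with $\inf f>-\infty$ and $\nabla f$ globally $L$-Lipschitz. Let $h>0$, $\beta\ge0$, and let $(\gamma_k)_{k\in\mathbb{N}}$ satisfy $c\le\gamma_k\le C$ for all $k$, for some $0<c\le C$. Given $x_0,x_1\in\mathbb{R}^d$, define for $k\ge1$ $$y_k=x_k+\alpha_k(x_k-x_{k-1})-\beta_k(\nabla f(x_k)-\nabla f(x_{k-1})),\qquad x_{k+1}=y_k-s_k\nabla f(x_k),$$ with $\alpha_k=\frac1{1+\gamma_kh}$, $\beta_k=\beta h\alpha_k$, $s_k=h^2\alpha_k$. Then: (i) if $\beta+\frac h2<\frac cL$, then $(\|\nabla f(x_k)\|)_k\in\ell^2(\mathbb{N})$ and $(\|x_{k+1}-x_k\|)_k\in\ell^2(\mathbb{N})$; in particular $\|\nabla f(x_k)\|\to0$; (ii) if moreover $(x_k)$ is bounded and $f$ is definable, then $(\|x_{k+1}-x_k\|)_k\in\ell^1(\mathbb{N})$ and $x_k$ converges to a critical point of $f$; (iii) if $\gamma_k\equiv c>0$, $0<\beta<\frac cL$, $\beta\neq\frac1c$ and $h<\min\big(2(\frac cL-\beta),\frac1{L\beta}\big)$, then the set of initializations $(x_0,x_1)\in\mathbb{R}^d\times\mathbb{R}^d$ for which $(x_k)$ converges to a strict saddle point of $f$ has Lebesgue measure zero. Consequently, if in addition $f$ is definable and $(x_k)$ is bounded for almost every initialization, then for almost all $(x_0,x_1)$, $x_k$ converges to a critical point of $f$ that is not a strict saddle point; and if furthermore $f$ has the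 strict saddle property, $x_k$ converges to a local minimum of $f$ for almost all $(x_0,x_1)$.
   Context: Definable: definable in an o-minimal structure over $\mathbb{R}$. A strict saddle point of $f$ is a critical point $\hat x$ ($\nabla f(\hat x)=0$) with $\lambda_{\min}(\nabla^2 f(\hat x))<0$. A local minimum is a critical point with positive definite Hessian. $f$ has the strict saddle property if every critical point is either a local minimum or a strict saddle point. *)

theory Defs
  imports "HOL-Analysis.Analysis"
begin

definition Rn :: "nat \<Rightarrow> real list set" where
  "Rn n = {xs. length xs = n}"

definition finite_union_points_intervals :: "real set \<Rightarrow> bool" where
  "finite_union_points_intervals U \<longleftrightarrow>
     (\<exists>F. finite F \<and> U = \<Union>F \<and>
        (\<forall>I\<in>F. (\<exists>a. I = {a}) \<or> (\<exists>a b :: ereal. I = {t. a < ereal t \<and> ereal t < b})))"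

definition o_minimal_structure :: "(nat \<Rightarrow> real list set set) \<Rightarrow> bool" where
  "o_minimal_structure S \<longleftrightarrow>
     (\<forall>n. \<forall>A\<in>S n. A \<subseteq> Rn n) \<and>
     (\<forall>n. {} \<in> S n) \<and>
     (\<forall>n. \<forall>A\<in>S n. \<forall>B\<in>S n. A \<union> B \<in> S n) \<and>
     (\<forall>n. \<forall>A\<in>S n. Rn n - A \<in> S n) \<and>
     (\<forall>n. \<forall>A\<in>S n. {xs @ [t] | xs t. xs \<in> A} \<in> S (Suc n)) \<and>
     (\<forall>n. \<forall>A\<in>S n. {t # xs | xs t. xs \<in> A} \<in> S (Suc n)) \<and>
     (\<forall>n i j. i < n \<and> j < n \<longrightarrow> {xs \<in> Rn n. xs ! i = xs ! j} \<in> S n) \<and>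
     (\<forall>n. \<forall>A\<in>S (Suc n). butlast ` A \<in> S n) \<and>
     {[x, y] | x y. x < y} \<in> S 2 \<and>
     {[x, y, z] | x y z. z = x + y} \<in> S 3 \<and>
     {[x, y, z] | x y z. z = x * y} \<in> S 3 \<and>
     S 1 = {(\<lambda>t. [t]) ` U | U. finite_union_points_intervals U}"

definition coords :: "(nat \<Rightarrow> 'n::finite) \<Rightarrow> real^'n \<Rightarrow> real list" where
  "coords e x = map (\<lambda>i. x $ e i) [0..<CARD('n)]"

definition definable_in :: "(nat \<Rightarrow> real list set set) \<Rightarrow> (real^'n::finite \<Rightarrow> real) \<Rightarrow> bool" where
  "definable_in S f \<longleftrightarrow>
     (\<exists>e. bij_betw e {..<CARD('n)} (UNIV :: 'n set) \<and>
          {coords e x @ [f x] | x. True} \<in> S (Suc CARD('n)))"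

definition definable :: "(real^'n::finite \<Rightarrow> real) \<Rightarrow> bool" where
  "definable f \<longleftrightarrow> (\<exists>S. o_minimal_structure S \<and> definable_in S f)"

definition mat_eigenvalues :: "real^'n^'n \<Rightarrow> real set" where
  "mat_eigenvalues A = {\<mu>. \<exists>v. v \<noteq> 0 \<and> A *v v = \<mu> *\<^sub>R v}"

definition lambda_min :: "real^'n^'n \<Rightarrow> real" where
  "lambda_min A = Min (mat_eigenvalues A)"

definition pos_def :: "real^'n^'n \<Rightarrow> bool" where
  "pos_def A \<longleftrightarrow> (\<forall>v. v \<noteq> 0 \<longrightarrow> v \<bullet> (A *v v) > 0)"

text \<open>g is the gradient, H the Hessian of f.\<close>

definition strict_saddle :: "(real^'n \<Rightarrow> real^'n) \<Rightarrow> (real^'n \<Rightarrow> real^'n^'n) \<Rightarrow> real^'n \<Rightarrow> bool" where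
  "strict_saddle g H z \<longleftrightarrow> g z = 0 \<and> lambda_min (H z) < 0"

definition local_min_pt :: "(real^'n \<Rightarrow> real^'n) \<Rightarrow> (real^'n \<Rightarrow> real^'n^'n) \<Rightarrow> real^'n \<Rightarrow> bool" where
  "local_min_pt g H z \<longleftrightarrow> g z = 0 \<and> pos_def (H z)"

definition strict_saddle_property :: "(real^'n \<Rightarrow> real^'n) \<Rightarrow> (real^'n \<Rightarrow> real^'n^'n) \<Rightarrow> bool" where
  "strict_saddle_property g H \<longleftrightarrow>
     (\<forall>z. g z = 0 \<longrightarrow> local_min_pt g H z \<or> strict_saddle g H z)"

text \<open>hb_pair ... k = (x_k, x_(k+1)). The step producing x_(k+2) from (x_k, x_(k+1))
  uses the parameters with index k+1.\<close>

fun hb_pair :: "(real^'n \<Rightarrow> real^'n) \<Rightarrow> real \<Rightarrow> real \<Rightarrow> (nat \<Rightarrow> real) \<Rightarrow> real^'n \<Rightarrow> real^'n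
                 \<Rightarrow> nat \<Rightarrow> (real^'n) \<times> (real^'n)" where
  "hb_pair g h \<beta> \<gamma> x0 x1 0 = (x0, x1)"
| "hb_pair g h \<beta> \<gamma> x0 x1 (Suc k) =
     (let (xp, xc) = hb_pair g h \<beta> \<gamma> x0 x1 k;
          \<alpha>k = 1 / (1 + \<gamma> (Suc k) * h);
          \<beta>k = \<beta> * h * \<alpha>k;
          sk = h^2 * \<alpha>k;
          y = xc + \<alpha>k *\<^sub>R (xc - xp) - \<beta>k *\<^sub>R (g xc - g xp)
      in (xc, y - sk *\<^sub>R g xc))"

definition hb_seq :: "(real^'n \<Rightarrow> real^'n) \<Rightarrow> real \<Rightarrow> real \<Rightarrow> (nat \<Rightarrow> real) \<Rightarrow> real^'n \<Rightarrow> real^'n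
                 \<Rightarrow> nat \<Rightarrow> real^'n" where
  "hb_seq g h \<beta> \<gamma> x0 x1 k = fst (hb_pair g h \<beta> \<gamma> x0 x1 k)"

end

theory Submission
  imports Defs
begin

text \<open>
  Along the iterates the energy \<open>f x\<^sub>k + \<kappa> |x\<^sub>k - x\<^sub>k\<^sub>-\<^sub>1|\<^sup>2\<close> decreases by at least a multiple of
  \<open>|x\<^sub>k - x\<^sub>k\<^sub>-\<^sub>1|\<^sup>2 + |x\<^sub>k\<^sub>+\<^sub>1 - x\<^sub>k|\<^sup>2\<close>, which also controls the squared gradient; this gives (i).

  For (ii), the energy is definable on the doubled space. On each level set inside a ball one selects
  the lexicographically least minimizer of the gradient norm. The coordinates of the resulting
  definable curve are monotone near the limit value, so the curve has finite length, and
  differentiating the energy along it bounds the decrease of the energy by the gradient norm times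
  the length of the corresponding arc. Telescoping yields finite length of the iterates.

  For (iii), minus the energy of the linearization at a strict saddle, slightly perturbed, is a
  quadratic form that the linearized map expands by a factor larger than one and that is positive in
  some direction. Hence orbits starting on a common line in that direction cannot both stay close to
  the saddle, so the set of trapped points has disjoint translates and is null. The iteration map is
  injective with Lipschitz inverse, so preimages of null sets are null.
\<close>

section \<open>Definability in o-minimal structures\<close>

text \<open>With inertia \<open>f\<close> alone need not decrease, so every estimate lives on pairs
  of points. Near a limit value the selected curve is known only to be monotone in each coordinate
  and may jump; hence no derivative of the curve appears, only expansions of the energy at single
  points of it, and lengths are measured by increments of a monotone function. At a saddle the
  one-step energy inequality is reused, one Hessian eigenmode at a time, on the scalar function
  \<open>\<eta> / 2 * t\<^sup>2\<close> with \<open>\<bar>\<eta>\<bar> \<le> L\<close>, which is why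
  the same constants reappear. The obstacle there is a zero eigenvalue of the Hessian: constant
  pairs in that mode are fixed by the linearization and carry no energy, so neither decrease nor
  expansion is strict. The shift \<open>\<delta>\<close> makes the form negative on them, and a
  factor \<open>\<mu> > 1\<close> makes a negative value smaller still; this produces the strict
  margin \<open>\<epsilon>\<close> that absorbs the nonlinear error.\<close>

locale o_minimal =
  fixes S :: "nat \<Rightarrow> real list set set"
  assumes o_minimal: "o_minimal_structure S"
begin

lemma sets_in_Rn: "A \<in> S n \<Longrightarrow> A \<subseteq> Rn n"
  and empty_in: "{} \<in> S n"
  and Un_in: "A \<in> S n \<Longrightarrow> B \<in> S n \<Longrightarrow> A \<union> B \<in> S n"
  and Compl_in: "A \<in> S n \<Longrightarrow> Rn n - A \<in> S n"
  and Cons_in: "A \<in> S n \<Longrightarrow> {t # xs | xs t. xs \<in> A} \<in> S (Suc n)"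
  and diag_in: "i < n \<Longrightarrow> j < n \<Longrightarrow> {xs \<in> Rn n. xs ! i = xs ! j} \<in> S n"
  and butlast_in: "B \<in> S (Suc n) \<Longrightarrow> butlast ` B \<in> S n"
  and less_in: "{[x, y] | x y. x < y} \<in> S 2"
  and add_in: "{[x, y, z] | x y z. z = x + y} \<in> S 3"
  and mult_in: "{[x, y, z] | x y z. z = x * y} \<in> S 3"
  and S1: "S 1 = {(\<lambda>t. [t]) ` U | U. finite_union_points_intervals U}"
proof -
  note * = o_minimal[unfolded o_minimal_structure_def]
  show "A \<in> S n \<Longrightarrow> A \<subseteq> Rn n" by (rule *[THEN conjunct1, rule_format])
  note * = *[THEN conjunct2]
  show "{} \<in> S n" by (rule *[THEN conjunct1, rule_format])
  note * = *[THEN conjunct2]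
  show "A \<in> S n \<Longrightarrow> B \<in> S n \<Longrightarrow> A \<union> B \<in> S n" by (rule *[THEN conjunct1, rule_format])
  note * = *[THEN conjunct2]
  show "A \<in> S n \<Longrightarrow> Rn n - A \<in> S n" by (rule *[THEN conjunct1, rule_format])
  note * = *[THEN conjunct2]
  note * = *[THEN conjunct2]
  show "A \<in> S n \<Longrightarrow> {t # xs | xs t. xs \<in> A} \<in> S (Suc n)" by (rule *[THEN conjunct1, rule_format])
  note * = *[THEN conjunct2]
  show "i < n \<Longrightarrow> j < n \<Longrightarrow> {xs \<in> Rn n. xs ! i = xs ! j} \<in> S n"
    by (rule *[THEN conjunct1, rule_format]) simp
  note * = *[THEN conjunct2]
  show "B \<in> S (Suc n) \<Longrightarrow> butlast ` B \<in> S n" by (rule *[THEN conjunct1, rule_format])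
  note * = *[THEN conjunct2]
  show "{[x, y] | x y. x < y} \<in> S 2" by (rule *[THEN conjunct1])
  note * = *[THEN conjunct2]
  show "{[x, y, z] | x y z. z = x + y} \<in> S 3" by (rule *[THEN conjunct1])
  note * = *[THEN conjunct2]
  show "{[x, y, z] | x y z. z = x * y} \<in> S 3" by (rule *[THEN conjunct1])
  show "S 1 = {(\<lambda>t. [t]) ` U | U. finite_union_points_intervals U}" by (rule *[THEN conjunct2])
qed

section \<open>Boolean operations, projections and substitution of coordinates\<close>

lemma Rn_in: "Rn n \<in> S n"
  using Compl_in[OF empty_in] by simp

lemma Int_in:
  assumes "A \<in> S n" "B \<in> S n"
  shows "A \<inter> B \<in> S n"
proof -
  have "A \<inter> B = Rn n - ((Rn n - A) \<union> (Rn n - B))"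
    using assms sets_in_Rn by blast
  then show ?thesis
    using Compl_in Un_in assms by simp
qed

lemma Ball_in:
  assumes "finite I" "\<And>i. i \<in> I \<Longrightarrow> {xs \<in> Rn n. P i xs} \<in> S n"
  shows "{xs \<in> Rn n. \<forall>i\<in>I. P i xs} \<in> S n"
  using assms
proof (induction I rule: finite_induct)
  case empty
  then show ?case using Rn_in by simp
next
  case (insert i I)
  have "{xs \<in> Rn n. \<forall>i\<in>insert i I. P i xs} = {xs \<in> Rn n. P i xs} \<inter> {xs \<in> Rn n. \<forall>i\<in>I. P i xs}"
    by auto
  then show ?case using Int_in insert by simp
qed

lemma prepend_in:
  assumes "A \<in> S m"
  shows "{ys @ zs | ys zs. ys \<in> Rn n \<and> zs \<in> A} \<in> S (n + m)"
proof (induction n)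
  case 0
  then show ?case using assms by (simp add: Rn_def)
next
  case (Suc n)
  have "{ys @ zs | ys zs. ys \<in> Rn (Suc n) \<and> zs \<in> A}
      = {t # xs | xs t. xs \<in> {ys @ zs | ys zs. ys \<in> Rn n \<and> zs \<in> A}}"
    by (auto simp: Rn_def length_Suc_conv) (metis append_Cons length_Cons)+
  then show ?case using Cons_in[OF Suc] by simp
qed

lemma take_in: "B \<in> S (n + m) \<Longrightarrow> take n ` B \<in> S n"
proof (induction m arbitrary: B)
  case 0
  have "take n ` B = B"
    using sets_in_Rn[OF 0] by (force simp: Rn_def)
  then show ?case using 0 by simp
next
  case (Suc m)
  have "take n ` (butlast ` B) \<in> S n"
    using Suc.IH[of "butlast ` B"] butlast_in[of B "n + m"] Suc.prems by simp
  moreover have "take n ` (butlast ` B) = take n ` B"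
    unfolding image_image
    by (rule image_cong) (use sets_in_Rn[OF Suc.prems] in \<open>auto simp: Rn_def take_butlast\<close>)
  ultimately show ?case by simp
qed

text \<open>The graph of the substitution is cut out of \<open>Rn n\<close> times \<open>A\<close>
  by the diagonal equations linking coordinate \<open>n + i\<close> to coordinate
  \<open>\<sigma> i\<close>, then projected. Since \<open>\<sigma>\<close> may be any map,
  permuting, repeating and adding dummy coordinates are covered at once.\<close>

lemma substitution_in:
  assumes A: "A \<in> S m" and \<sigma>: "\<And>i. i < m \<Longrightarrow> \<sigma> i < n"
  shows "{xs \<in> Rn n. map (\<lambda>i. xs ! \<sigma> i) [0..<m] \<in> A} \<in> S n"
proof -
  let ?B = "{ys @ zs | ys zs. ys \<in> Rn n \<and> zs \<in> A} \<inter> {xs \<in> Rn (n + m). \<forall>i\<in>{..<m}. xs ! (n + i) = xs ! \<sigma> i}"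
  have len: "\<And>zs. zs \<in> A \<Longrightarrow> length zs = m"
    using sets_in_Rn[OF A] by (auto simp: Rn_def)
  have "?B \<in> S (n + m)"
    by (intro Int_in prepend_in A Ball_in) (auto intro!: diag_in simp: \<sigma> trans_less_add1)
  then have "take n ` ?B \<in> S n" by (rule take_in)
  moreover have "take n ` ?B = {xs \<in> Rn n. map (\<lambda>i. xs ! \<sigma> i) [0..<m] \<in> A}" (is "_ = ?C")
  proof (intro equalityI subsetI)
    fix xs assume "xs \<in> take n ` ?B"
    then obtain zs where xs: "xs \<in> Rn n" and zs: "zs \<in> A"
      and eq: "\<forall>i<m. (xs @ zs) ! (n + i) = (xs @ zs) ! \<sigma> i"
      by (auto simp: Rn_def)
    have "map (\<lambda>i. xs ! \<sigma> i) [0..<m] = zs"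
      by (rule nth_equalityI) (use eq xs len[OF zs] \<sigma> in \<open>auto simp: Rn_def nth_append\<close>)
    then show "xs \<in> ?C" using xs zs by simp
  next
    fix xs assume xs: "xs \<in> ?C"
    let ?zs = "map (\<lambda>i. xs ! \<sigma> i) [0..<m]"
    have "xs @ ?zs \<in> ?B"
      using xs \<sigma> by (auto simp: Rn_def nth_append)
    moreover have "xs = take n (xs @ ?zs)"
      using xs by (simp add: Rn_def)
    ultimately show "xs \<in> take n ` ?B" by blast
  qed
  ultimately show ?thesis by simp
qed

text \<open>Definable sets are handled as predicates on environments assigning reals to
  de Bruijn indexed variables, of which only finitely many may matter.\<close>

definition dep_upto :: "nat \<Rightarrow> ((nat \<Rightarrow> real) \<Rightarrow> bool) \<Rightarrow> bool" where
  "dep_upto N P \<longleftrightarrow> (\<forall>v w. (\<forall>i<N. v i = w i) \<longrightarrow> P v = P w)"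

text \<open>Beyond the length of \<open>xs\<close> the environment \<open>(!) xs\<close> is
  unspecified; \<open>dep_upto\<close> makes those entries irrelevant.\<close>

definition def_upto :: "nat \<Rightarrow> ((nat \<Rightarrow> real) \<Rightarrow> bool) \<Rightarrow> bool" where
  "def_upto N P \<longleftrightarrow> dep_upto N P \<and> {xs \<in> Rn N. P ((!) xs)} \<in> S N"

definition def_pred :: "((nat \<Rightarrow> real) \<Rightarrow> bool) \<Rightarrow> bool" where
  "def_pred P \<longleftrightarrow> (\<exists>N. def_upto N P)"

text \<open>The graph of \<open>T\<close> with the value in slot 0 and the arguments shifted up, so
  that substituting a term amounts to quantifying over slot 0.\<close>

definition def_fun :: "((nat \<Rightarrow> real) \<Rightarrow> real) \<Rightarrow> bool" where
  "def_fun T \<longleftrightarrow> def_pred (\<lambda>v. v 0 = T (\<lambda>i. v (Suc i)))"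

lemma dep_uptoD: "dep_upto N P \<Longrightarrow> (\<And>i. i < N \<Longrightarrow> v i = w i) \<Longrightarrow> P v = P w"
  unfolding dep_upto_def by blast

lemma def_upto_rename:
  assumes "def_upto N P" "\<And>i. i < N \<Longrightarrow> \<sigma> i < M"
  shows "def_upto M (\<lambda>v. P (\<lambda>i. v (\<sigma> i)))"
proof -
  have dep: "dep_upto N P" and A: "{xs \<in> Rn N. P ((!) xs)} \<in> S N"
    using assms(1) by (auto simp: def_upto_def)
  have "{xs \<in> Rn M. P (\<lambda>i. xs ! \<sigma> i)} = {xs \<in> Rn M. map (\<lambda>i. xs ! \<sigma> i) [0..<N] \<in> {xs \<in> Rn N. P ((!) xs)}}"
  proof -
    have "P ((!) (map (\<lambda>i. xs ! \<sigma> i) [0..<N])) = P (\<lambda>i. xs ! \<sigma> i)" for xs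
      by (rule dep_uptoD[OF dep]) simp
    then show ?thesis by (auto simp: Rn_def)
  qed
  then have "{xs \<in> Rn M. P (\<lambda>i. xs ! \<sigma> i)} \<in> S M"
    using substitution_in[OF A assms(2)] by simp
  moreover have "dep_upto M (\<lambda>v. P (\<lambda>i. v (\<sigma> i)))"
    unfolding dep_upto_def using assms(2) by (auto intro!: dep_uptoD[OF dep])
  ultimately show ?thesis by (simp add: def_upto_def)
qed

lemma def_upto_mono: "def_upto N P \<Longrightarrow> N \<le> M \<Longrightarrow> def_upto M P"
  using def_upto_rename[of N P "\<lambda>i. i" M] by simp

lemma def_pred_rename:
  assumes "def_pred P"
  shows "def_pred (\<lambda>v. P (\<lambda>i. v (\<sigma> i)))"
proof -
  obtain N where N: "def_upto N P" using assms by (auto simp: def_pred_def)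
  have "\<sigma> i < Suc (Max (\<sigma> ` {..<N}))" if "i < N" for i
    using that by (auto intro!: le_imp_less_Suc Max_ge)
  then show ?thesis
    unfolding def_pred_def using def_upto_rename[OF N] by blast
qed

lemma def_pred_not: "def_pred P \<Longrightarrow> def_pred (\<lambda>v. \<not> P v)"
proof -
  assume "def_pred P"
  then obtain N where N: "def_upto N P" by (auto simp: def_pred_def)
  have "{xs \<in> Rn N. \<not> P ((!) xs)} = Rn N - {xs \<in> Rn N. P ((!) xs)}" by auto
  then have "def_upto N (\<lambda>v. \<not> P v)"
    using N Compl_in unfolding def_upto_def dep_upto_def by (metis (mono_tags))
  then show ?thesis by (auto simp: def_pred_def)
qed

lemma def_pred_conj:
  assumes "def_pred P" "def_pred Q"
  shows "def_pred (\<lambda>v. P v \<and> Q v)"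
proof -
  obtain N M where "def_upto N P" "def_upto M Q"
    using assms by (auto simp: def_pred_def)
  then have *: "def_upto (max N M) P" "def_upto (max N M) Q"
    by (auto intro: def_upto_mono)
  have "{xs \<in> Rn (max N M). P ((!) xs) \<and> Q ((!) xs)}
      = {xs \<in> Rn (max N M). P ((!) xs)} \<inter> {xs \<in> Rn (max N M). Q ((!) xs)}" by auto
  then have "def_upto (max N M) (\<lambda>v. P v \<and> Q v)"
    using * Int_in unfolding def_upto_def dep_upto_def by (metis (mono_tags, lifting))
  then show ?thesis by (auto simp: def_pred_def)
qed

lemma def_pred_disj: "def_pred P \<Longrightarrow> def_pred Q \<Longrightarrow> def_pred (\<lambda>v. P v \<or> Q v)"
  using def_pred_not[OF def_pred_conj[OF def_pred_not def_pred_not]] by simp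

lemma def_pred_imp: "def_pred P \<Longrightarrow> def_pred Q \<Longrightarrow> def_pred (\<lambda>v. P v \<longrightarrow> Q v)"
  unfolding imp_conv_disj by (intro def_pred_disj def_pred_not)

lemma def_pred_const: "def_pred (\<lambda>v. b)"
proof -
  have "def_upto 0 (\<lambda>v. b)"
    using Rn_in[of 0] empty_in[of 0] by (cases b) (auto simp: def_upto_def dep_upto_def)
  then show ?thesis by (auto simp: def_pred_def)
qed

lemma def_pred_Ball:
  assumes "finite I" "\<And>i. i \<in> I \<Longrightarrow> def_pred (P i)"
  shows "def_pred (\<lambda>v. \<forall>i\<in>I. P i v)"
  using assms
  by (induction I rule: finite_induct) (simp_all add: def_pred_const def_pred_conj)

lemma def_pred_Bex:
  assumes "finite I" "\<And>i. i \<in> I \<Longrightarrow> def_pred (P i)"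
  shows "def_pred (\<lambda>v. \<exists>i\<in>I. P i v)"
  using assms
  by (induction I rule: finite_induct) (simp_all add: def_pred_const def_pred_disj)

lemma def_pred_ex:
  assumes "def_pred (\<lambda>v. P (\<lambda>i. v (Suc i)) (v 0))"
  shows "def_pred (\<lambda>v. \<exists>t. P v t)"
proof -
  let ?R = "\<lambda>v. P (\<lambda>i. v (Suc i)) (v 0)"
  obtain N where "def_upto N ?R" using assms by (auto simp: def_pred_def)
  then have R: "def_upto (Suc N) ?R" by (rule def_upto_mono) simp
  have dep: "P v t = P w t" if "\<And>i. i < N \<Longrightarrow> v i = w i" for v w t
  proof -
    have "?R (case_nat t v) = ?R (case_nat t w)"
      by (rule dep_uptoD[of "Suc N"])
        (use R that in \<open>auto simp: def_upto_def split: nat.split\<close>)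
    then show ?thesis by simp
  qed
  \<comment> \<open>The bound variable sits in slot 0, but projection removes the last coordinate:
    the renaming reads slot 0 from slot \<open>N\<close> and shifts the others down.\<close>
  have "def_upto (Suc N) (\<lambda>v. ?R (\<lambda>i. v (case i of 0 \<Rightarrow> N | Suc j \<Rightarrow> j)))"
    by (rule def_upto_rename[OF R]) (auto split: nat.split)
  then have *: "{xs \<in> Rn (Suc N). P ((!) xs) (xs ! N)} \<in> S (Suc N)"
    by (simp add: def_upto_def)
  have "butlast ` {xs \<in> Rn (Suc N). P ((!) xs) (xs ! N)} = {xs \<in> Rn N. \<exists>t. P ((!) xs) t}" (is "?l = ?r")
  proof (intro equalityI subsetI)
    fix xs assume "xs \<in> ?l"
    then obtain ys where ys: "length ys = Suc N" "P ((!) ys) (ys ! N)" "xs = butlast ys"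
      by (auto simp: Rn_def)
    have "P ((!) xs) (ys ! N) = P ((!) ys) (ys ! N)"
      by (rule dep) (use ys in \<open>auto simp: nth_butlast\<close>)
    then show "xs \<in> ?r" using ys by (auto simp: Rn_def)
  next
    fix xs assume "xs \<in> ?r"
    then obtain t where t: "length xs = N" "P ((!) xs) t" by (auto simp: Rn_def)
    have "P ((!) (xs @ [t])) t = P ((!) xs) t"
      by (rule dep) (use t in \<open>auto simp: nth_append\<close>)
    moreover have "(xs @ [t]) ! N = t"
      using t by (simp add: nth_append)
    ultimately have "xs @ [t] \<in> {xs \<in> Rn (Suc N). P ((!) xs) (xs ! N)}"
      using t by (simp add: Rn_def)
    then show "xs \<in> ?l" by (metis (no_types, lifting) butlast_snoc image_eqI)
  qed
  then have "def_upto N (\<lambda>v. \<exists>t. P v t)"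
    using butlast_in[OF *] dep unfolding def_upto_def dep_upto_def by metis
  then show ?thesis by (auto simp: def_pred_def)
qed

lemma def_pred_all:
  assumes "def_pred (\<lambda>v. P (\<lambda>i. v (Suc i)) (v 0))"
  shows "def_pred (\<lambda>v. \<forall>t. P v t)"
proof -
  have "def_pred (\<lambda>v. \<not> (\<exists>t. \<not> P v t))"
    by (intro def_pred_not def_pred_ex assms)
  then show ?thesis by simp
qed

lemma def_fun_rename: "def_fun T \<Longrightarrow> def_fun (\<lambda>v. T (\<lambda>i. v (\<sigma> i)))"
  unfolding def_fun_def
  using def_pred_rename[of "\<lambda>v. v 0 = T (\<lambda>i. v (Suc i))" "case_nat 0 (\<lambda>i. Suc (\<sigma> i))"]
  by simp

lemma def_pred_subst:
  assumes "def_pred (\<lambda>v. P (\<lambda>i. v (Suc i)) (v 0))" "def_fun T"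
  shows "def_pred (\<lambda>v. P v (T v))"
proof -
  have "def_pred (\<lambda>v. \<exists>t. t = T v \<and> P v t)"
    by (intro def_pred_ex def_pred_conj assms(1) assms(2)[unfolded def_fun_def])
  then show ?thesis by simp
qed

lemma def_pred_subst2:
  assumes "def_pred (\<lambda>v. P (v 0) (v 1))" "def_fun T" "def_fun U"
  shows "def_pred (\<lambda>v. P (T v) (U v))"
proof (rule def_pred_subst[where P = "\<lambda>v. P (T v)"])
  show "def_pred (\<lambda>v. P (T (\<lambda>i. v (Suc i))) (v 0))"
  proof (rule def_pred_subst[where P = "\<lambda>v t. P t (v 0)"])
    show "def_pred (\<lambda>v. P (v 0) (v (Suc 0)))" using assms(1) by simp
    show "def_fun (\<lambda>v. T (\<lambda>i. v (Suc i)))" by (rule def_fun_rename[OF assms(2)])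
  qed
qed (rule assms(3))

lemma def_pred_less_var: "def_pred (\<lambda>v. v 0 < v 1)"
proof -
  have "{xs \<in> Rn 2. xs ! 0 < xs ! 1} = {[x, y] | x y. x < y}"
    by (auto simp: Rn_def length_Suc_conv numeral_2_eq_2)
  then have "def_upto 2 (\<lambda>v. v 0 < v 1)"
    using less_in by (simp add: def_upto_def dep_upto_def)
  then show ?thesis by (auto simp: def_pred_def)
qed

lemma def_pred_eq_var: "def_pred (\<lambda>v. v i = v j)"
proof -
  have "def_upto (Suc (max i j)) (\<lambda>v. v i = v j)"
    using diag_in[of i "Suc (max i j)" j] by (simp add: def_upto_def dep_upto_def)
  then show ?thesis by (auto simp: def_pred_def)
qed

lemma def_fun_var: "def_fun (\<lambda>v. v i)"
  unfolding def_fun_def by (rule def_pred_eq_var)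

lemma def_pred_eq: "def_fun T \<Longrightarrow> def_fun U \<Longrightarrow> def_pred (\<lambda>v. T v = U v)"
  by (rule def_pred_subst2[where P = "(=)"]) (rule def_pred_eq_var)

lemma def_pred_less: "def_fun T \<Longrightarrow> def_fun U \<Longrightarrow> def_pred (\<lambda>v. T v < U v)"
  by (rule def_pred_subst2[where P = "(<)"]) (rule def_pred_less_var)

lemma def_pred_le: "def_fun T \<Longrightarrow> def_fun U \<Longrightarrow> def_pred (\<lambda>v. T v \<le> U v)"
  using def_pred_not[OF def_pred_less[of U T]] by (simp add: not_less)

lemma def_fun_const: "def_fun (\<lambda>v. a)"
proof -
  have "finite_union_points_intervals {a}"
    unfolding finite_union_points_intervals_def by (rule exI[of _ "{{a}}"]) auto
  then have "{[a]} \<in> S 1"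
    unfolding S1 by (intro CollectI exI[of _ "{a}"]) auto
  moreover have "{xs \<in> Rn 1. xs ! 0 = a} = {[a]}"
    by (auto simp: Rn_def length_Suc_conv)
  ultimately have "def_upto 1 (\<lambda>v. v 0 = a)"
    by (simp add: def_upto_def dep_upto_def)
  then show ?thesis by (auto simp: def_pred_def def_fun_def)
qed

lemma def_fun_binary:
  assumes graph: "{[x, y, z] | x y z. z = F x y} \<in> S 3" and "def_fun T" "def_fun U"
  shows "def_fun (\<lambda>v. F (T v) (U v))"
proof -
  have "{xs \<in> Rn 3. xs ! 2 = F (xs ! 0) (xs ! 1)} = {[x, y, z] | x y z. z = F x y}"
    by (auto simp: Rn_def length_Suc_conv numeral_3_eq_3)
  then have "def_upto 3 (\<lambda>v. v 2 = F (v 0) (v 1))"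
    using graph by (simp add: def_upto_def dep_upto_def)
  then have G: "def_pred (\<lambda>v. v 2 = F (v 0) (v 1))" by (auto simp: def_pred_def)
  have "def_pred (\<lambda>v. v 0 = F (T (\<lambda>i. v (Suc i))) (U (\<lambda>i. v (Suc i))))"
  proof (rule def_pred_subst[where T = "\<lambda>v. T (\<lambda>i. v (Suc i))" and P = "\<lambda>v t. v 0 = F t (U (\<lambda>i. v (Suc i)))"])
    show "def_pred (\<lambda>v. v (Suc 0) = F (v 0) (U (\<lambda>i. v (Suc (Suc i)))))"
    proof (rule def_pred_subst[where T = "\<lambda>v. U (\<lambda>i. v (Suc (Suc i)))" and P = "\<lambda>v t. v (Suc 0) = F (v 0) t"])
      show "def_pred (\<lambda>v. v (Suc (Suc 0)) = F (v (Suc 0)) (v 0))"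
        using def_pred_rename[OF G, of "\<lambda>i. if i = 0 then 1 else if i = 1 then 0 else i"]
        by (simp add: numeral_2_eq_2)
    qed (rule def_fun_rename[OF assms(3)])
  qed (rule def_fun_rename[OF assms(2)])
  then show ?thesis by (simp add: def_fun_def)
qed

lemma def_fun_add: "def_fun T \<Longrightarrow> def_fun U \<Longrightarrow> def_fun (\<lambda>v. T v + U v)"
  by (rule def_fun_binary[OF add_in])

lemma def_fun_mult: "def_fun T \<Longrightarrow> def_fun U \<Longrightarrow> def_fun (\<lambda>v. T v * U v)"
  by (rule def_fun_binary[OF mult_in])

lemma def_fun_uminus: "def_fun T \<Longrightarrow> def_fun (\<lambda>v. - T v)"
  using def_fun_mult[OF def_fun_const[of "-1"], of T] by simp

lemma def_fun_diff: "def_fun T \<Longrightarrow> def_fun U \<Longrightarrow> def_fun (\<lambda>v. T v - U v)"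
  using def_fun_add[OF _ def_fun_uminus, of T U] by simp

lemma def_fun_sum:
  "finite I \<Longrightarrow> (\<And>i. i \<in> I \<Longrightarrow> def_fun (T i)) \<Longrightarrow> def_fun (\<lambda>v. \<Sum>i\<in>I. T i v)"
  by (induction I rule: finite_induct) (simp_all add: def_fun_const def_fun_add)

lemma def_fun_abs: "def_fun T \<Longrightarrow> def_fun (\<lambda>v. \<bar>T v\<bar>)"
proof -
  assume T: "def_fun T"
  have "def_pred (\<lambda>v. (0 \<le> T (\<lambda>i. v (Suc i)) \<and> v 0 = T (\<lambda>i. v (Suc i)))
                    \<or> (T (\<lambda>i. v (Suc i)) < 0 \<and> v 0 = - T (\<lambda>i. v (Suc i))))"
    by (intro def_pred_disj def_pred_conj def_pred_le def_pred_less def_pred_eq def_fun_const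
        def_fun_var def_fun_uminus def_fun_rename[OF T])
  then show ?thesis
    unfolding def_fun_def
    by (rule back_subst[where P = def_pred]) auto
qed

section \<open>Vector-valued terms and blocks of quantifiers\<close>

definition def_vec :: "((nat \<Rightarrow> real) \<Rightarrow> 'a::euclidean_space) \<Rightarrow> bool" where
  "def_vec X \<longleftrightarrow> (\<forall>b\<in>Basis. def_fun (\<lambda>v. X v \<bullet> b))"

lemma def_vec_add: "def_vec X \<Longrightarrow> def_vec Y \<Longrightarrow> def_vec (\<lambda>v. X v + Y v)"
  by (simp add: def_vec_def inner_add_left def_fun_add)

lemma def_vec_diff: "def_vec X \<Longrightarrow> def_vec Y \<Longrightarrow> def_vec (\<lambda>v. X v - Y v)"
  by (simp add: def_vec_def inner_diff_left def_fun_diff)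

lemma def_vec_scaleR: "def_fun T \<Longrightarrow> def_vec X \<Longrightarrow> def_vec (\<lambda>v. T v *\<^sub>R X v)"
  by (simp add: def_vec_def def_fun_mult)

lemma def_vec_const: "def_vec (\<lambda>v. a)"
  by (simp add: def_vec_def def_fun_const)

lemma def_vec_rename: "def_vec X \<Longrightarrow> def_vec (\<lambda>v. X (\<lambda>i. v (\<sigma> i)))"
  using def_fun_rename[of "\<lambda>v. X v \<bullet> _"] by (simp add: def_vec_def)

lemma def_vec_fst:
  assumes "def_vec X"
  shows "def_vec (\<lambda>v. fst (X v))"
  unfolding def_vec_def
proof
  fix b :: 'a assume "b \<in> Basis"
  then have "(b, 0) \<in> (Basis :: ('a \<times> 'b) set)" by (simp add: Basis_prod_def)
  then have "def_fun (\<lambda>v. X v \<bullet> (b, 0))" using assms unfolding def_vec_def by blast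
  then show "def_fun (\<lambda>v. fst (X v) \<bullet> b)" by (simp add: inner_prod_def)
qed

lemma def_vec_snd:
  assumes "def_vec X"
  shows "def_vec (\<lambda>v. snd (X v))"
  unfolding def_vec_def
proof
  fix b :: 'b assume "b \<in> Basis"
  then have "(0, b) \<in> (Basis :: ('a \<times> 'b) set)" by (simp add: Basis_prod_def)
  then have "def_fun (\<lambda>v. X v \<bullet> (0, b))" using assms unfolding def_vec_def by blast
  then show "def_fun (\<lambda>v. snd (X v) \<bullet> b)" by (simp add: inner_prod_def)
qed

lemma def_fun_inner: "def_vec X \<Longrightarrow> def_vec Y \<Longrightarrow> def_fun (\<lambda>v. X v \<bullet> Y v)"
  unfolding def_vec_def by (subst euclidean_inner) (intro def_fun_sum def_fun_mult; simp)

lemma def_fun_norm: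
  assumes X: "def_vec X"
  shows "def_fun (\<lambda>v. norm (X v))"
proof -
  have "def_pred (\<lambda>v. 0 \<le> v 0 \<and> v 0 * v 0 = X (\<lambda>i. v (Suc i)) \<bullet> X (\<lambda>i. v (Suc i)))"
    by (intro def_pred_conj def_pred_le def_pred_eq def_fun_const
        def_fun_var def_fun_mult def_fun_inner def_vec_rename[OF X])
  moreover have "(0 \<le> v 0 \<and> v 0 * v 0 = X (\<lambda>i. v (Suc i)) \<bullet> X (\<lambda>i. v (Suc i)))
      = (v 0 = norm (X (\<lambda>i. v (Suc i))))" for v :: "nat \<Rightarrow> real"
    by (auto simp: dot_square_norm power2_eq_square[symmetric] intro: power2_eq_imp_eq)
  ultimately show ?thesis by (simp add: def_fun_def)
qed

lemma def_vec_eq: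
  assumes X: "def_vec X" and Y: "def_vec Y"
  shows "def_pred (\<lambda>v. X v = Y v)"
proof -
  have "def_pred (\<lambda>v. \<forall>b\<in>Basis. X v \<bullet> b = Y v \<bullet> b)"
    using X Y by (intro def_pred_Ball def_pred_eq) (auto simp: def_vec_def)
  then show ?thesis by (simp add: euclidean_eq_iff[symmetric])
qed

text \<open>Quantifies \<open>n\<close> variables at once by letting a whole environment
  \<open>w\<close> vary; only its first \<open>n\<close> entries are read, and the outer environment
  is shifted past them.\<close>

lemma def_pred_ex_block:
  assumes "def_pred R"
  shows "def_pred (\<lambda>v. \<exists>w. R (\<lambda>i. if i < n then w i else v (i - n)))"
  using assms
proof (induction n arbitrary: R)
  case 0
  then show ?case by simp
next
  case (Suc n)
  have "def_pred (\<lambda>v. \<exists>t. R (case_nat t v))"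
  proof (rule def_pred_ex)
    have "case_nat (v 0) (\<lambda>i. v (Suc i)) = v" for v :: "nat \<Rightarrow> real"
      by (auto split: nat.split)
    then show "def_pred (\<lambda>v. R (case_nat (v 0) (\<lambda>i. v (Suc i))))"
      using Suc.prems by simp
  qed
  from Suc.IH[OF this]
  have *: "def_pred (\<lambda>v. \<exists>w t. R (case_nat t (\<lambda>i. if i < n then w i else v (i - n))))" .
  have "(\<exists>w t. R (case_nat t (\<lambda>i. if i < n then w i else v (i - n))))
      = (\<exists>w. R (\<lambda>i. if i < Suc n then w i else v (i - Suc n)))" (is "?l = ?r") for v
  proof
    assume ?l
    then obtain w t where wt: "R (case_nat t (\<lambda>i. if i < n then w i else v (i - n)))" by blast
    have "case_nat t (\<lambda>i. if i < n then w i else v (i - n))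
        = (\<lambda>i. if i < Suc n then case_nat t w i else v (i - Suc n))"
      by (auto split: nat.split)
    then show ?r using wt by metis
  next
    assume ?r
    then obtain w where w: "R (\<lambda>i. if i < Suc n then w i else v (i - Suc n))" by blast
    have "case_nat (w 0) (\<lambda>i. if i < n then w (Suc i) else v (i - n))
        = (\<lambda>i. if i < Suc n then w i else v (i - Suc n))"
      by (auto split: nat.split)
    then show ?l
      using w by (intro exI[of _ "\<lambda>i. w (Suc i)"] exI[of _ "w 0"]) simp
  qed
  with * show ?case by simp
qed

end

text \<open>Any fixed enumeration of \<open>Basis\<close> serves. It assigns variable slots to the
  coordinates of a vector and later also ranks them for the lexicographic order.\<close>

definition basis_index :: "'a::euclidean_space \<Rightarrow> nat" where
  "basis_index = (SOME e. bij_betw e (Basis :: 'a set) {..<DIM('a)})"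

lemma bij_basis_index: "bij_betw (basis_index :: 'a \<Rightarrow> nat) Basis {..<DIM('a::euclidean_space)}"
proof -
  have "\<exists>e. bij_betw e (Basis :: 'a set) {..<DIM('a)}"
    using ex_bij_betw_finite_nat[of "Basis :: 'a set"] by (simp add: lessThan_atLeast0)
  then show ?thesis unfolding basis_index_def by (rule someI_ex)
qed

definition vec_of :: "(nat \<Rightarrow> real) \<Rightarrow> 'a::euclidean_space" where
  "vec_of v = (\<Sum>b\<in>Basis. v (basis_index b) *\<^sub>R b)"

lemma vec_of_inner: "b \<in> Basis \<Longrightarrow> vec_of v \<bullet> b = v (basis_index b)"
  unfolding vec_of_def by (simp add: inner_sum_left_Basis)

lemma basis_index_less: "(b :: 'a::euclidean_space) \<in> Basis \<Longrightarrow> basis_index b < DIM('a)"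
  using bij_basis_index[where 'a='a] by (auto simp: bij_betw_def)

lemma vec_of_surj: "\<exists>w. (x :: 'a::euclidean_space) = vec_of w"
proof
  let ?w = "\<lambda>i. x \<bullet> inv_into Basis basis_index i"
  have "inv_into Basis basis_index (basis_index b) = b" if "b \<in> Basis" for b :: 'a
    using that bij_basis_index[where 'a='a] by (auto simp: bij_betw_def)
  then show "x = vec_of ?w"
    by (subst euclidean_eq_iff) (simp add: vec_of_inner)
qed

section \<open>Vectors as variables and definability of gradients\<close>

context o_minimal
begin

lemma def_vec_of: "def_vec (\<lambda>v. vec_of v)"
  unfolding def_vec_def by (simp add: vec_of_inner def_fun_var)

lemma def_pred_ex_vec:
  fixes P :: "(nat \<Rightarrow> real) \<Rightarrow> 'a::euclidean_space \<Rightarrow> bool"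
  assumes "def_pred (\<lambda>v. P (\<lambda>i. v (i + DIM('a))) (vec_of v))"
  shows "def_pred (\<lambda>v. \<exists>x. P v x)"
proof -
  let ?d = "DIM('a)"
  have "vec_of (\<lambda>i. if i < ?d then w i else v (i - ?d)) = (vec_of w :: 'a)" for v w :: "nat \<Rightarrow> real"
    by (rule euclidean_eqI) (simp add: vec_of_inner basis_index_less)
  then have "def_pred (\<lambda>v. \<exists>w. P v (vec_of w))"
    using def_pred_ex_block[OF assms, of ?d] by simp
  moreover have "(\<exists>w. P v (vec_of w)) = (\<exists>x. P v x)" for v
    using vec_of_surj by metis
  ultimately show ?thesis by simp
qed

lemma def_pred_all_vec:
  fixes P :: "(nat \<Rightarrow> real) \<Rightarrow> 'a::euclidean_space \<Rightarrow> bool"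
  assumes "def_pred (\<lambda>v. P (\<lambda>i. v (i + DIM('a))) (vec_of v))"
  shows "def_pred (\<lambda>v. \<forall>x. P v x)"
proof -
  have "def_pred (\<lambda>v. \<not> (\<exists>x. \<not> P v x))"
    by (intro def_pred_not def_pred_ex_vec assms)
  then show ?thesis by simp
qed

lemma def_pred_subst_vec:
  fixes X :: "(nat \<Rightarrow> real) \<Rightarrow> 'a::euclidean_space"
  assumes "def_pred (\<lambda>v. P (\<lambda>i. v (i + DIM('a))) (vec_of v))" "def_vec X"
  shows "def_pred (\<lambda>v. P v (X v))"
proof -
  have "def_pred (\<lambda>v. \<exists>x. x = X v \<and> P v x)"
    by (intro def_pred_ex_vec def_pred_conj def_vec_eq def_vec_of assms(1) def_vec_rename[OF assms(2)])
  then show ?thesis by simp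
qed

lemma def_fun_subst_vec:
  fixes X :: "(nat \<Rightarrow> real) \<Rightarrow> 'a::euclidean_space"
  assumes "def_fun (\<lambda>v. F (vec_of v :: 'a))" "def_vec X"
  shows "def_fun (\<lambda>v. F (X v))"
  unfolding def_fun_def
proof (rule def_pred_subst_vec[where P = "\<lambda>v x. v 0 = F x"])
  show "def_pred (\<lambda>v. v (0 + DIM('a)) = F (vec_of v))"
    using assms(1) by (intro def_pred_eq def_fun_var)
qed (rule def_vec_rename[OF assms(2)])

text \<open>Definability of \<open>f\<close> may refer to any enumeration \<open>e\<close> of the
  coordinates, while \<open>vec_of\<close> follows \<open>basis_index\<close>; a permutation of the
  variables reconciles the two.\<close>

lemma def_fun_of_definable_in:
  fixes f :: "real^'n::finite \<Rightarrow> real"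
  assumes "definable_in S f"
  shows "def_fun (\<lambda>v. f (vec_of v))"
proof -
  obtain e where e: "bij_betw e {..<CARD('n)} (UNIV :: 'n set)"
    and gr: "{coords e x @ [f x] | x. True} \<in> S (Suc CARD('n))"
    using assms by (auto simp: definable_in_def)
  define e' where "e' = inv_into {..<CARD('n)} e"
  have e': "e' i < CARD('n)" "e (e' i) = i" for i
    using e inv_into_into[of i e "{..<CARD('n)}"] f_inv_into_f[of i e "{..<CARD('n)}"]
    unfolding e'_def bij_betw_def by auto
  have ee: "e' (e j) = j" if "j < CARD('n)" for j
    using e that unfolding e'_def bij_betw_def by simp
  let ?P = "\<lambda>v. v CARD('n) = f (\<chi> i. v (e' i))"
  have "{xs \<in> Rn (Suc CARD('n)). ?P ((!) xs)} = {coords e x @ [f x] | x. True}" (is "?l = ?r")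
  proof (intro equalityI subsetI)
    fix xs assume "xs \<in> ?l"
    then have xs: "length xs = Suc CARD('n)" "xs ! CARD('n) = f (\<chi> i. xs ! e' i)"
      by (auto simp: Rn_def)
    have "xs = coords e (\<chi> i. xs ! e' i) @ [f (\<chi> i. xs ! e' i)]"
      by (rule nth_equalityI) (use xs ee in \<open>auto simp: coords_def nth_append less_Suc_eq\<close>)
    then show "xs \<in> ?r" by blast
  next
    fix xs assume "xs \<in> ?r"
    then obtain x where xs: "xs = coords e x @ [f x]" by blast
    have "(\<chi> i. xs ! e' i) = x"
      unfolding xs by (simp add: vec_eq_iff coords_def nth_append e')
    moreover have "xs ! CARD('n) = f x"
      unfolding xs by (simp add: coords_def nth_append)
    ultimately show "xs \<in> ?l" unfolding xs by (simp add: Rn_def coords_def)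
  qed
  moreover have "dep_upto (Suc CARD('n)) ?P"
    unfolding dep_upto_def by (simp add: e'(1) less_SucI)
  ultimately have "def_upto (Suc CARD('n)) ?P"
    using gr by (simp add: def_upto_def)
  then have P: "def_pred ?P" by (auto simp: def_pred_def)
  have [simp]: "(vec_of v :: real^'n) = (\<chi> i. v (basis_index (axis i (1::real))))" for v
    using vec_of_inner[of "axis _ 1 :: real^'n" v] by (simp add: vec_eq_iff inner_axis axis_in_Basis_iff)
  show ?thesis
    unfolding def_fun_def
    \<comment> \<open>The last entry of the graph, the value, becomes slot 0; coordinate
      \<open>j\<close> is read one past its slot in \<open>vec_of\<close>.\<close>
    using def_pred_rename[OF P, of "\<lambda>j. if j = CARD('n) then 0 else Suc (basis_index (axis (e j) (1::real) :: real^'n))"]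
    by (simp add: e' less_imp_neq[OF e'(1)])
qed

text \<open>A partial derivative is described by an epsilon-delta formula over \<open>F\<close>. The
  formula is first-order, and uniqueness of derivatives makes it the graph of the corresponding
  coordinate of \<open>G\<close>.\<close>

lemma def_fun_deriv:
  fixes F :: "'a::euclidean_space \<Rightarrow> real"
  assumes F: "def_fun (\<lambda>v. F (vec_of v))"
    and G: "\<And>x. (F has_derivative (\<lambda>y. G x \<bullet> y)) (at x)"
  shows "def_vec (\<lambda>v. G (vec_of v))"
  unfolding def_vec_def
proof
  fix b :: 'a assume b: "b \<in> Basis"
  define Q where "Q x y \<longleftrightarrow> (\<forall>\<epsilon>. 0 < \<epsilon> \<longrightarrow> (\<exists>\<delta>. 0 < \<delta> \<and> (\<forall>s. \<bar>s\<bar> < \<delta> \<longrightarrow>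
      \<bar>F (x + s *\<^sub>R b) - F x - y * s\<bar> \<le> \<epsilon> * \<bar>s\<bar>)))" for x y
  have "y = G x \<bullet> b \<longleftrightarrow> Q x y" for x y
  proof -
    have "((\<lambda>s. F (x + s *\<^sub>R b)) has_derivative (\<lambda>s. G x \<bullet> (s *\<^sub>R b))) (at 0)"
      by (rule has_derivative_compose[of "\<lambda>s. x + s *\<^sub>R b" "\<lambda>s. s *\<^sub>R b"])
        (auto intro!: derivative_eq_intros G)
    then have D: "((\<lambda>s. F (x + s *\<^sub>R b)) has_real_derivative G x \<bullet> b) (at 0)"
      by (rule has_derivative_imp_has_field_derivative) simp
    have "Q x y \<longleftrightarrow> ((\<lambda>s. F (x + s *\<^sub>R b)) has_real_derivative y) (at 0)"
      unfolding has_field_derivative_def has_derivative_within_alt Q_def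
      by (simp add: bounded_linear_mult_right)
    then show ?thesis using D DERIV_unique by blast
  qed
  moreover have "def_pred (\<lambda>v. Q (vec_of (\<lambda>i. v (Suc i))) (v 0))"
    unfolding Q_def
    by (intro def_pred_all def_pred_imp def_pred_less def_pred_ex def_pred_conj def_pred_le def_fun_abs
        def_fun_const def_fun_var def_fun_mult def_fun_diff def_fun_subst_vec[OF F] def_vec_add
        def_vec_scaleR def_vec_const def_vec_rename[OF def_vec_of])
  ultimately show "def_fun (\<lambda>v. G (vec_of v) \<bullet> b)"
    by (simp add: def_fun_def)
qed

end

section \<open>Monotonicity of definable functions of one variable\<close>

text \<open>Immediately to the right of \<open>a\<close> a single point is absent, and an interval
  is either everything or nothing; finitely many pieces are decided simultaneously. A definable
  property of one variable thus has an eventual truth value there.\<close>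

lemma finite_union_eventually_right:
  assumes "finite_union_points_intervals U"
  shows "eventually (\<lambda>t. t \<in> U) (at_right a) \<or> eventually (\<lambda>t. t \<notin> U) (at_right a)"
proof -
  obtain F where F: "finite F" "U = \<Union>F"
    and I: "\<And>I. I \<in> F \<Longrightarrow> (\<exists>p. I = {p}) \<or> (\<exists>p q :: ereal. I = {t. p < ereal t \<and> ereal t < q})"
    using assms unfolding finite_union_points_intervals_def by auto
  have piece: "eventually (\<lambda>t. t \<in> I) (at_right a) \<or> eventually (\<lambda>t. t \<notin> I) (at_right a)"
    if "I \<in> F" for I
  proof -
    have pt: "eventually (\<lambda>t. t \<notin> {p}) (at_right a)" for p :: real
      using eventually_neq_at_within by auto
    have "eventually (\<lambda>t. t \<in> {t. p < ereal t \<and> ereal t < q}) (at_right a)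
        \<or> eventually (\<lambda>t. t \<notin> {t. p < ereal t \<and> ereal t < q}) (at_right a)" for p q :: ereal
    proof -
      have lim: "((\<lambda>t. ereal t) \<longlongrightarrow> ereal a) (at_right a)" by (intro tendsto_intros)
      have gt: "eventually (\<lambda>t. ereal a < ereal t) (at_right a)"
        by (simp add: eventually_at_right_less)
      consider "p \<le> ereal a" "ereal a < q" | "ereal a < p" | "q \<le> ereal a" by fastforce
      then show ?thesis
      proof cases
        case 1
        have "eventually (\<lambda>t. ereal t < q) (at_right a)"
          using order_tendstoD(2)[OF lim 1(2)] .
        with gt have "eventually (\<lambda>t. t \<in> {t. p < ereal t \<and> ereal t < q}) (at_right a)"
          by eventually_elim (use 1 in \<open>blast intro: le_less_trans\<close>)
        then show ?thesis ..
      next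
        case 2
        have "eventually (\<lambda>t. t \<notin> {t. p < ereal t \<and> ereal t < q}) (at_right a)"
          using order_tendstoD(2)[OF lim 2] by eventually_elim auto
        then show ?thesis ..
      next
        case 3
        have "eventually (\<lambda>t. t \<notin> {t. p < ereal t \<and> ereal t < q}) (at_right a)"
          using gt by eventually_elim (use 3 in \<open>auto dest: le_less_trans less_trans simp del: less_ereal.simps\<close>)
        then show ?thesis ..
      qed
    qed
    then show ?thesis
      using I[OF that]
      by (elim disjE exE) (use pt in blast, simp only: simp_thms)
  qed
  show ?thesis
  proof (cases "\<exists>I\<in>F. eventually (\<lambda>t. t \<in> I) (at_right a)")
    case True
    then obtain I where "I \<in> F" "eventually (\<lambda>t. t \<in> I) (at_right a)" by blast
    then have "eventually (\<lambda>t. t \<in> U) (at_right a)"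
      using F(2) by (auto elim: eventually_mono)
    then show ?thesis ..
  next
    case False
    then have "\<forall>I\<in>F. eventually (\<lambda>t. t \<notin> I) (at_right a)" using piece by blast
    then have "eventually (\<lambda>t. \<forall>I\<in>F. t \<notin> I) (at_right a)"
      using F(1) by (simp add: eventually_ball_finite)
    then show ?thesis using F(2) by (auto elim: eventually_mono)
  qed
qed

text \<open>Supremum argument without continuity: the left condition puts the supremum of
  \<open>Z\<close> into \<open>Z\<close>, the right condition pushes it past every point below
  \<open>y\<close>.\<close>

lemma mono_on_of_local:
  fixes \<phi> :: "real \<Rightarrow> real"
  assumes "\<And>t. t \<in> {a<..<b} \<Longrightarrow> eventually (\<lambda>s. \<phi> t \<le> \<phi> s) (at_right t)"
    and "\<And>t. t \<in> {a<..<b} \<Longrightarrow> eventually (\<lambda>s. \<phi> s \<le> \<phi> t) (at_left t)"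
  shows "mono_on {a<..<b} \<phi>"
proof (rule mono_onI)
  fix x y assume x: "x \<in> {a<..<b}" and y: "y \<in> {a<..<b}" and xy: "x \<le> y"
  define Z where "Z = {z \<in> {x..y}. \<phi> x \<le> \<phi> z}"
  define \<sigma> where "\<sigma> = Sup Z"
  have xZ: "x \<in> Z" and bd: "bdd_above Z" using xy by (auto simp: Z_def)
  have \<sigma>: "x \<le> \<sigma>" "\<sigma> \<le> y"
    unfolding \<sigma>_def using xZ bd by (auto intro: cSup_upper cSup_least simp: Z_def)
  then have \<sigma>ab: "\<sigma> \<in> {a<..<b}" using x y by auto
  have \<sigma>Z: "\<sigma> \<in> Z"
  proof (rule ccontr)
    assume n: "\<sigma> \<notin> Z"
    obtain l where l: "l < \<sigma>" "\<And>s. l < s \<Longrightarrow> s < \<sigma> \<Longrightarrow> \<phi> s \<le> \<phi> \<sigma>"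
      using assms(2)[OF \<sigma>ab] by (auto simp: eventually_at_left_field)
    obtain z where z: "z \<in> Z" "l < z"
      using less_cSupD[of Z l] xZ l(1) unfolding \<sigma>_def by auto
    then have "z < \<sigma>" using n cSup_upper[OF z(1) bd] unfolding \<sigma>_def by (metis order_less_le)
    then have "\<phi> x \<le> \<phi> \<sigma>" using l(2)[OF z(2)] z by (auto simp: Z_def)
    then show False using n \<sigma> by (auto simp: Z_def)
  qed
  show "\<phi> x \<le> \<phi> y"
  proof (rule ccontr)
    assume "\<not> \<phi> x \<le> \<phi> y"
    then have "\<sigma> < y" using \<sigma>Z \<sigma> by (auto simp: Z_def order_less_le)
    obtain r where r: "r > \<sigma>" "\<And>s. \<sigma> < s \<Longrightarrow> s < r \<Longrightarrow> \<phi> \<sigma> \<le> \<phi> s"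
      using assms(1)[OF \<sigma>ab] by (auto simp: eventually_at_right_field)
    obtain s where s: "\<sigma> < s" "s < min r y" using dense r(1) \<open>\<sigma> < y\<close> by (metis min_less_iff_conj)
    then have "\<phi> x \<le> \<phi> s" using r(2)[of s] \<sigma>Z by (auto simp: Z_def)
    then have "s \<in> Z" using s \<sigma> by (auto simp: Z_def)
    then show False using cSup_upper[OF _ bd] s(1) unfolding \<sigma>_def by fastforce
  qed
qed

text \<open>Such a point is the only strict minimizer of \<open>\<phi>\<close> in some interval with
  rational endpoints, and there are countably many of these intervals.\<close>

lemma countable_strict_local_minima:
  fixes \<phi> :: "real \<Rightarrow> real"
  shows "countable {t. eventually (\<lambda>s. \<phi> t < \<phi> s) (at_left t) \<and> eventually (\<lambda>s. \<phi> t < \<phi> s) (at_right t)}"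
    (is "countable ?M")
proof -
  define T where "T = (\<lambda>(p, q). {t. p < t \<and> t < q \<and> (\<forall>s. p < s \<and> s < q \<and> s \<noteq> t \<longrightarrow> \<phi> t < \<phi> s)})"
  have "?M \<subseteq> (\<Union>pq \<in> \<rat> \<times> \<rat>. T pq)"
  proof
    fix t assume "t \<in> ?M"
    then obtain l r where l: "l < t" "\<And>s. l < s \<Longrightarrow> s < t \<Longrightarrow> \<phi> t < \<phi> s"
      and r: "t < r" "\<And>s. t < s \<Longrightarrow> s < r \<Longrightarrow> \<phi> t < \<phi> s"
      by (auto simp: eventually_at_left_field eventually_at_right_field)
    obtain p q where pq: "p \<in> \<rat>" "l < p" "p < t" "q \<in> \<rat>" "t < q" "q < r"
      using Rats_dense_in_real l(1) r(1) by metis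
    have "t \<in> T (p, q)"
      unfolding T_def using pq l(2) r(2) by (auto simp: neq_iff)
    then show "t \<in> (\<Union>pq \<in> \<rat> \<times> \<rat>. T pq)" using pq by blast
  qed
  moreover have "countable (T pq)" for pq
  proof -
    have "x = y" if "x \<in> T pq" "y \<in> T pq" for x y
    proof (rule ccontr)
      assume "x \<noteq> y"
      then have "\<phi> x < \<phi> y" "\<phi> y < \<phi> x"
        using that unfolding T_def by (auto split: prod.splits)
      then show False by simp
    qed
    then have "T pq \<subseteq> {SOME x. x \<in> T pq}" using someI[of "\<lambda>x. x \<in> T pq"] by blast
    then show ?thesis by (rule countable_subset) simp
  qed
  ultimately show ?thesis
    by (meson countable_SIGMA countable_UN countable_rat countable_subset)
qed

context o_minimal
begin

lemma def_pred_eventually_right: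
  assumes "def_pred (\<lambda>v. P (v 0))"
  shows "eventually P (at_right a) \<or> eventually (\<lambda>t. \<not> P t) (at_right a)"
proof -
  obtain N where N: "def_upto N (\<lambda>v. P (v 0))" using assms by (auto simp: def_pred_def)
  have "def_upto 1 (\<lambda>v. P (v 0))"
    using def_upto_rename[OF N, of "\<lambda>_. 0" 1] by simp
  then have "{xs \<in> Rn 1. P (xs ! 0)} \<in> S 1" by (simp add: def_upto_def)
  then obtain U where U: "finite_union_points_intervals U" "{xs \<in> Rn 1. P (xs ! 0)} = (\<lambda>t. [t]) ` U"
    unfolding S1 by blast
  have "P t \<longleftrightarrow> t \<in> U" for t
  proof -
    have "P t \<longleftrightarrow> [t] \<in> {xs \<in> Rn 1. P (xs ! 0)}" by (simp add: Rn_def)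
    also have "\<dots> \<longleftrightarrow> t \<in> U" unfolding U(2) by auto
    finally show ?thesis .
  qed
  then have "P = (\<lambda>t. t \<in> U)" by blast
  then show ?thesis using finite_union_eventually_right[OF U(1)] by simp
qed

lemma def_pred_eventually_left:
  assumes "def_pred (\<lambda>v. P (v 0))"
  shows "eventually P (at_left a) \<or> eventually (\<lambda>t. \<not> P t) (at_left a)"
proof -
  have "def_pred (\<lambda>v. P (- v 0))"
    by (rule def_pred_subst[where P = "\<lambda>v t. P t"]) (auto intro!: assms def_fun_uminus def_fun_var)
  from def_pred_eventually_right[OF this, of "- a"] show ?thesis
    by (simp add: at_left_minus[of a] eventually_filtermap)
qed

text \<open>Over the reals, o-minimality is only needed to sort the points by the one-sided signs of
  \<open>\<phi> s - \<phi> t\<close>: strict local extrema are countably many, hence do not fill an interval.\<close>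

theorem def_fun_eventually_monotone:
  assumes \<phi>: "def_fun (\<lambda>v. \<phi> (v 0))"
  shows "\<exists>\<epsilon>>0. mono_on {a<..<a+\<epsilon>} \<phi> \<or> antimono_on {a<..<a+\<epsilon>} \<phi>"
proof -
  \<comment> \<open>For fixed \<open>t\<close>, o-minimality makes the sign of
    \<open>\<phi> s - \<phi> t\<close> eventually constant on each side of \<open>t\<close>.\<close>
  have tri: "eventually (\<lambda>s. \<phi> t < \<phi> s) F \<or> eventually (\<lambda>s. \<phi> t = \<phi> s) F \<or> eventually (\<lambda>s. \<phi> s < \<phi> t) F"
    if "F = at_left t \<or> F = at_right t" for t F
  proof -
    have 1: "def_pred (\<lambda>v. \<phi> t < \<phi> (v 0))" "def_pred (\<lambda>v. \<phi> t = \<phi> (v 0))"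
      by (intro def_pred_less def_pred_eq def_fun_const \<phi>)+
    have "eventually (\<lambda>s. \<phi> t < \<phi> s) F \<or> eventually (\<lambda>s. \<not> \<phi> t < \<phi> s) F"
      and "eventually (\<lambda>s. \<phi> t = \<phi> s) F \<or> eventually (\<lambda>s. \<not> \<phi> t = \<phi> s) F"
      using that def_pred_eventually_right[OF 1(1)] def_pred_eventually_left[OF 1(1)]
        def_pred_eventually_right[OF 1(2)] def_pred_eventually_left[OF 1(2)] by blast+
    moreover have "eventually (\<lambda>s. \<phi> s < \<phi> t) F"
      if "eventually (\<lambda>s. \<not> \<phi> t < \<phi> s) F" "eventually (\<lambda>s. \<not> \<phi> t = \<phi> s) F"
      using that by eventually_elim auto
    ultimately show ?thesis by blast
  qed
  \<comment> \<open>The same dichotomy one level up: which sign occurs next to \<open>t\<close> is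
    itself a definable property of \<open>t\<close>, hence settled as \<open>t\<close> tends to
    \<open>a\<close> from the right.\<close>
  have right: "eventually (\<lambda>t. eventually (\<lambda>s. R (\<phi> t) (\<phi> s)) (at_right t)) (at_right a)
      \<or> eventually (\<lambda>t. \<not> eventually (\<lambda>s. R (\<phi> t) (\<phi> s)) (at_right t)) (at_right a)"
    and left: "eventually (\<lambda>t. eventually (\<lambda>s. R (\<phi> t) (\<phi> s)) (at_left t)) (at_right a)
      \<or> eventually (\<lambda>t. \<not> eventually (\<lambda>s. R (\<phi> t) (\<phi> s)) (at_left t)) (at_right a)"
    if R: "\<And>T U. def_fun T \<Longrightarrow> def_fun U \<Longrightarrow> def_pred (\<lambda>v. R (T v) (U v))" for R
  proof -
    have \<phi>': "def_fun (\<lambda>v. \<phi> (v i))" for i using def_fun_rename[OF \<phi>, of "\<lambda>_. i"] by simp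
    have "def_pred (\<lambda>v. \<exists>r. v 0 < r \<and> (\<forall>s. v 0 < s \<longrightarrow> s < r \<longrightarrow> R (\<phi> (v 0)) (\<phi> s)))"
      by (intro def_pred_ex def_pred_conj def_pred_all def_pred_imp def_pred_less def_fun_var R \<phi>')
    from def_pred_eventually_right[OF this, of a]
    show "eventually (\<lambda>t. eventually (\<lambda>s. R (\<phi> t) (\<phi> s)) (at_right t)) (at_right a)
      \<or> eventually (\<lambda>t. \<not> eventually (\<lambda>s. R (\<phi> t) (\<phi> s)) (at_right t)) (at_right a)"
      by (simp only: eventually_at_right_field)
    have "def_pred (\<lambda>v. \<exists>r. r < v 0 \<and> (\<forall>s. r < s \<longrightarrow> s < v 0 \<longrightarrow> R (\<phi> (v 0)) (\<phi> s)))"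
      by (intro def_pred_ex def_pred_conj def_pred_all def_pred_imp def_pred_less def_fun_var R \<phi>')
    from def_pred_eventually_right[OF this, of a]
    show "eventually (\<lambda>t. eventually (\<lambda>s. R (\<phi> t) (\<phi> s)) (at_left t)) (at_right a)
      \<or> eventually (\<lambda>t. \<not> eventually (\<lambda>s. R (\<phi> t) (\<phi> s)) (at_left t)) (at_right a)"
      by (simp only: eventually_at_left_field)
  qed
  have one: "eventually (\<lambda>t. A t) (at_right a) \<or> eventually (\<lambda>t. B t) (at_right a) \<or> eventually (\<lambda>t. C t) (at_right a)"
    if "\<And>t. A t \<or> B t \<or> C t"
      "eventually (\<lambda>t. A t) (at_right a) \<or> eventually (\<lambda>t. \<not> A t) (at_right a)"
      "eventually (\<lambda>t. B t) (at_right a) \<or> eventually (\<lambda>t. \<not> B t) (at_right a)" for A B C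
  proof -
    have "eventually C (at_right a)"
      if "eventually (\<lambda>t. \<not> A t) (at_right a)" "eventually (\<lambda>t. \<not> B t) (at_right a)"
      using that by eventually_elim (use \<open>\<And>t. A t \<or> B t \<or> C t\<close> in blast)
    then show ?thesis using that by blast
  qed
  have R: "eventually (\<lambda>t. eventually (\<lambda>s. \<phi> t < \<phi> s) (at_right t)) (at_right a) \<or>
        eventually (\<lambda>t. eventually (\<lambda>s. \<phi> t = \<phi> s) (at_right t)) (at_right a) \<or>
        eventually (\<lambda>t. eventually (\<lambda>s. \<phi> s < \<phi> t) (at_right t)) (at_right a)"
    by (rule one[OF _ right[OF def_pred_less] right[OF def_pred_eq]]) (use tri in auto)
  have L: "eventually (\<lambda>t. eventually (\<lambda>s. \<phi> t < \<phi> s) (at_left t)) (at_right a) \<or>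
        eventually (\<lambda>t. eventually (\<lambda>s. \<phi> t = \<phi> s) (at_left t)) (at_right a) \<or>
        eventually (\<lambda>t. eventually (\<lambda>s. \<phi> s < \<phi> t) (at_left t)) (at_right a)"
    by (rule one[OF _ left[OF def_pred_less] left[OF def_pred_eq]]) (use tri in auto)
  have common: "\<exists>\<epsilon>>0. \<forall>t\<in>{a<..<a+\<epsilon>}. A t \<and> B t"
    if "eventually A (at_right a)" "eventually B (at_right a)" for A B
  proof -
    have "eventually (\<lambda>t. A t \<and> B t) (at_right a)" using that by (rule eventually_conj)
    then obtain b where "b > a" "\<And>t. a < t \<Longrightarrow> t < b \<Longrightarrow> A t \<and> B t"
      by (auto simp: eventually_at_right_field)
    then show ?thesis by (intro exI[of _ "b - a"]) auto
  qed
  have inc: ?thesis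
    if "eventually (\<lambda>t. eventually (\<lambda>s. \<phi> t \<le> \<phi> s) (at_right t)) (at_right a)"
      "eventually (\<lambda>t. eventually (\<lambda>s. \<phi> s \<le> \<phi> t) (at_left t)) (at_right a)"
    using common[OF that] mono_on_of_local by blast
  have dec: ?thesis
    if h1: "eventually (\<lambda>t. eventually (\<lambda>s. \<phi> s \<le> \<phi> t) (at_right t)) (at_right a)"
      and h2: "eventually (\<lambda>t. eventually (\<lambda>s. \<phi> t \<le> \<phi> s) (at_left t)) (at_right a)"
  proof -
    obtain \<epsilon> where \<epsilon>: "\<epsilon> > 0" "\<And>t. t \<in> {a<..<a+\<epsilon>} \<Longrightarrow> eventually (\<lambda>s. \<phi> s \<le> \<phi> t) (at_right t)"
      "\<And>t. t \<in> {a<..<a+\<epsilon>} \<Longrightarrow> eventually (\<lambda>s. \<phi> t \<le> \<phi> s) (at_left t)"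
      using common[OF h1 h2] by blast
    have "mono_on {a<..<a+\<epsilon>} (\<lambda>t. - \<phi> t)"
      by (rule mono_on_of_local) (use \<epsilon> in auto)
    then have "antimono_on {a<..<a+\<epsilon>} \<phi>" by (auto simp: monotone_on_def)
    then show ?thesis using \<epsilon>(1) by blast
  qed
  have minima: False
    if h1: "eventually (\<lambda>t. eventually (\<lambda>s. \<psi> t < \<psi> s) (at_right t)) (at_right a)"
      and h2: "eventually (\<lambda>t. eventually (\<lambda>s. \<psi> t < \<psi> s) (at_left t)) (at_right a)" for \<psi> :: "real \<Rightarrow> real"
  proof -
    obtain \<epsilon> where \<epsilon>: "\<epsilon> > 0"
      and "\<forall>t\<in>{a<..<a+\<epsilon>}. eventually (\<lambda>s. \<psi> t < \<psi> s) (at_right t) \<and> eventually (\<lambda>s. \<psi> t < \<psi> s) (at_left t)"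
      using common[OF h1 h2] by blast
    then have "{a<..<a+\<epsilon>} \<subseteq> {t. eventually (\<lambda>s. \<psi> t < \<psi> s) (at_left t) \<and> eventually (\<lambda>s. \<psi> t < \<psi> s) (at_right t)}"
      by blast
    then have "countable {a<..<a+\<epsilon>}" using countable_strict_local_minima countable_subset by blast
    then show False using uncountable_open_interval \<epsilon> by (metis less_add_same_cancel1)
  qed
  have maxima: False
    if "eventually (\<lambda>t. eventually (\<lambda>s. \<phi> s < \<phi> t) (at_right t)) (at_right a)"
      "eventually (\<lambda>t. eventually (\<lambda>s. \<phi> s < \<phi> t) (at_left t)) (at_right a)"
    using minima[of "\<lambda>t. - \<phi> t"] that by simp
  have weaken: "eventually (\<lambda>t. eventually (A t) (F t)) (at_right a) \<Longrightarrow> (\<And>t s. A t s \<Longrightarrow> B t s)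
      \<Longrightarrow> eventually (\<lambda>t. eventually (B t) (F t)) (at_right a)" for A B and F :: "real \<Rightarrow> real filter"
    by (auto elim!: eventually_mono)
  have Rge: "eventually (\<lambda>t. eventually (\<lambda>s. \<phi> t \<le> \<phi> s) (at_right t)) (at_right a)"
    if "eventually (\<lambda>t. eventually (\<lambda>s. \<phi> t < \<phi> s) (at_right t)) (at_right a) \<or>
        eventually (\<lambda>t. eventually (\<lambda>s. \<phi> t = \<phi> s) (at_right t)) (at_right a)"
    using that by (auto elim!: weaken)
  have Rle: "eventually (\<lambda>t. eventually (\<lambda>s. \<phi> s \<le> \<phi> t) (at_right t)) (at_right a)"
    if "eventually (\<lambda>t. eventually (\<lambda>s. \<phi> s < \<phi> t) (at_right t)) (at_right a) \<or>
        eventually (\<lambda>t. eventually (\<lambda>s. \<phi> t = \<phi> s) (at_right t)) (at_right a)"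
    using that by (auto elim!: weaken)
  have Lge: "eventually (\<lambda>t. eventually (\<lambda>s. \<phi> t \<le> \<phi> s) (at_left t)) (at_right a)"
    if "eventually (\<lambda>t. eventually (\<lambda>s. \<phi> t < \<phi> s) (at_left t)) (at_right a) \<or>
        eventually (\<lambda>t. eventually (\<lambda>s. \<phi> t = \<phi> s) (at_left t)) (at_right a)"
    using that by (auto elim!: weaken)
  have Lle: "eventually (\<lambda>t. eventually (\<lambda>s. \<phi> s \<le> \<phi> t) (at_left t)) (at_right a)"
    if "eventually (\<lambda>t. eventually (\<lambda>s. \<phi> s < \<phi> t) (at_left t)) (at_right a) \<or>
        eventually (\<lambda>t. eventually (\<lambda>s. \<phi> t = \<phi> s) (at_left t)) (at_right a)"
    using that by (auto elim!: weaken)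
  \<comment> \<open>Of the nine combinations of right and left signs, seven give local monotonicity
    in one direction. The other two make every point of an interval a strict local extremum, which
    is impossible since an interval is uncountable.\<close>
  show ?thesis
    using R L inc[OF Rge Lle] dec[OF Rle Lge] minima maxima by blast
qed

end

section \<open>The Kurdyka--Lojasiewicz inequality\<close>

text \<open>\<open>V\<close> may jump, so no mean value theorem applies; being monotone, it only
  jumps upwards. Therefore the supremum of the good points \<open>Z\<close> is itself good, and it
  cannot lie before \<open>b\<close>.\<close>

lemma growth_from_right_growth:
  fixes V :: "real \<Rightarrow> real"
  assumes ab: "a \<le> b" and mono: "mono_on {a..b} V" and K: "K > 0"
    and loc: "\<And>t. a \<le> t \<Longrightarrow> t < b \<Longrightarrow> eventually (\<lambda>s. K * (s - t) \<le> V s - V t) (at_right t)"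
  shows "K * (b - a) \<le> V b - V a"
proof -
  define Z where "Z = {z \<in> {a..b}. K * (z - a) \<le> V z - V a}"
  define \<sigma> where "\<sigma> = Sup Z"
  have aZ: "a \<in> Z" and bd: "bdd_above Z" using ab by (auto simp: Z_def)
  have \<sigma>: "a \<le> \<sigma>" "\<sigma> \<le> b"
    unfolding \<sigma>_def using aZ by (rule cSup_upper[OF _ bd], intro cSup_least) (auto simp: Z_def)
  have "\<sigma> \<le> a + (V \<sigma> - V a) / K"
    unfolding \<sigma>_def
  proof (rule cSup_least)
    fix z assume z: "z \<in> Z"
    then have "z \<le> \<sigma>" unfolding \<sigma>_def using bd by (rule cSup_upper)
    then have "V z \<le> V \<sigma>" using mono_onD[OF mono, of z \<sigma>] z \<sigma> by (auto simp: Z_def)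
    then have "K * (z - a) \<le> V \<sigma> - V a" using z by (auto simp: Z_def)
    then show "z \<le> a + (V (Sup Z) - V a) / K" using K by (simp add: field_simps \<sigma>_def)
  qed (use aZ in auto)
  then have \<sigma>K: "K * (\<sigma> - a) \<le> V \<sigma> - V a" using K by (simp add: field_simps)
  have "\<sigma> = b"
  proof (rule ccontr)
    assume "\<sigma> \<noteq> b"
    then have "\<sigma> < b" using \<sigma> by simp
    obtain r where r: "r > \<sigma>" "\<And>s. \<sigma> < s \<Longrightarrow> s < r \<Longrightarrow> K * (s - \<sigma>) \<le> V s - V \<sigma>"
      using loc[OF \<sigma>(1) \<open>\<sigma> < b\<close>] by (auto simp: eventually_at_right_field)
    obtain s where s: "\<sigma> < s" "s < min r b" using dense r(1) \<open>\<sigma> < b\<close> by (metis min_less_iff_conj)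
    have "K * (s - a) \<le> V s - V a" using r(2)[of s] s \<sigma>K by (simp add: algebra_simps)
    then have "s \<in> Z" using s \<sigma> by (auto simp: Z_def)
    then show False using cSup_upper[OF _ bd] s(1) unfolding \<sigma>_def by fastforce
  qed
  then show ?thesis using \<sigma>K by simp
qed

text \<open>Serves as definable choice: taking the least minimizer in this order, instead of an
  arbitrary one, keeps the selected curve definable.\<close>

definition lex_le :: "'a::euclidean_space \<Rightarrow> 'a \<Rightarrow> bool" where
  "lex_le x y \<longleftrightarrow> x = y \<or> (\<exists>b\<in>Basis. x \<bullet> b < y \<bullet> b \<and>
     (\<forall>b'\<in>Basis. basis_index b' < basis_index b \<longrightarrow> x \<bullet> b' = y \<bullet> b'))"

lemma lex_le_antisym:
  assumes "lex_le x y" "lex_le y x"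
  shows "x = y"
proof (rule ccontr)
  assume "x \<noteq> y"
  then obtain b c where b: "b \<in> Basis" "x \<bullet> b < y \<bullet> b"
      "\<And>b'. b' \<in> Basis \<Longrightarrow> basis_index b' < basis_index b \<Longrightarrow> x \<bullet> b' = y \<bullet> b'"
    and c: "c \<in> Basis" "y \<bullet> c < x \<bullet> c"
      "\<And>b'. b' \<in> Basis \<Longrightarrow> basis_index b' < basis_index c \<Longrightarrow> y \<bullet> b' = x \<bullet> b'"
    using assms unfolding lex_le_def by metis
  have "basis_index b = basis_index c"
    using b c by (metis less_irrefl linorder_neqE_nat)
  then have "b = c"
    using bij_basis_index[where 'a='a] b(1) c(1) unfolding bij_betw_def by (meson inj_onD)
  then show False using b(2) c(2) by simp
qed

text \<open>Minimizes the coordinates one after the other in the order of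
  \<open>basis_index\<close>; each round leaves a nonempty compact set.\<close>

lemma compact_lex_min:
  fixes M :: "'a::euclidean_space set"
  assumes "compact M" "M \<noteq> {}"
  obtains x where "x \<in> M" "\<And>y. y \<in> M \<Longrightarrow> lex_le x y"
proof -
  \<comment> \<open>Invariant after \<open>k\<close> rounds: a survivor is lexicographically below
    every point of \<open>M\<close>, except possibly survivors that agree with it in the first
    \<open>k\<close> coordinates.\<close>
  have "\<exists>N. N \<subseteq> M \<and> compact N \<and> N \<noteq> {} \<and> (\<forall>x\<in>N. \<forall>y\<in>M. lex_le x y \<or>
      (y \<in> N \<and> (\<forall>b\<in>Basis. basis_index b < k \<longrightarrow> x \<bullet> b = y \<bullet> b)))" if "k \<le> DIM('a)" for k
    using that
  proof (induction k)
    case 0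
    then show ?case using assms by (intro exI[of _ M]) auto
  next
    case (Suc k)
    then obtain N where N: "N \<subseteq> M" "compact N" "N \<noteq> {}"
      and le: "\<And>x y. x \<in> N \<Longrightarrow> y \<in> M \<Longrightarrow> lex_le x y \<or>
        (y \<in> N \<and> (\<forall>b\<in>Basis. basis_index b < k \<longrightarrow> x \<bullet> b = y \<bullet> b))"
      by (metis Suc_leD)
    have "k \<in> basis_index ` (Basis :: 'a set)"
      using bij_basis_index[where 'a='a] Suc.prems by (auto simp: bij_betw_def)
    then obtain b :: 'a where b: "b \<in> Basis" "basis_index b = k" by blast
    have uniq: "c = b" if "c \<in> Basis" "basis_index c = k" for c :: 'a
      using bij_basis_index[where 'a='a] b that unfolding bij_betw_def by (meson inj_onD)
    obtain x0 where x0: "x0 \<in> N" "\<And>y. y \<in> N \<Longrightarrow> x0 \<bullet> b \<le> y \<bullet> b"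
      using continuous_attains_inf[OF N(2,3), of "\<lambda>x. x \<bullet> b"] by (force intro: continuous_intros)
    let ?N = "N \<inter> {x. x \<bullet> b = x0 \<bullet> b}"
    have "closed {x. x \<bullet> b = x0 \<bullet> b}" by (intro closed_Collect_eq continuous_intros)
    then have "compact ?N" using N(2) by (intro compact_Int_closed)
    moreover have "lex_le x y \<or> (y \<in> ?N \<and> (\<forall>c\<in>Basis. basis_index c < Suc k \<longrightarrow> x \<bullet> c = y \<bullet> c))"
      if x: "x \<in> ?N" and y: "y \<in> M" for x y
    proof (rule disjCI)
      assume n: "\<not> (y \<in> ?N \<and> (\<forall>c\<in>Basis. basis_index c < Suc k \<longrightarrow> x \<bullet> c = y \<bullet> c))"
      show "lex_le x y"
      proof (rule ccontr)
        assume nl: "\<not> lex_le x y"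
        then have yN: "y \<in> N" and eq: "\<And>c. c \<in> Basis \<Longrightarrow> basis_index c < k \<Longrightarrow> x \<bullet> c = y \<bullet> c"
          using le[of x y] x y by auto
        have "x \<bullet> b \<le> y \<bullet> b" using x x0(2)[OF yN] by auto
        moreover have "\<not> x \<bullet> b < y \<bullet> b"
          using nl b eq unfolding lex_le_def by blast
        ultimately have "x \<bullet> b = y \<bullet> b" by simp
        then have "y \<in> ?N \<and> (\<forall>c\<in>Basis. basis_index c < Suc k \<longrightarrow> x \<bullet> c = y \<bullet> c)"
          using yN x eq uniq by (auto simp: less_Suc_eq)
        then show False using n by blast
      qed
    qed
    ultimately show ?case
      using N(1) x0(1) by (intro exI[of _ ?N]) auto
  qed
  from this[OF order_refl] obtain N where N: "N \<subseteq> M" "N \<noteq> {}"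
    and N': "\<forall>x\<in>N. \<forall>y\<in>M. lex_le x y \<or>
      (y \<in> N \<and> (\<forall>b\<in>Basis. basis_index b < DIM('a) \<longrightarrow> x \<bullet> b = y \<bullet> b))"
    by (elim exE conjE)
  have le: "lex_le x y \<or> (\<forall>b\<in>Basis. x \<bullet> b = y \<bullet> b)" if "x \<in> N" "y \<in> M" for x y
    using N'[rule_format, OF that] by (auto simp: basis_index_less)
  obtain x where x: "x \<in> N" using N(2) by blast
  have "lex_le x y" if "y \<in> M" for y
    using le[OF x that] by (auto simp: lex_le_def euclidean_eq_iff[symmetric])
  then show thesis using that x N(1) by blast
qed

context o_minimal
begin

lemma def_pred_lex_le:
  assumes "def_vec X" "def_vec Y"
  shows "def_pred (\<lambda>v. lex_le (X v) (Y v))"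
proof -
  have *: "def_fun (\<lambda>v. X v \<bullet> b)" "def_fun (\<lambda>v. Y v \<bullet> b)" if "b \<in> Basis" for b
    using assms that by (auto simp: def_vec_def)
  show ?thesis
    unfolding lex_le_def
    by (intro def_pred_disj def_vec_eq assms def_pred_Bex def_pred_conj def_pred_less def_pred_Ball
        def_pred_imp def_pred_const def_pred_eq finite_Basis *)
qed

text \<open>The Kurdyka--Lojasiewicz inequality in integrated form, at the value \<open>a\<close>: \<open>V\<close> plays the role
  of the desingularizing function. It is the signed sum of the coordinates of a definable curve
  along which the gradient norm is minimal on each level set; each coordinate is monotone, so \<open>V\<close>
  controls the length of the curve, and no differentiability of the curve is needed.\<close>

theorem desingularization:
  fixes \<Phi> :: "'a::euclidean_space \<Rightarrow> real" and G :: "'a \<Rightarrow> 'a"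
  assumes def\<Phi>: "def_fun (\<lambda>v. \<Phi> (vec_of v))"
    and grad: "\<And>x. (\<Phi> has_derivative (\<lambda>y. G x \<bullet> y)) (at x)"
    and contG: "continuous_on UNIV G"
    and z: "\<And>k::nat. norm (z k) \<le> R" "\<And>k. \<Phi> (z k) > a" "(\<lambda>k. \<Phi> (z k)) \<longlonglongrightarrow> a" "(\<lambda>k. norm (G (z k))) \<longlonglongrightarrow> 0"
  obtains \<epsilon> V B where "\<epsilon> > 0" "\<And>t. t \<in> {a<..<a+\<epsilon>} \<Longrightarrow> \<bar>V t\<bar> \<le> B"
    "\<And>s t x. a < s \<Longrightarrow> s \<le> t \<Longrightarrow> t < a + \<epsilon> \<Longrightarrow> norm x \<le> R \<Longrightarrow> \<Phi> x = t
       \<Longrightarrow> t - s \<le> norm (G x) * (V t - V s)"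
proof -
  define lev where "lev x t \<longleftrightarrow> norm x \<le> R \<and> \<Phi> x = t" for x t
  define arg where "arg x t \<longleftrightarrow> lev x t \<and> (\<forall>y. lev y t \<longrightarrow> norm (G x) \<le> norm (G y))" for x t
  define sel where "sel x t \<longleftrightarrow> arg x t \<and> (\<forall>y. arg y t \<longrightarrow> lex_le x y)" for x t
  \<comment> \<open>The value 0 on empty levels only makes \<open>\<xi>\<close> total; just above
    \<open>a\<close> all levels turn out to be nonempty.\<close>
  define \<xi> where "\<xi> t = (if \<exists>x. lev x t then SOME x. sel x t else 0)" for t
  have cont\<Phi>: "continuous_on UNIV \<Phi>"
    by (intro continuous_at_imp_continuous_on ballI has_derivative_continuous[OF grad])
  have sel_ex: "\<exists>x. sel x t" if ne: "\<exists>x. lev x t" for t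
  proof -
    have lev_eq: "Collect (\<lambda>x. lev x t) = cball 0 R \<inter> {x. \<Phi> x = t}" by (auto simp: lev_def)
    have "closed {x. \<Phi> x = t}" by (intro closed_Collect_eq cont\<Phi> continuous_on_const)
    then have cl: "compact (Collect (\<lambda>x. lev x t))" unfolding lev_eq by (intro compact_Int_closed compact_cball)
    have "continuous_on (Collect (\<lambda>x. lev x t)) (\<lambda>x. norm (G x))"
      by (intro continuous_on_norm continuous_on_subset[OF contG]) simp
    then obtain x0 where x0: "lev x0 t" "\<And>y. lev y t \<Longrightarrow> norm (G x0) \<le> norm (G y)"
      using continuous_attains_inf[OF cl, of "\<lambda>x. norm (G x)"] ne by auto
    have arg_eq: "Collect (\<lambda>x. arg x t) = Collect (\<lambda>x. lev x t) \<inter> {x. norm (G x) \<le> norm (G x0)}"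
      using x0 unfolding arg_def by (auto intro: order_trans)
    have "closed {x. norm (G x) \<le> norm (G x0)}"
      by (intro closed_Collect_le continuous_intros contG)
    then have "compact (Collect (\<lambda>x. arg x t))"
      unfolding arg_eq using cl by (intro compact_Int_closed)
    moreover have "Collect (\<lambda>x. arg x t) \<noteq> {}" unfolding arg_eq using x0 by auto
    ultimately obtain x where "x \<in> Collect (\<lambda>x. arg x t)" "\<And>y. y \<in> Collect (\<lambda>x. arg x t) \<Longrightarrow> lex_le x y"
      by (rule compact_lex_min) blast
    then show ?thesis unfolding sel_def by auto
  qed
  have sel_uniq: "x = y" if "sel x t" "sel y t" for x y t
    using that lex_le_antisym unfolding sel_def by blast
  have \<xi>_sel: "sel (\<xi> t) t" if "\<exists>x. lev x t" for t
    using someI_ex[OF sel_ex[OF that]] that by (simp add: \<xi>_def)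
  have defG: "def_vec (\<lambda>v. G (vec_of v))" by (rule def_fun_deriv[OF def\<Phi> grad])
  have def_lev: "def_pred (\<lambda>v. lev (X v) (T v))" if "def_vec X" "def_fun T" for X T
    unfolding lev_def
    by (intro def_pred_conj def_pred_le def_pred_eq def_fun_norm def_fun_const that def_fun_subst_vec[OF def\<Phi>])
  have def_nG: "def_fun (\<lambda>v. norm (G (X v)))" if "def_vec X" for X
    by (rule def_fun_subst_vec[OF def_fun_norm[OF defG] that])
  have def_arg: "def_pred (\<lambda>v. arg (X v) (T v))" if X: "def_vec X" and T: "def_fun T" for X T
    unfolding arg_def
    by (intro def_pred_conj def_lev X T def_pred_all_vec def_pred_imp def_pred_le def_nG
        def_vec_of def_vec_rename[OF X] def_fun_rename[OF T])
  have def_sel: "def_pred (\<lambda>v. sel (X v) (T v))" if X: "def_vec X" and T: "def_fun T" for X T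
    unfolding sel_def
    by (intro def_pred_conj def_arg X T def_pred_all_vec def_pred_imp def_pred_lex_le
        def_vec_of def_vec_rename[OF X] def_fun_rename[OF T])
  have def_nonempty: "def_pred (\<lambda>v. \<exists>x. lev x (v j))" for j
    by (intro def_pred_ex_vec def_lev def_vec_of def_fun_var)
  have def_\<xi>: "def_vec (\<lambda>v. \<xi> (v 0))"
    unfolding def_vec_def
  proof
    fix b :: 'a assume b: "b \<in> Basis"
    \<comment> \<open>Uniqueness of the selected point lets a formula replace the choice
      operator.\<close>
    have "y = \<xi> t \<bullet> b \<longleftrightarrow> (\<exists>x. (sel x t \<or> (\<not> (\<exists>x. lev x t) \<and> x = 0)) \<and> y = x \<bullet> b)" for y t
    proof (cases "\<exists>x. lev x t")
      case True
      then show ?thesis using \<xi>_sel sel_uniq by metis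
    next
      case False
      then have "\<not> sel x t" for x by (auto simp: sel_def arg_def)
      then show ?thesis using False by (auto simp: \<xi>_def)
    qed
    moreover have "def_pred (\<lambda>v. \<exists>x. (sel x (v (Suc 0)) \<or> (\<not> (\<exists>x. lev x (v (Suc 0))) \<and> x = 0)) \<and> v 0 = x \<bullet> b)"
      by (intro def_pred_ex_vec def_pred_conj def_pred_disj def_pred_not def_sel def_vec_of def_fun_var
          def_nonempty def_vec_eq def_vec_const def_pred_eq def_fun_inner)
    ultimately show "def_fun (\<lambda>v. \<xi> (v 0) \<bullet> b)" by (simp add: def_fun_def)
  qed
  define m where "m t = norm (G (\<xi> t))" for t
  have def_m: "def_fun (\<lambda>v. m (v 0))" unfolding m_def by (rule def_nG[OF def_\<xi>])
  have z_right: "filterlim (\<lambda>k. \<Phi> (z k)) (at_right a) sequentially"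
    using z(3) z(2)[THEN less_imp_neq, THEN not_sym] z(2) by (simp add: filterlim_at)
  have lev_z: "lev (z k) (\<Phi> (z k))" for k using z(1) by (simp add: lev_def)
  \<comment> \<open>Nonemptiness of the level is eventually true or eventually false; the levels
    through the points \<open>z k\<close> approach \<open>a\<close> from above and rule out the
    latter.\<close>
  have "eventually (\<lambda>t. \<exists>x. lev x t) (at_right a)"
  proof (rule ccontr)
    assume "\<not> ?thesis"
    then have "eventually (\<lambda>t. \<not> (\<exists>x. lev x t)) (at_right a)"
      using def_pred_eventually_right[OF def_nonempty[of 0]] by blast
    then have "eventually (\<lambda>k. \<not> (\<exists>x. lev x (\<Phi> (z k)))) sequentially"
      using z_right by (rule eventually_compose_filterlim)
    then show False using lev_z by (auto simp: eventually_sequentially)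
  qed
  then obtain c0 where "c0 > a" and lev0: "\<And>t. a < t \<Longrightarrow> t < c0 \<Longrightarrow> \<exists>x. lev x t"
    by (auto simp: eventually_at_right_field)
  then have c0: "c0 - a > 0" by simp
  have "\<exists>\<epsilon> sg. \<epsilon> > 0 \<and> \<bar>sg\<bar> = 1 \<and> mono_on {a<..<a+\<epsilon>} (\<lambda>t. sg * (\<xi> t \<bullet> b))" if "b \<in> Basis" for b
  proof -
    have "def_fun (\<lambda>v. \<xi> (v 0) \<bullet> b)" using def_\<xi> that by (auto simp: def_vec_def)
    then obtain \<epsilon> where \<epsilon>: "\<epsilon> > 0" "mono_on {a<..<a+\<epsilon>} (\<lambda>t. \<xi> t \<bullet> b) \<or> antimono_on {a<..<a+\<epsilon>} (\<lambda>t. \<xi> t \<bullet> b)"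
      using def_fun_eventually_monotone[of "\<lambda>t. \<xi> t \<bullet> b" a] by blast
    from \<epsilon>(2) show ?thesis
    proof
      assume "mono_on {a<..<a+\<epsilon>} (\<lambda>t. \<xi> t \<bullet> b)"
      then show ?thesis using \<epsilon>(1) by (intro exI[of _ \<epsilon>] exI[of _ 1]) auto
    next
      assume "antimono_on {a<..<a+\<epsilon>} (\<lambda>t. \<xi> t \<bullet> b)"
      then show ?thesis using \<epsilon>(1)
        by (intro exI[of _ \<epsilon>] exI[of _ "-1"]) (auto simp: monotone_on_def)
    qed
  qed
  then obtain \<epsilon>b sg where \<epsilon>b: "\<And>b. b \<in> Basis \<Longrightarrow> \<epsilon>b b > 0" and sg: "\<And>b. b \<in> Basis \<Longrightarrow> \<bar>sg b\<bar> = (1::real)"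
    and mono_b: "\<And>b. b \<in> Basis \<Longrightarrow> mono_on {a<..<a+\<epsilon>b b} (\<lambda>t. sg b * (\<xi> t \<bullet> b))"
    by metis
  obtain \<epsilon>m where \<epsilon>m: "\<epsilon>m > 0" "mono_on {a<..<a+\<epsilon>m} m \<or> antimono_on {a<..<a+\<epsilon>m} m"
    using def_fun_eventually_monotone[OF def_m] by blast
  define \<epsilon> where "\<epsilon> = Min (insert (c0 - a) (insert \<epsilon>m (\<epsilon>b ` Basis)))"
  have \<epsilon>: "\<epsilon> > 0" unfolding \<epsilon>_def using c0 \<epsilon>m(1) \<epsilon>b by simp
  have \<epsilon>_le: "\<epsilon> \<le> c0 - a" "\<epsilon> \<le> \<epsilon>m" "\<And>b. b \<in> Basis \<Longrightarrow> \<epsilon> \<le> \<epsilon>b b"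
    unfolding \<epsilon>_def by (rule Min_le; simp)+
  let ?I = "{a<..<a+\<epsilon>}"
  have sel\<xi>: "sel (\<xi> t) t" if "t \<in> ?I" for t
    using \<xi>_sel lev0[of t] that \<epsilon>_le(1) by auto
  have \<Phi>\<xi>: "\<Phi> (\<xi> t) = t" and R\<xi>: "norm (\<xi> t) \<le> R" if "t \<in> ?I" for t
    using sel\<xi>[OF that] by (auto simp: sel_def arg_def lev_def)
  have m_le: "m t \<le> norm (G x)" if "t \<in> ?I" "lev x t" for x t
    using sel\<xi>[OF that(1)] that(2) by (auto simp: sel_def arg_def m_def)
  have m_nonneg: "m t \<ge> 0" for t by (simp add: m_def)
  have mono_m: "m s \<le> m t" if "s \<in> ?I" "t \<in> ?I" "s \<le> t" for s t
    using \<epsilon>m(2)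
  proof
    assume "mono_on {a<..<a+\<epsilon>m} m"
    then show ?thesis using that \<epsilon>_le(2) by (auto intro: mono_onD)
  next
    assume anti: "antimono_on {a<..<a+\<epsilon>m} m"
    \<comment> \<open>If \<open>m\<close> were decreasing, its value at \<open>s\<close> would
      eventually bound the gradient norms along \<open>z\<close> from below, and these tend to
      0.\<close>
    have "m s \<le> 0"
    proof (rule tendsto_lowerbound[OF z(4)])
      have "eventually (\<lambda>k. \<Phi> (z k) < s) sequentially"
        using order_tendstoD(2)[OF z(3)] that(1) by auto
      then show "eventually (\<lambda>k. m s \<le> norm (G (z k))) sequentially"
      proof eventually_elim
        case (elim k)
        have "\<Phi> (z k) \<in> ?I" using z(2)[of k] elim that(1) by auto
        moreover from this have "m s \<le> m (\<Phi> (z k))"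
          using anti that(1) elim \<epsilon>_le(2) unfolding monotone_on_def by (auto simp: less_imp_le)
        ultimately show ?case using m_le[OF _ lev_z] order_trans by blast
      qed
    qed simp
    then show ?thesis using m_nonneg[of t] by linarith
  qed
  \<comment> \<open>The signs make every summand increasing, so an increment of \<open>V\<close> is
    the sum of the absolute coordinate increments of \<open>\<xi>\<close> and dominates the norm of
    the chord.\<close>
  define V where "V t = (\<Sum>b\<in>Basis. sg b * (\<xi> t \<bullet> b))" for t
  have V_length: "norm (\<xi> t - \<xi> s) \<le> V t - V s" if "s \<in> ?I" "t \<in> ?I" "s \<le> t" for s t
  proof -
    have "norm (\<xi> t - \<xi> s) \<le> (\<Sum>b\<in>Basis. \<bar>(\<xi> t - \<xi> s) \<bullet> b\<bar>)" by (rule norm_le_l1)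
    also have "\<dots> \<le> (\<Sum>b\<in>Basis. sg b * (\<xi> t \<bullet> b) - sg b * (\<xi> s \<bullet> b))"
    proof (rule sum_mono)
      fix b :: 'a assume b: "b \<in> Basis"
      have "sg b * (\<xi> s \<bullet> b) \<le> sg b * (\<xi> t \<bullet> b)"
        using mono_onD[OF mono_b[OF b], of s t] that \<epsilon>_le(3)[OF b] by auto
      then show "\<bar>(\<xi> t - \<xi> s) \<bullet> b\<bar> \<le> sg b * (\<xi> t \<bullet> b) - sg b * (\<xi> s \<bullet> b)"
        using sg[OF b] by (auto simp: inner_diff_left abs_if split: if_splits)
    qed
    finally show ?thesis by (simp add: V_def sum_subtractf)
  qed
  have V_mono: "V s \<le> V t" if "s \<in> ?I" "t \<in> ?I" "s \<le> t" for s t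
    using V_length[OF that] norm_ge_zero[of "\<xi> t - \<xi> s"] by linarith
  \<comment> \<open>Either \<open>\<xi>\<close> moves by less than \<open>d\<close>, and the
    expansion of \<open>\<Phi>\<close> at \<open>\<xi> \<tau>\<close> converts the level difference
    \<open>s - \<tau>\<close> into length; or it moves by at least \<open>d\<close>, which dominates
    \<open>K * (s - \<tau>)\<close> because \<open>s < \<tau> + d / K\<close>.\<close>
  have V_loc: "eventually (\<lambda>s. K * (s - \<tau>) \<le> V s - V \<tau>) (at_right \<tau>)"
    if \<tau>: "\<tau> \<in> ?I" and K: "K > 0" "K * m \<tau> < 1" for \<tau> K
  proof -
    define e where "e = (1 - K * m \<tau>) / K"
    have e: "e > 0" "K * (m \<tau> + e) = 1" using K by (auto simp: e_def field_simps)
    obtain d where d: "d > 0" "\<And>y. norm (y - \<xi> \<tau>) < d \<Longrightarrow>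
        norm (\<Phi> y - \<Phi> (\<xi> \<tau>) - G (\<xi> \<tau>) \<bullet> (y - \<xi> \<tau>)) \<le> e * norm (y - \<xi> \<tau>)"
      using grad[of "\<xi> \<tau>"] e(1) unfolding has_derivative_at_alt by blast
    have "eventually (\<lambda>s. s < min (a + \<epsilon>) (\<tau> + d / K)) (at_right \<tau>)"
      by (rule order_tendstoD(2)[OF tendsto_ident_at]) (use \<tau> d K in auto)
    moreover have "eventually (\<lambda>s. \<tau> < s) (at_right \<tau>)" by (rule eventually_at_right_less)
    ultimately show ?thesis
    proof eventually_elim
      case (elim s)
      then have s: "s \<in> ?I" "\<tau> \<le> s" using \<tau> by auto
      have len: "norm (\<xi> s - \<xi> \<tau>) \<le> V s - V \<tau>" by (rule V_length[OF \<tau> s])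
      show ?case
      proof (cases "norm (\<xi> s - \<xi> \<tau>) < d")
        case True
        have "s - \<tau> \<le> G (\<xi> \<tau>) \<bullet> (\<xi> s - \<xi> \<tau>) + e * norm (\<xi> s - \<xi> \<tau>)"
          using d(2)[OF True] \<Phi>\<xi>[OF s(1)] \<Phi>\<xi>[OF \<tau>] by (simp add: abs_le_iff)
        also have "\<dots> \<le> (m \<tau> + e) * norm (\<xi> s - \<xi> \<tau>)"
          using norm_cauchy_schwarz[of "G (\<xi> \<tau>)" "\<xi> s - \<xi> \<tau>"] by (simp add: m_def algebra_simps)
        also have "\<dots> \<le> (m \<tau> + e) * (V s - V \<tau>)"
          using len m_nonneg[of \<tau>] e(1) by (intro mult_left_mono) auto
        finally have "K * (s - \<tau>) \<le> (K * (m \<tau> + e)) * (V s - V \<tau>)"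
          using K(1) by (simp add: mult.assoc)
        then show ?thesis by (simp add: e(2))
      next
        case False
        have "K * (s - \<tau>) \<le> d" using elim K(1) by (simp add: field_simps)
        then show ?thesis using False len by linarith
      qed
    qed
  qed
  have V_K: "K * (t - s) \<le> V t - V s"
    if "s \<in> ?I" "t \<in> ?I" "s \<le> t" and K: "K > 0" "K * m t < 1" for s t K
  proof (rule growth_from_right_growth[OF that(3) _ K(1)])
    show "mono_on {s..t} V"
      using that(1,2) by (intro mono_onI V_mono) auto
  next
    fix \<tau> assume \<tau>: "s \<le> \<tau>" "\<tau> < t"
    then have "\<tau> \<in> ?I" using that(1,2) by auto
    moreover have "K * m \<tau> < 1"
    proof -
      have "m \<tau> \<le> m t" using mono_m[OF \<open>\<tau> \<in> ?I\<close> that(2)] \<tau> by simp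
      then have "K * m \<tau> \<le> K * m t" using K(1) by (simp add: mult_left_mono)
      then show ?thesis using K(2) by linarith
    qed
    ultimately show "eventually (\<lambda>s. K * (s - \<tau>) \<le> V s - V \<tau>) (at_right \<tau>)"
      using V_loc K(1) by blast
  qed
  have main: "t - s \<le> m t * (V t - V s)" if "s \<in> ?I" "t \<in> ?I" "s \<le> t" for s t
  proof (cases "s = t")
    case False
    then have st: "s < t" using that by simp
    show ?thesis
    proof (cases "m t = 0")
      case True
      \<comment> \<open>With \<open>m t = 0\<close> every positive slope is admissible; this one
        would force \<open>V t - V s\<close> to exceed itself by one, so the case cannot
        occur.\<close>
      define K where "K = (V t - V s + 1) / (t - s)"
      have "K > 0" unfolding K_def using V_mono[OF that] st by (intro divide_pos_pos) auto
      then have "K * (t - s) \<le> V t - V s" using V_K[OF that] True by simp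
      moreover have "K * (t - s) = V t - V s + 1" unfolding K_def using st by simp
      ultimately show ?thesis by simp
    next
      case False
      then have mt: "m t > 0" using m_nonneg[of t] by simp
      show ?thesis
      \<comment> \<open>The slope \<open>1 / m t\<close> is only a limit of admissible ones, hence
        \<open>x / m t\<close> with \<open>x < 1\<close>.\<close>
      proof (rule field_le_mult_one_interval)
        fix x :: real assume x: "0 < x" "x < 1"
        have "x / m t * (t - s) \<le> V t - V s"
          using V_K[OF that, of "x / m t"] mt x by simp
        then show "x * (t - s) \<le> m t * (V t - V s)"
          using mt by (simp add: field_simps)
      qed
    qed
  qed simp
  have bound: "\<bar>V t\<bar> \<le> DIM('a) * R" if t: "t \<in> ?I" for t
  proof -
    have "\<bar>V t\<bar> \<le> (\<Sum>b\<in>Basis. \<bar>sg b * (\<xi> t \<bullet> b)\<bar>)" unfolding V_def by (rule sum_abs)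
    also have "\<dots> \<le> (\<Sum>b\<in>(Basis :: 'a set). R)"
    proof (rule sum_mono)
      fix b :: 'a assume b: "b \<in> Basis"
      have "\<bar>sg b * (\<xi> t \<bullet> b)\<bar> = \<bar>\<xi> t \<bullet> b\<bar>" using sg[OF b] by (simp add: abs_mult)
      also have "\<dots> \<le> R" using Basis_le_norm[OF b, of "\<xi> t"] R\<xi>[OF t] by linarith
      finally show "\<bar>sg b * (\<xi> t \<bullet> b)\<bar> \<le> R" .
    qed
    finally show ?thesis by simp
  qed
  show thesis
  proof (rule that[OF \<epsilon> bound])
    fix s t x assume st: "a < s" "s \<le> t" "t < a + \<epsilon>" and x: "norm x \<le> R" "\<Phi> x = t"
    then have I: "s \<in> ?I" "t \<in> ?I" by auto
    have "t - s \<le> m t * (V t - V s)" by (rule main[OF I st(2)])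
    also have "\<dots> \<le> norm (G x) * (V t - V s)"
      using m_le[OF I(2)] x V_mono[OF I st(2)] by (intro mult_right_mono) (auto simp: lev_def)
    finally show "t - s \<le> norm (G x) * (V t - V s)" .
  qed
qed

end

section \<open>Energy decrease and convergence\<close>

text \<open>Along the segment from \<open>x\<close> to \<open>y\<close>, \<open>f\<close> minus its
  linear part and minus the quadratic bound has nonpositive derivative by the Lipschitz
  estimate.\<close>

lemma descent_lemma:
  fixes f :: "'a::real_inner \<Rightarrow> real"
  assumes grad: "\<And>x. (f has_derivative (\<lambda>v. g x \<bullet> v)) (at x)"
    and lip: "L-lipschitz_on UNIV g"
  shows "f y \<le> f x + g x \<bullet> (y - x) + L / 2 * (norm (y - x))\<^sup>2"
proof -
  define d where "d = y - x"
  define \<phi> where "\<phi> t = f (x + t *\<^sub>R d) - t * (g x \<bullet> d) - L / 2 * t\<^sup>2 * (norm d)\<^sup>2" for t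
  have der: "(\<phi> has_real_derivative (g (x + t *\<^sub>R d) \<bullet> d - g x \<bullet> d - L * t * (norm d)\<^sup>2)) (at t)" for t
  proof -
    have "((\<lambda>s. f (x + s *\<^sub>R d)) has_derivative (\<lambda>s. g (x + t *\<^sub>R d) \<bullet> (s *\<^sub>R d))) (at t)"
      by (rule has_derivative_compose[of "\<lambda>s. x + s *\<^sub>R d" "\<lambda>s. s *\<^sub>R d"])
        (auto intro!: derivative_eq_intros grad)
    then have "((\<lambda>s. f (x + s *\<^sub>R d)) has_real_derivative g (x + t *\<^sub>R d) \<bullet> d) (at t)"
      by (rule has_derivative_imp_has_field_derivative) simp
    then show ?thesis
      unfolding \<phi>_def by (auto intro!: derivative_eq_intros)
  qed
  have "\<phi> 1 \<le> \<phi> 0"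
  proof (rule DERIV_nonpos_imp_nonincreasing[of 0 1 \<phi>])
    fix t :: real assume t: "0 \<le> t" "t \<le> 1"
    have "(g (x + t *\<^sub>R d) - g x) \<bullet> d \<le> norm (g (x + t *\<^sub>R d) - g x) * norm d"
      by (rule norm_cauchy_schwarz)
    also have "\<dots> \<le> (L * norm (t *\<^sub>R d)) * norm d"
      using lipschitz_onD[OF lip, of "x + t *\<^sub>R d" x] by (intro mult_right_mono) (auto simp: dist_norm)
    also have "\<dots> = L * t * (norm d)\<^sup>2" using t by (simp add: power2_eq_square)
    finally have "g (x + t *\<^sub>R d) \<bullet> d - g x \<bullet> d - L * t * (norm d)\<^sup>2 \<le> 0"
      by (simp add: inner_diff_left)
    then show "\<exists>y. (\<phi> has_real_derivative y) (at t) \<and> y \<le> 0" using der by blast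
  qed simp
  then show ?thesis by (simp add: \<phi>_def d_def)
qed

text \<open>Stated over any real vector space because it is applied to the iterates, to a Hessian in
  place of the gradient, and to scalar eigenmodes.\<close>

definition hb_step :: "('a::real_vector \<Rightarrow> 'a) \<Rightarrow> real \<Rightarrow> real \<Rightarrow> real \<Rightarrow> 'a \<Rightarrow> 'a \<Rightarrow> 'a" where
  "hb_step g h \<beta> \<gamma> x y = y + (1 / (1 + \<gamma> * h)) *\<^sub>R (y - x)
     - (\<beta> * h * (1 / (1 + \<gamma> * h))) *\<^sub>R (g y - g x) - (h\<^sup>2 * (1 / (1 + \<gamma> * h))) *\<^sub>R g y"

lemma hb_step_increment:
  assumes "1 + \<gamma> * h \<noteq> 0"
  shows "(1 + \<gamma> * h) *\<^sub>R (hb_step g h \<beta> \<gamma> x y - y) = (y - x) - (\<beta> * h) *\<^sub>R (g y - g x) - h\<^sup>2 *\<^sub>R g y"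
proof -
  have "hb_step g h \<beta> \<gamma> x y - y = (1 / (1 + \<gamma> * h)) *\<^sub>R ((y - x) - (\<beta> * h) *\<^sub>R (g y - g x) - h\<^sup>2 *\<^sub>R g y)"
    unfolding hb_step_def by (simp add: scaleR_diff_right mult.commute)
  then show ?thesis using assms by simp
qed

text \<open>\<open>hb_theta\<close> and \<open>hb_kappa\<close> solve the two equations that match
  the coefficients of the squared increments in \<open>hb_step_energy\<close>. The surplus damping
  \<open>(c - L * (\<beta> + h / 2)) / h\<close> is shared equally between the old and the new
  increment, hence the factor 2. For positive \<open>L\<close> and \<open>h\<close> it is positive
  exactly when \<open>\<beta> + h / 2 < c / L\<close>.\<close>

definition hb_theta :: "real \<Rightarrow> real \<Rightarrow> real \<Rightarrow> real \<Rightarrow> real" where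
  "hb_theta L h \<beta> c = (c - L * (\<beta> + h / 2)) / (2 * h)"

definition hb_kappa :: "real \<Rightarrow> real \<Rightarrow> real \<Rightarrow> real \<Rightarrow> real" where
  "hb_kappa L h \<beta> c = (1 + \<beta> * h * L) / (2 * h\<^sup>2) + hb_theta L h \<beta> c"

text \<open>The recursion, tested against the new increment, expresses its inner product with
  \<open>g y\<close> through the two increments; the descent inequality turns this into a bound on
  \<open>f y'\<close>. Cross terms are split evenly between the two squares.\<close>

lemma hb_step_energy:
  fixes f :: "'a::real_inner \<Rightarrow> real"
  assumes grad: "\<And>x. (f has_derivative (\<lambda>v. g x \<bullet> v)) (at x)"
    and lip: "L-lipschitz_on UNIV g"
    and h: "h > 0" and \<beta>: "\<beta> \<ge> 0" and c: "0 < c" "c \<le> \<gamma>"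
    and y': "y' = hb_step g h \<beta> \<gamma> x y"
  shows "f y' + hb_kappa L h \<beta> c * (norm (y' - y))\<^sup>2 + hb_theta L h \<beta> c * ((norm (y - x))\<^sup>2 + (norm (y' - y))\<^sup>2)
      \<le> f y + hb_kappa L h \<beta> c * (norm (y - x))\<^sup>2"
proof -
  define a b w where "a = y - x" and "b = y' - y" and "w = g y - g x"
  have "\<gamma> * h > 0" using h c by simp
  then have "(1 + \<gamma> * h) *\<^sub>R b = a - (\<beta> * h) *\<^sub>R w - h\<^sup>2 *\<^sub>R g y"
    unfolding a_def b_def w_def y' by (intro hb_step_increment) simp
  then have "h\<^sup>2 *\<^sub>R g y = a - (\<beta> * h) *\<^sub>R w - (1 + \<gamma> * h) *\<^sub>R b" by (simp add: algebra_simps)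
  then have "(h\<^sup>2 *\<^sub>R g y) \<bullet> b = (a - (\<beta> * h) *\<^sub>R w - (1 + \<gamma> * h) *\<^sub>R b) \<bullet> b" by simp
  then have eq: "h\<^sup>2 * (g y \<bullet> b) = a \<bullet> b - \<beta> * h * (w \<bullet> b) - (1 + \<gamma> * h) * (norm b)\<^sup>2"
    by (simp add: inner_diff_left power2_norm_eq_inner)
  have am: "norm a * norm b \<le> ((norm a)\<^sup>2 + (norm b)\<^sup>2) / 2"
    using sum_squares_bound[of "norm a" "norm b"] by simp
  have 1: "a \<bullet> b \<le> ((norm a)\<^sup>2 + (norm b)\<^sup>2) / 2"
    using norm_cauchy_schwarz[of a b] am by linarith
  have L0: "L \<ge> 0" using lip by (rule lipschitz_on_nonneg)
  have "norm w \<le> L * norm a"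
    using lipschitz_onD[OF lip, of y x] by (simp add: w_def a_def dist_norm)
  then have "norm w * norm b \<le> L * (norm a * norm b)" by (simp add: mult_right_mono mult.assoc[symmetric])
  also have "\<dots> \<le> L * (((norm a)\<^sup>2 + (norm b)\<^sup>2) / 2)" using am L0 by (rule mult_left_mono)
  finally have "- (w \<bullet> b) \<le> L * (((norm a)\<^sup>2 + (norm b)\<^sup>2) / 2)"
    using Cauchy_Schwarz_ineq2[of w b] by linarith
  then have 2: "\<beta> * h * (- (w \<bullet> b)) \<le> \<beta> * h * (L * (((norm a)\<^sup>2 + (norm b)\<^sup>2) / 2))"
    using \<beta> h by (intro mult_left_mono) auto
  have 3: "c * h * (norm b)\<^sup>2 \<le> \<gamma> * h * (norm b)\<^sup>2"
    using c h by (intro mult_right_mono) auto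
  have "h\<^sup>2 * (g y \<bullet> b) \<le> ((norm a)\<^sup>2 + (norm b)\<^sup>2) / 2 + \<beta> * h * (L * (((norm a)\<^sup>2 + (norm b)\<^sup>2) / 2)) - (1 + c * h) * (norm b)\<^sup>2"
    unfolding eq distrib_right[of 1] using 1 2[unfolded mult_minus_right] 3 by linarith
  then have "g y \<bullet> b \<le> (((norm a)\<^sup>2 + (norm b)\<^sup>2) / 2 + \<beta> * h * (L * (((norm a)\<^sup>2 + (norm b)\<^sup>2) / 2)) - (1 + c * h) * (norm b)\<^sup>2) / h\<^sup>2"
    using h by (simp add: pos_le_divide_eq mult.commute)
  moreover have "f y' \<le> f y + g y \<bullet> b + L / 2 * (norm b)\<^sup>2"
    unfolding b_def by (rule descent_lemma[OF grad lip])
  ultimately have "f y' \<le> f y + (((norm a)\<^sup>2 + (norm b)\<^sup>2) / 2 + \<beta> * h * (L * (((norm a)\<^sup>2 + (norm b)\<^sup>2) / 2)) - (1 + c * h) * (norm b)\<^sup>2) / h\<^sup>2 + L / 2 * (norm b)\<^sup>2"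
    by linarith
  \<comment> \<open>An identity: the two constants are defined so that the coefficients of both
    squares agree.\<close>
  also have "\<dots> = f y + hb_kappa L h \<beta> c * (norm a)\<^sup>2 - hb_kappa L h \<beta> c * (norm b)\<^sup>2
      - hb_theta L h \<beta> c * ((norm a)\<^sup>2 + (norm b)\<^sup>2)"
    using h unfolding hb_kappa_def hb_theta_def by (simp add: field_simps power2_eq_square)
  finally show ?thesis unfolding a_def b_def by simp
qed

text \<open>The recursion solved for the gradient. Along the orbit it lets increments control the
  gradient of the energy; for the scalar map \<open>\<eta> * t\<close> with \<open>\<eta>\<close>
  away from zero it bounds the position itself.\<close>

lemma hb_step_gradient_bound:
  fixes g :: "'a::real_normed_vector \<Rightarrow> 'a"
  assumes lip: "L-lipschitz_on UNIV g"
    and h: "h > 0" and \<beta>: "\<beta> \<ge> 0" and \<gamma>: "0 < \<gamma>" "\<gamma> \<le> C"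
    and y': "y' = hb_step g h \<beta> \<gamma> x y"
  shows "h\<^sup>2 * norm (g y) \<le> (1 + \<beta> * h * L) * norm (y - x) + (1 + C * h) * norm (y' - y)"
proof -
  have pos: "\<gamma> * h > 0" using h \<gamma> by simp
  then have "(1 + \<gamma> * h) *\<^sub>R (y' - y) = (y - x) - (\<beta> * h) *\<^sub>R (g y - g x) - h\<^sup>2 *\<^sub>R g y"
    unfolding y' by (intro hb_step_increment) simp
  then have eq: "h\<^sup>2 *\<^sub>R g y = (y - x) - (\<beta> * h) *\<^sub>R (g y - g x) - (1 + \<gamma> * h) *\<^sub>R (y' - y)"
    by (simp add: algebra_simps)
  have "h\<^sup>2 * norm (g y) = norm (h\<^sup>2 *\<^sub>R g y)" by simp
  also have "\<dots> \<le> norm (y - x) + norm ((\<beta> * h) *\<^sub>R (g y - g x)) + norm ((1 + \<gamma> * h) *\<^sub>R (y' - y))"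
    unfolding eq by (meson add_mono norm_triangle_ineq4 order_refl order_trans)
  also have "\<dots> = norm (y - x) + \<beta> * h * norm (g y - g x) + (1 + \<gamma> * h) * norm (y' - y)"
    using \<beta> h pos by simp
  also have "\<dots> \<le> norm (y - x) + \<beta> * h * (L * norm (y - x)) + (1 + C * h) * norm (y' - y)"
    using lipschitz_onD[OF lip, of y x] \<beta> h \<gamma>
    by (intro add_mono mult_left_mono mult_right_mono) (auto simp: dist_norm)
  finally show ?thesis by (simp add: algebra_simps)
qed

lemma summable_telescoping:
  fixes a :: "nat \<Rightarrow> real"
  assumes "\<And>k. 0 \<le> a k" "\<And>k. a k \<le> E k - E (Suc k)" "\<And>k. B \<le> E k"
  shows "summable a"
proof (rule bounded_imp_summable[OF assms(1)])
  fix n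
  have "sum a {..n} \<le> (\<Sum>k\<le>n. E k - E (Suc k))" by (rule sum_mono) (rule assms(2))
  also have "\<dots> = E 0 - E (Suc n)" by (rule sum_telescope)
  also have "\<dots> \<le> E 0 - B" using assms(3)[of "Suc n"] by simp
  finally show "sum a {..n} \<le> E 0 - B" .
qed

lemma convergent_if_summable_increments:
  fixes x :: "nat \<Rightarrow> 'a::banach"
  assumes "summable (\<lambda>k. norm (x (Suc k) - x k))"
  shows "\<exists>z. x \<longlonglongrightarrow> z"
proof -
  have "(\<lambda>n. \<Sum>k<n. x (Suc k) - x k) \<longlonglongrightarrow> (\<Sum>k. x (Suc k) - x k)"
    by (rule summable_LIMSEQ[OF summable_norm_cancel[OF assms]])
  then have "(\<lambda>n. x n - x 0) \<longlonglongrightarrow> (\<Sum>k. x (Suc k) - x k)"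
    by (simp add: sum_lessThan_telescope)
  from tendsto_add[OF this tendsto_const[of "x 0"]] show ?thesis by auto
qed

section \<open>A single orbit: square summability, then finite length\<close>

locale heavy_ball =
  fixes f :: "'a::euclidean_space \<Rightarrow> real" and g :: "'a \<Rightarrow> 'a" and L h \<beta> c C :: real
    and \<gamma> :: "nat \<Rightarrow> real" and x :: "nat \<Rightarrow> 'a"
  assumes grad: "\<And>x. (f has_derivative (\<lambda>v. g x \<bullet> v)) (at x)"
    and bdd: "bdd_below (range f)"
    and L_pos: "L > 0"
    and lip: "L-lipschitz_on UNIV g"
    and h_pos: "h > 0"
    and beta_nonneg: "\<beta> \<ge> 0"
    and c_pos: "0 < c"
    and gamma_bounds: "\<And>k. c \<le> \<gamma> k \<and> \<gamma> k \<le> C"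
    and step_size: "\<beta> + h / 2 < c / L"
    and recursion: "\<And>k. x (Suc (Suc k)) = hb_step g h \<beta> (\<gamma> (Suc k)) (x k) (x (Suc k))"
begin

abbreviation "\<theta> \<equiv> hb_theta L h \<beta> c"
abbreviation "\<kappa> \<equiv> hb_kappa L h \<beta> c"

definition incr :: "nat \<Rightarrow> real" where
  "incr k = norm (x (Suc k) - x k)"

text \<open>Index \<open>k\<close> refers to the iterates \<open>k\<close> and \<open>k + 1\<close>:
  the increment is the one leading to the point at which \<open>f\<close> is evaluated.\<close>

definition energy :: "nat \<Rightarrow> real" where
  "energy k = f (x (Suc k)) + \<kappa> * (incr k)\<^sup>2"

lemma theta_pos: "\<theta> > 0"
  unfolding hb_theta_def using step_size L_pos h_pos
  by (intro divide_pos_pos) (auto simp: field_simps)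

lemma kappa_pos: "\<kappa> > 0"
proof -
  have "1 + \<beta> * h * L > 0"
    by (intro add_pos_nonneg mult_nonneg_nonneg) (use beta_nonneg h_pos L_pos in auto)
  then have "(1 + \<beta> * h * L) / (2 * h\<^sup>2) > 0" using h_pos by (intro divide_pos_pos) auto
  then show ?thesis unfolding hb_kappa_def using theta_pos by linarith
qed

lemma incr_nonneg: "incr k \<ge> 0"
  by (simp add: incr_def)

lemma energy_decrease: "\<theta> * ((incr k)\<^sup>2 + (incr (Suc k))\<^sup>2) \<le> energy k - energy (Suc k)"
  using hb_step_energy[OF grad lip h_pos beta_nonneg c_pos conjunct1[OF gamma_bounds] recursion[of k]]
  unfolding energy_def incr_def by linarith

lemma energy_bounded: "\<exists>B. \<forall>k. B \<le> energy k"
proof -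
  obtain B where B: "\<And>y. B \<le> f y" using bdd by (auto simp: bdd_below_def)
  have "B \<le> energy k" for k
  proof -
    have "0 \<le> \<kappa> * (incr k)\<^sup>2" using kappa_pos by simp
    then show ?thesis unfolding energy_def using B[of "x (Suc k)"] by linarith
  qed
  then show ?thesis by blast
qed

lemma summable_incr_sq: "summable (\<lambda>k. (incr k)\<^sup>2)"
proof -
  obtain B where B: "\<And>k. B \<le> energy k" using energy_bounded by blast
  have "summable (\<lambda>k. \<theta> * (incr k)\<^sup>2)"
  proof (rule summable_telescoping[OF _ _ B])
    fix k
    show "0 \<le> \<theta> * (incr k)\<^sup>2" using theta_pos by simp
    have "0 \<le> \<theta> * (incr (Suc k))\<^sup>2" using theta_pos by simp
    then show "\<theta> * (incr k)\<^sup>2 \<le> energy k - energy (Suc k)"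
      using energy_decrease[of k] by (simp add: algebra_simps)
  qed
  then show ?thesis using theta_pos by (simp add: summable_cmult_iff)
qed

lemma gradient_bound: "\<exists>M>0. \<forall>k. norm (g (x (Suc k))) \<le> M * (incr k + incr (Suc k))"
proof -
  define M where "M = ((1 + \<beta> * h * L) + (1 + C * h)) / h\<^sup>2"
  have C: "C > 0" using gamma_bounds[of 0] c_pos by linarith
  have p: "\<beta> * h * L \<ge> 0" "C * h > 0" using beta_nonneg h_pos L_pos C by auto
  have "M > 0" unfolding M_def using p h_pos by (intro divide_pos_pos) auto
  moreover have "norm (g (x (Suc k))) \<le> M * (incr k + incr (Suc k))" for k
  proof -
    have "h\<^sup>2 * norm (g (x (Suc k))) \<le> (1 + \<beta> * h * L) * incr k + (1 + C * h) * incr (Suc k)"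
      unfolding incr_def
      by (rule hb_step_gradient_bound[OF lip h_pos beta_nonneg _ _ recursion])
        (use gamma_bounds[of "Suc k"] c_pos in auto)
    also have "\<dots> \<le> ((1 + \<beta> * h * L) + (1 + C * h)) * incr k + ((1 + \<beta> * h * L) + (1 + C * h)) * incr (Suc k)"
      by (intro add_mono[OF mult_right_mono mult_right_mono] incr_nonneg) (use p in linarith)+
    also have "\<dots> = h\<^sup>2 * (M * (incr k + incr (Suc k)))"
      unfolding M_def using h_pos by (simp add: field_simps)
    finally show ?thesis using h_pos by simp
  qed
  ultimately show ?thesis by blast
qed

lemma summable_gradient_sq: "summable (\<lambda>k. (norm (g (x k)))\<^sup>2)"
proof -
  obtain M where M: "M > 0" "\<And>k. norm (g (x (Suc k))) \<le> M * (incr k + incr (Suc k))"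
    using gradient_bound by blast
  have s: "summable (\<lambda>k. 2 * M\<^sup>2 * ((incr k)\<^sup>2 + (incr (Suc k))\<^sup>2))"
    by (intro summable_mult summable_add summable_incr_sq)
      (simp add: summable_Suc_iff[where f = "\<lambda>k. (incr k)\<^sup>2"] summable_incr_sq)
  have "summable (\<lambda>k. (norm (g (x (Suc k))))\<^sup>2)"
  proof (rule summable_comparison_test'[OF s])
    fix k
    have "(norm (g (x (Suc k))))\<^sup>2 \<le> (M * (incr k + incr (Suc k)))\<^sup>2"
      using M(2) by (rule power_mono) simp
    also have "\<dots> \<le> M\<^sup>2 * (2 * ((incr k)\<^sup>2 + (incr (Suc k))\<^sup>2))"
      unfolding power_mult_distrib
      using sum_squares_bound[of "incr k" "incr (Suc k)"] by (intro mult_left_mono) (auto simp: power2_sum)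
    finally show "norm ((norm (g (x (Suc k))))\<^sup>2) \<le> 2 * M\<^sup>2 * ((incr k)\<^sup>2 + (incr (Suc k))\<^sup>2)"
      by (simp add: algebra_simps)
  qed
  then show ?thesis by (simp add: summable_Suc_iff[where f = "\<lambda>k. (norm (g (x k)))\<^sup>2"])
qed

lemma gradient_tendsto_zero: "(\<lambda>k. norm (g (x k))) \<longlonglongrightarrow> 0"
  using tendsto_real_sqrt[OF summable_LIMSEQ_zero[OF summable_gradient_sq]] by simp

lemma incr_tendsto_zero: "incr \<longlonglongrightarrow> 0"
  using tendsto_real_sqrt[OF summable_LIMSEQ_zero[OF summable_incr_sq]] incr_nonneg by simp

text \<open>The energy as a function of the current and the previous point. Writing the squared
  distance as an inner product makes it visibly polynomial, which serves both differentiability and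
  definability.\<close>

definition ext_energy :: "'a \<times> 'a \<Rightarrow> real" where
  "ext_energy p = f (fst p) + \<kappa> * ((fst p - snd p) \<bullet> (fst p - snd p))"

definition ext_gradient :: "'a \<times> 'a \<Rightarrow> 'a \<times> 'a" where
  "ext_gradient p = (g (fst p) + (2 * \<kappa>) *\<^sub>R (fst p - snd p), - ((2 * \<kappa>) *\<^sub>R (fst p - snd p)))"

lemma ext_energy_seq: "ext_energy (x (Suc k), x k) = energy k"
  by (simp add: ext_energy_def energy_def incr_def power2_norm_eq_inner)

lemma ext_gradient: "(ext_energy has_derivative (\<lambda>v. ext_gradient p \<bullet> v)) (at p)"
proof -
  have 1: "((\<lambda>p. f (fst p)) has_derivative (\<lambda>v. g (fst p) \<bullet> fst v)) (at p)"
    by (rule has_derivative_compose[of fst fst]) (auto intro!: derivative_eq_intros grad)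
  show ?thesis
    unfolding ext_energy_def ext_gradient_def
    by (rule has_derivative_eq_rhs)
      (auto intro!: derivative_eq_intros 1 simp: fun_eq_iff inner_prod_def algebra_simps inner_commute)
qed

lemma ext_gradient_continuous: "continuous_on UNIV ext_gradient"
proof -
  have g: "continuous_on UNIV g" using lip by (rule lipschitz_on_continuous_on)
  show ?thesis
    unfolding ext_gradient_def
    by (intro continuous_intros continuous_on_compose2[OF g]) auto
qed

lemma ext_gradient_seq_bound:
  "norm (ext_gradient (x (Suc k), x k)) \<le> norm (g (x (Suc k))) + 4 * \<kappa> * incr k"
proof -
  have "norm (ext_gradient (x (Suc k), x k)) \<le> norm (g (x (Suc k)) + (2 * \<kappa>) *\<^sub>R (x (Suc k) - x k)) + norm (- ((2 * \<kappa>) *\<^sub>R (x (Suc k) - x k)))"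
    unfolding ext_gradient_def fst_conv snd_conv by (rule norm_Pair_le)
  also have "\<dots> \<le> (norm (g (x (Suc k))) + norm ((2 * \<kappa>) *\<^sub>R (x (Suc k) - x k))) + norm ((2 * \<kappa>) *\<^sub>R (x (Suc k) - x k))"
    by (intro add_mono norm_triangle_ineq) simp
  finally show ?thesis using kappa_pos by (simp add: incr_def)
qed

text \<open>With \<open>s\<close> the sum of two consecutive increments, the energy drops by at
  least a multiple of \<open>s\<close> squared and, by \<open>desingularization\<close>, by at most
  a multiple of \<open>s\<close> times the drop of \<open>V\<close>. Cancelling \<open>s\<close>
  leaves a telescoping bound.\<close>

theorem summable_incr_if_definable:
  assumes om: "o_minimal S" and def: "o_minimal.def_fun S (\<lambda>v. f (vec_of v))"
    and bounded: "bounded (range x)"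
  shows "summable incr"
proof -
  interpret o_minimal S by (rule om)
  have anti: "energy (Suc k) \<le> energy k" for k
  proof -
    have "0 \<le> \<theta> * ((incr k)\<^sup>2 + (incr (Suc k))\<^sup>2)" using theta_pos by simp
    then show ?thesis using energy_decrease[of k] by linarith
  qed
  have dec: "decseq energy" using anti by (rule decseq_SucI)
  obtain a where a: "energy \<longlonglongrightarrow> a" "\<And>k. a \<le> energy k"
    using energy_bounded decseq_convergent[OF dec] by metis
  \<comment> \<open>The desingularizing inequality concerns values strictly above \<open>a\<close>.
    If the energy attains its limit, it is constant from then on and the iterates stand
    still.\<close>
  show ?thesis
  proof (cases "\<exists>K. energy K = a")
    case True
    then obtain K where K: "energy K = a" ..
    have "incr k = 0" if "k \<ge> K" for k
    proof -
      have "energy k = a" "energy (Suc k) = a"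
        using decseqD[OF dec that] decseqD[OF dec, of K "Suc k"] that a(2) K by (auto intro!: antisym)
      then have "\<theta> * ((incr k)\<^sup>2 + (incr (Suc k))\<^sup>2) \<le> 0" using energy_decrease[of k] by simp
      then have "(incr k)\<^sup>2 + (incr (Suc k))\<^sup>2 \<le> 0" using theta_pos by (simp add: mult_le_0_iff)
      then show ?thesis by (simp add: sum_power2_le_zero_iff)
    qed
    then have "summable (\<lambda>k. incr (k + K))" by simp
    then show ?thesis by (subst (asm) summable_iff_shift)
  next
    case False
    then have gt: "energy k > a" for k using a(2)[of k] by (metis order_le_less)
    let ?z = "\<lambda>k. (x (Suc k), x k)"
    obtain R0 where R0: "\<And>k. norm (x k) \<le> R0" using bounded by (auto simp: bounded_iff)
    have R: "norm (?z k) \<le> R0 + R0" for k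
      using norm_Pair_le[of "x (Suc k)" "x k"] R0[of k] R0[of "Suc k"] by linarith
    have def\<Phi>: "def_fun (\<lambda>v. ext_energy (vec_of v))"
      unfolding ext_energy_def
      by (intro def_fun_add def_fun_mult def_fun_const def_fun_inner def_vec_diff def_vec_fst def_vec_snd
          def_vec_of def_fun_subst_vec[OF def])
    have lim: "(\<lambda>k. norm (ext_gradient (?z k))) \<longlonglongrightarrow> 0"
    proof (rule tendsto_sandwich[OF _ _ tendsto_const])
      show "(\<lambda>k. norm (g (x (Suc k))) + 4 * \<kappa> * incr k) \<longlonglongrightarrow> 0"
        using tendsto_add[OF LIMSEQ_Suc[OF gradient_tendsto_zero] tendsto_mult_left[OF incr_tendsto_zero, of "4 * \<kappa>"]]
        by simp
    qed (auto intro: always_eventually ext_gradient_seq_bound)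
    obtain \<epsilon> V B where \<epsilon>: "\<epsilon> > 0" and B: "\<And>t. t \<in> {a<..<a+\<epsilon>} \<Longrightarrow> \<bar>V t\<bar> \<le> B"
      and KL: "\<And>s t p. a < s \<Longrightarrow> s \<le> t \<Longrightarrow> t < a + \<epsilon> \<Longrightarrow> norm p \<le> R0 + R0 \<Longrightarrow> ext_energy p = t
       \<Longrightarrow> t - s \<le> norm (ext_gradient p) * (V t - V s)"
      by (rule desingularization[OF def\<Phi> ext_gradient ext_gradient_continuous R _ _ lim, of a])
        (auto simp: ext_energy_seq gt a(1))
    obtain N where N: "\<And>k. k \<ge> N \<Longrightarrow> energy k < a + \<epsilon>"
      using order_tendstoD(2)[OF a(1), of "a + \<epsilon>"] \<epsilon> by (auto simp: eventually_sequentially)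
    obtain M where M: "M > 0" "\<And>k. norm (g (x (Suc k))) \<le> M * (incr k + incr (Suc k))"
      using gradient_bound by blast
    define M' where "M' = M + 4 * \<kappa>"
    have M': "M' > 0" using M kappa_pos by (simp add: M'_def)
    have key: "\<theta> / 2 * incr k \<le> M' * (V (energy k) - V (energy (Suc k)))" if k: "k \<ge> N" for k
    proof -
      let ?s = "incr k + incr (Suc k)" and ?d = "V (energy k) - V (energy (Suc k))"
      have KLk: "energy k - energy (Suc k) \<le> norm (ext_gradient (?z k)) * ?d"
        by (rule KL[OF gt anti N[OF k] R ext_energy_seq])
      \<comment> \<open>Growth of \<open>V\<close> between consecutive energies is recovered from
        the inequality itself: a positive left side forces the second factor to be positive.\<close>
      have d: "?d \<ge> 0"
      proof (cases "energy k = energy (Suc k)")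
        case False
        then have "0 < norm (ext_gradient (?z k)) * ?d" using KLk anti[of k] by linarith
        then show ?thesis by (simp add: zero_less_mult_iff)
      qed simp
      have "norm (ext_gradient (?z k)) \<le> M' * ?s"
      proof -
        have "4 * \<kappa> * incr k \<le> 4 * \<kappa> * ?s"
          using kappa_pos incr_nonneg[of "Suc k"] by (intro mult_left_mono) auto
        then show ?thesis
          using ext_gradient_seq_bound[of k] M(2)[of k] unfolding M'_def distrib_right by linarith
      qed
      then have "norm (ext_gradient (?z k)) * ?d \<le> M' * ?s * ?d" using d by (rule mult_right_mono)
      moreover have "\<theta> / 2 * ?s\<^sup>2 \<le> \<theta> * ((incr k)\<^sup>2 + (incr (Suc k))\<^sup>2)"
      proof -
        have "?s\<^sup>2 \<le> 2 * ((incr k)\<^sup>2 + (incr (Suc k))\<^sup>2)"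
          using sum_squares_bound[of "incr k" "incr (Suc k)"] by (simp add: power2_sum)
        then show ?thesis using theta_pos by simp
      qed
      ultimately have le: "(\<theta> / 2 * ?s) * ?s \<le> (M' * ?d) * ?s"
        using KLk energy_decrease[of k] by (simp add: power2_eq_square mult.commute mult.left_commute)
      have "\<theta> / 2 * ?s \<le> M' * ?d"
      proof (cases "?s = 0")
        case True
        then show ?thesis using d M' by simp
      next
        case False
        then have "?s > 0" using incr_nonneg[of k] incr_nonneg[of "Suc k"] by linarith
        then show ?thesis by (rule mult_right_le_imp_le[OF le])
      qed
      moreover have "\<theta> / 2 * incr k \<le> \<theta> / 2 * ?s"
        using theta_pos incr_nonneg[of "Suc k"] by (intro mult_left_mono) auto
      ultimately show ?thesis by linarith
    qed
    have "summable (\<lambda>k. \<theta> / 2 * incr (k + N))"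
    proof (rule summable_telescoping[where E = "\<lambda>k. M' * V (energy (k + N))" and B = "- (M' * B)"])
      fix k
      show "0 \<le> \<theta> / 2 * incr (k + N)" using theta_pos incr_nonneg by simp
      show "\<theta> / 2 * incr (k + N) \<le> M' * V (energy (k + N)) - M' * V (energy (Suc k + N))"
        using key[of "k + N"] by (simp add: algebra_simps)
      have "\<bar>V (energy (k + N))\<bar> \<le> B" using gt N by (intro B) auto
      then have "M' * (- B) \<le> M' * V (energy (k + N))" using M' by (intro mult_left_mono) auto
      then show "- (M' * B) \<le> M' * V (energy (k + N))" by simp
    qed
    then have "summable (\<lambda>k. incr (k + N))" using theta_pos by (simp add: summable_cmult_iff)
    then show ?thesis by (subst (asm) summable_iff_shift)
  qed
qed

lemma converges_if_summable_incr:
  assumes "summable incr"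
  shows "\<exists>z. x \<longlonglongrightarrow> z \<and> g z = 0"
proof -
  obtain z where z: "x \<longlonglongrightarrow> z"
    using convergent_if_summable_increments[of x] assms by (auto simp: incr_def[abs_def])
  have "continuous_on UNIV g" using lip by (rule lipschitz_on_continuous_on)
  then have "(\<lambda>k. g (x k)) \<longlonglongrightarrow> g z"
    using z by (auto simp: continuous_on_eq_continuous_at isCont_tendsto_compose)
  moreover have "(\<lambda>k. g (x k)) \<longlonglongrightarrow> 0"
    using gradient_tendsto_zero by (rule tendsto_norm_zero_cancel)
  ultimately have "g z = 0" by (rule LIMSEQ_unique)
  then show ?thesis using z by blast
qed

end

section \<open>The given recursion as an instance\<close>

lemma hb_pair_eq: "snd (hb_pair g h \<beta> \<gamma> x0 x1 k) = hb_seq g h \<beta> \<gamma> x0 x1 (Suc k)"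
  by (simp add: hb_seq_def Let_def split: prod.split)

lemma hb_seq_recursion:
  "hb_seq g h \<beta> \<gamma> x0 x1 (Suc (Suc k))
     = hb_step g h \<beta> (\<gamma> (Suc k)) (hb_seq g h \<beta> \<gamma> x0 x1 k) (hb_seq g h \<beta> \<gamma> x0 x1 (Suc k))"
proof -
  have "hb_seq g h \<beta> \<gamma> x0 x1 (Suc (Suc k)) = snd (hb_pair g h \<beta> \<gamma> x0 x1 (Suc k))"
    by (simp only: hb_pair_eq)
  also have "\<dots> = hb_step g h \<beta> (\<gamma> (Suc k)) (fst (hb_pair g h \<beta> \<gamma> x0 x1 k)) (snd (hb_pair g h \<beta> \<gamma> x0 x1 k))"
    by (simp add: hb_step_def Let_def split: prod.split)
  finally show ?thesis by (simp only: hb_pair_eq) (simp add: hb_seq_def)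
qed

section \<open>Trapped sets near expanding fixed points\<close>

lemma second_difference_estimate:
  fixes f :: "'a::real_inner \<Rightarrow> real"
  assumes grad: "\<And>x. (f has_derivative (\<lambda>v. g x \<bullet> v)) (at x)"
    and A: "linear A"
    and e: "\<And>w. norm w < d \<Longrightarrow> norm (g (z + w) - g z - A w) \<le> e * norm w" "e \<ge> 0"
    and t: "t > 0" "t * (norm u + norm v) < d"
  shows "\<bar>f (z + t *\<^sub>R u + t *\<^sub>R v) - f (z + t *\<^sub>R u) - f (z + t *\<^sub>R v) + f z - t\<^sup>2 * (A v \<bullet> u)\<bar>
      \<le> 2 * e * t\<^sup>2 * (norm u + norm v)\<^sup>2"
proof -
  \<comment> \<open>The second difference is the increment of \<open>\<phi>\<close> over the unit
    interval; the mean value theorem reduces it to a difference of gradients at two points near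
    \<open>z\<close>, where \<open>A\<close> approximates well.\<close>
  define \<phi> where "\<phi> s = f (z + t *\<^sub>R v + s *\<^sub>R (t *\<^sub>R u)) - f (z + s *\<^sub>R (t *\<^sub>R u))" for s
  define \<phi>' where "\<phi>' s = (g (z + t *\<^sub>R v + s *\<^sub>R (t *\<^sub>R u)) - g (z + s *\<^sub>R (t *\<^sub>R u))) \<bullet> (t *\<^sub>R u)" for s
  have line: "((\<lambda>s. f (p + s *\<^sub>R q)) has_real_derivative g (p + s *\<^sub>R q) \<bullet> q) (at s)" for p q s
  proof -
    have "((\<lambda>s. f (p + s *\<^sub>R q)) has_derivative (\<lambda>r. g (p + s *\<^sub>R q) \<bullet> (r *\<^sub>R q))) (at s)"
      by (rule has_derivative_compose[of "\<lambda>s. p + s *\<^sub>R q" "\<lambda>r. r *\<^sub>R q"])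
        (auto intro!: derivative_eq_intros grad)
    then show ?thesis by (rule has_derivative_imp_has_field_derivative) simp
  qed
  have "(\<phi> has_real_derivative \<phi>' s) (at s)" for s
    unfolding \<phi>_def \<phi>'_def inner_diff_left by (intro DERIV_diff line)
  then obtain s where s: "0 < s" "s < 1" "\<phi> 1 - \<phi> 0 = \<phi>' s"
    using MVT2[of 0 1 \<phi> \<phi>'] by auto
  define w1 w2 where "w1 = t *\<^sub>R v + s *\<^sub>R (t *\<^sub>R u)" and "w2 = s *\<^sub>R (t *\<^sub>R u)"
  have n2: "norm w2 \<le> t * norm u" using s t by (simp add: w2_def mult_left_le_one_le)
  have n1: "norm w1 \<le> t * (norm u + norm v)"
    using norm_triangle_ineq[of "t *\<^sub>R v" w2] n2 t(1) unfolding w1_def w2_def by (simp add: algebra_simps)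
  have n2': "norm w2 \<le> t * (norm u + norm v)"
    using n2 t(1) by (simp add: distrib_left add_increasing2)
  have "norm ((g (z + w1) - g z - A w1) - (g (z + w2) - g z - A w2)) \<le> e * norm w1 + e * norm w2"
    using e(1)[of w1] e(1)[of w2] n1 n2' t(2) norm_triangle_ineq4[of "g (z + w1) - g z - A w1" "g (z + w2) - g z - A w2"]
    by linarith
  also have "\<dots> \<le> e * (t * (norm u + norm v)) + e * (t * (norm u + norm v))"
    using n1 n2' e(2) by (intro add_mono mult_left_mono)
  finally have est: "norm (g (z + w1) - g (z + w2) - t *\<^sub>R A v) \<le> 2 * e * t * (norm u + norm v)"
    by (simp add: w1_def w2_def linear_add[OF A] linear_scale[OF A] algebra_simps)
  have "f (z + t *\<^sub>R u + t *\<^sub>R v) - f (z + t *\<^sub>R u) - f (z + t *\<^sub>R v) + f z = \<phi> 1 - \<phi> 0"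
    by (simp add: \<phi>_def algebra_simps)
  also have "\<dots> = (g (z + w1) - g (z + w2)) \<bullet> (t *\<^sub>R u)"
    unfolding s(3) \<phi>'_def w1_def w2_def by (simp add: algebra_simps)
  finally have "f (z + t *\<^sub>R u + t *\<^sub>R v) - f (z + t *\<^sub>R u) - f (z + t *\<^sub>R v) + f z - t\<^sup>2 * (A v \<bullet> u)
      = (g (z + w1) - g (z + w2) - t *\<^sub>R A v) \<bullet> (t *\<^sub>R u)"
    by (simp add: inner_diff_left power2_eq_square algebra_simps)
  also have "\<bar>\<dots>\<bar> \<le> norm (g (z + w1) - g (z + w2) - t *\<^sub>R A v) * norm (t *\<^sub>R u)"
    by (rule Cauchy_Schwarz_ineq2)
  also have "\<dots> \<le> (2 * e * t * (norm u + norm v)) * (t * (norm u + norm v))"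
    using est t(1) e(2) by (intro mult_mono) auto
  finally show ?thesis by (simp add: power2_eq_square algebra_simps)
qed

text \<open>The second difference does not change when \<open>u\<close> and \<open>v\<close> are
  swapped, so \<open>A v \<bullet> u\<close> and \<open>A u \<bullet> v\<close> approximate the same
  number up to an arbitrarily small error after division by \<open>t\<^sup>2\<close>.\<close>

lemma symmetric_second_derivative:
  fixes f :: "'a::real_inner \<Rightarrow> real"
  assumes grad: "\<And>x. (f has_derivative (\<lambda>v. g x \<bullet> v)) (at x)"
    and A: "(g has_derivative A) (at z)"
  shows "A u \<bullet> v = u \<bullet> A v"
proof -
  have lin: "linear A" using A by (rule has_derivative_linear)
  have "\<bar>A v \<bullet> u - A u \<bullet> v\<bar> \<le> 4 * (norm u + norm v)\<^sup>2 * e" if e: "e > 0" for e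
  proof -
    obtain d where d: "d > 0" "\<And>y. norm (y - z) < d \<Longrightarrow> norm (g y - g z - A (y - z)) \<le> e * norm (y - z)"
      using A e unfolding has_derivative_at_alt by blast
    have d': "norm (g (z + w) - g z - A w) \<le> e * norm w" if "norm w < d" for w
      using d(2)[of "z + w"] that by simp
    define t where "t = d / (2 * (norm u + norm v + 1))"
    have pos: "norm u + norm v + 1 > 0" by (simp add: add_nonneg_pos)
    have t1: "t > 0" unfolding t_def using d(1) pos by (intro divide_pos_pos) auto
    have "t * (norm u + norm v) \<le> t * (norm u + norm v + 1)" using t1 by simp
    also have "\<dots> = d / 2" unfolding t_def using pos by (simp add: field_simps)
    finally have t: "t > 0" "t * (norm u + norm v) < d" using t1 d(1) by linarith+
    have 1: "\<bar>f (z + t *\<^sub>R u + t *\<^sub>R v) - f (z + t *\<^sub>R u) - f (z + t *\<^sub>R v) + f z - t\<^sup>2 * (A v \<bullet> u)\<bar>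
        \<le> 2 * e * t\<^sup>2 * (norm u + norm v)\<^sup>2"
      by (rule second_difference_estimate[OF grad lin d' _ t]) (use e in auto)
    have "t * (norm v + norm u) < d" using t(2) by (simp add: add.commute)
    then have "\<bar>f (z + t *\<^sub>R v + t *\<^sub>R u) - f (z + t *\<^sub>R v) - f (z + t *\<^sub>R u) + f z - t\<^sup>2 * (A u \<bullet> v)\<bar>
        \<le> 2 * e * t\<^sup>2 * (norm v + norm u)\<^sup>2"
      by (intro second_difference_estimate[OF grad lin d' _ t(1)]) (use e in auto)
    then have 2: "\<bar>f (z + t *\<^sub>R u + t *\<^sub>R v) - f (z + t *\<^sub>R v) - f (z + t *\<^sub>R u) + f z - t\<^sup>2 * (A u \<bullet> v)\<bar>
        \<le> 2 * e * t\<^sup>2 * (norm u + norm v)\<^sup>2"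
      by (simp only: add.assoc add.commute[of "t *\<^sub>R v"] add.commute[of "norm v"])
    have "\<bar>t\<^sup>2 * (A v \<bullet> u) - t\<^sup>2 * (A u \<bullet> v)\<bar> \<le> 2 * e * t\<^sup>2 * (norm u + norm v)\<^sup>2 + 2 * e * t\<^sup>2 * (norm u + norm v)\<^sup>2"
      using 1 2 by linarith
    then have "t\<^sup>2 * \<bar>A v \<bullet> u - A u \<bullet> v\<bar> \<le> t\<^sup>2 * (4 * (norm u + norm v)\<^sup>2 * e)"
      unfolding right_diff_distrib[symmetric] abs_mult by (simp add: algebra_simps)
    then show ?thesis using t(1) by simp
  qed
  then have *: "\<bar>A v \<bullet> u - A u \<bullet> v\<bar> \<le> K * e" if "e > 0" "K = 4 * (norm u + norm v)\<^sup>2" for e K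
    using that by blast
  have "\<bar>A v \<bullet> u - A u \<bullet> v\<bar> \<le> 0"
  proof (rule field_le_epsilon)
    fix e :: real assume e: "e > 0"
    define K where "K = 4 * (norm u + norm v)\<^sup>2"
    have K: "K \<ge> 0" "K + 1 > 0" by (simp_all add: K_def add_nonneg_pos)
    have "\<bar>A v \<bullet> u - A u \<bullet> v\<bar> \<le> K * (e / (K + 1))"
      by (rule *) (use e K in \<open>auto simp: K_def\<close>)
    also have "\<dots> \<le> e" using e K by (simp add: pos_divide_le_eq distrib_left mult.commute)
    finally show "\<bar>A v \<bullet> u - A u \<bullet> v\<bar> \<le> 0 + e" by simp
  qed
  then show ?thesis by (simp add: inner_commute)
qed

section \<open>Spectral theorem for symmetric operators\<close>

lemma linear_term_zero:
  fixes a b :: real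
  assumes "\<And>t. 2 * t * a \<le> t\<^sup>2 * b"
  shows "a = 0"
proof (rule ccontr)
  assume a: "a \<noteq> 0"
  \<comment> \<open>The test value \<open>t = a / k\<close> is so small that the quadratic term
    cannot outweigh the linear one.\<close>
  define k where "k = \<bar>b\<bar> + 1"
  have k: "k > 0" "b < k" by (auto simp: k_def)
  have "2 * (a / k) * a \<le> (a / k)\<^sup>2 * b" by (rule assms)
  then have "a\<^sup>2 * (2 * k) \<le> a\<^sup>2 * b" using k by (simp add: field_simps power2_eq_square)
  then have "2 * k \<le> b" using a by simp
  then show False using k by linarith
qed

text \<open>Induction on the dimension: a maximizer of the quadratic form on the unit sphere of
  \<open>S\<close> is an eigenvector, and by symmetry its orthogonal complement in \<open>S\<close>
  is again invariant.\<close>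

lemma symmetric_eigenbasis_subspace:
  fixes A :: "'a::euclidean_space \<Rightarrow> 'a"
  assumes A: "linear A" and sym: "\<And>x y. A x \<bullet> y = x \<bullet> A y"
    and "subspace S" "A ` S \<subseteq> S"
  shows "\<exists>B. B \<subseteq> S \<and> finite B \<and> pairwise orthogonal B \<and> (\<forall>u\<in>B. norm u = 1 \<and> (\<exists>\<eta>. A u = \<eta> *\<^sub>R u)) \<and> span B = S"
  using assms(3,4)
proof (induction "dim S" arbitrary: S rule: less_induct)
  case less
  show ?case
  proof (cases "S = {0}")
    case True
    then show ?thesis by (intro exI[of _ "{}"]) auto
  next
    case False
    then obtain w where w: "w \<in> S" "w \<noteq> 0" using subspace_0[OF less.prems(1)] by blast
    have "w /\<^sub>R norm w \<in> sphere 0 1 \<inter> S" using w less.prems(1) by (auto intro: subspace_scale)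
    moreover have "compact (sphere 0 1 \<inter> S)"
      using closed_subspace[OF less.prems(1)] by (intro compact_Int_closed compact_sphere)
    moreover have "continuous_on (sphere 0 1 \<inter> S) (\<lambda>x. A x \<bullet> x)"
      using A by (intro continuous_on_inner continuous_on_id linear_continuous_on)
        (simp add: linear_conv_bounded_linear)
    ultimately have "\<exists>u\<in>sphere 0 1 \<inter> S. \<forall>y\<in>sphere 0 1 \<inter> S. A y \<bullet> y \<le> A u \<bullet> u"
      by (intro continuous_attains_sup) blast+
    then obtain u where u: "u \<in> S" "norm u = 1"
      and umax: "\<And>y. y \<in> S \<Longrightarrow> norm y = 1 \<Longrightarrow> A y \<bullet> y \<le> A u \<bullet> u"
      by auto
    define \<eta> where "\<eta> = A u \<bullet> u"
    have uu: "u \<bullet> u = 1" using u(2) by (simp add: dot_square_norm)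
    have quad: "A y \<bullet> y \<le> \<eta> * (y \<bullet> y)" if y: "y \<in> S" for y
    proof (cases "y = 0")
      case False
      have "A (y /\<^sub>R norm y) \<bullet> (y /\<^sub>R norm y) \<le> \<eta>"
        unfolding \<eta>_def using y False less.prems(1) by (intro umax) (auto intro: subspace_scale)
      then show ?thesis
        using False by (simp add: linear_scale[OF A] dot_square_norm field_simps power2_eq_square)
    qed simp
    \<comment> \<open>Stationarity: moving from \<open>u\<close> along an orthogonal
      \<open>y\<close> changes the quadratic form to first order by twice
      \<open>A u \<bullet> y\<close>, which must vanish at a maximum.\<close>
    have ortho: "A u \<bullet> y = 0" if y: "y \<in> S" "u \<bullet> y = 0" for y
    proof (rule linear_term_zero)
      fix t :: real
      have "u + t *\<^sub>R y \<in> S" using u y less.prems(1) by (auto intro: subspace_add subspace_scale)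
      from quad[OF this]
      have "A u \<bullet> u + 2 * t * (A u \<bullet> y) + t\<^sup>2 * (A y \<bullet> y) \<le> \<eta> * (1 + t\<^sup>2 * (y \<bullet> y))"
        using y(2) uu sym[of y u]
        by (simp add: linear_add[OF A] linear_scale[OF A] inner_add_left inner_add_right
            power2_eq_square inner_commute algebra_simps)
      then show "2 * t * (A u \<bullet> y) \<le> t\<^sup>2 * (\<eta> * (y \<bullet> y) - A y \<bullet> y)"
        by (simp add: \<eta>_def algebra_simps)
    qed
    have eig: "A u = \<eta> *\<^sub>R u"
    proof -
      let ?r = "A u - \<eta> *\<^sub>R u"
      have r: "?r \<in> S" using u less.prems by (auto intro!: subspace_diff subspace_scale)
      have ur: "u \<bullet> ?r = 0" using uu by (simp add: inner_diff_right \<eta>_def inner_commute)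
      have "?r \<bullet> ?r = A u \<bullet> ?r - \<eta> * (u \<bullet> ?r)" by (simp add: inner_diff_left)
      then have "?r \<bullet> ?r = 0" using ortho[OF r ur] ur by simp
      then show ?thesis by simp
    qed
    define S' where "S' = {x \<in> S. u \<bullet> x = 0}"
    have sub': "subspace S'"
      using less.prems(1) unfolding S'_def subspace_def by (auto simp: inner_add_right)
    have inv': "A ` S' \<subseteq> S'"
    proof
      fix y assume "y \<in> A ` S'"
      then obtain x where x: "x \<in> S" "u \<bullet> x = 0" "y = A x" by (auto simp: S'_def)
      have "u \<bullet> y = 0" using x sym[of u x] eig by simp
      then show "y \<in> S'" using x less.prems(2) by (auto simp: S'_def)
    qed
    have "u \<notin> S'" using uu by (simp add: S'_def)
    then have "S' \<subset> S" using u(1) unfolding S'_def by blast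
    then have "dim S' < dim S"
      using sub' less.prems(1) by (metis dim_psubset span_eq_iff)
    then obtain B where B: "B \<subseteq> S'" "finite B" "pairwise orthogonal B"
      "\<forall>u\<in>B. norm u = 1 \<and> (\<exists>\<eta>. A u = \<eta> *\<^sub>R u)" "span B = S'"
      using less.hyps[OF _ sub' inv'] by blast
    have "span (insert u B) = S"
    proof
      show "span (insert u B) \<subseteq> S"
        using u B(1) less.prems(1) by (intro span_minimal) (auto simp: S'_def)
      show "S \<subseteq> span (insert u B)"
      proof
        fix x assume x: "x \<in> S"
        have "x - (u \<bullet> x) *\<^sub>R u \<in> S'"
          using x u uu less.prems(1) by (auto simp: S'_def inner_diff_right intro!: subspace_diff subspace_scale)
        then show "x \<in> span (insert u B)" using B(5) by (auto simp: span_insert)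
      qed
    qed
    moreover have "pairwise orthogonal (insert u B)"
      using B(1,3) by (auto simp: pairwise_insert orthogonal_def S'_def inner_commute)
    ultimately show ?thesis
      using B u eig by (intro exI[of _ "insert u B"]) (auto simp: S'_def)
  qed
qed

text \<open>The Parseval identity is the form in which the basis is used: it splits quadratic forms
  into sums over eigenmodes.\<close>

lemma symmetric_eigenbasis:
  fixes A :: "'a::euclidean_space \<Rightarrow> 'a"
  assumes A: "linear A" and sym: "\<And>x y. A x \<bullet> y = x \<bullet> A y"
  obtains B \<eta> where "finite B" "\<And>u. u \<in> B \<Longrightarrow> norm u = 1" "\<And>u. u \<in> B \<Longrightarrow> A u = \<eta> u *\<^sub>R u"
    "\<And>x y. x \<bullet> y = (\<Sum>u\<in>B. (x \<bullet> u) * (y \<bullet> u))"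
proof -
  obtain B where B: "finite B" "pairwise orthogonal B"
    and B': "\<forall>u\<in>B. norm u = 1 \<and> (\<exists>\<eta>. A u = \<eta> *\<^sub>R u)" and span: "span B = UNIV"
    using symmetric_eigenbasis_subspace[OF A sym subspace_UNIV subset_UNIV] by (elim exE conjE) simp
  have B1: "\<And>u. u \<in> B \<Longrightarrow> norm u = 1" using B' by blast
  obtain \<eta> where \<eta>: "\<And>u. u \<in> B \<Longrightarrow> A u = \<eta> u *\<^sub>R u" using B' by metis
  have "x \<bullet> y = (\<Sum>u\<in>B. (x \<bullet> u) * (y \<bullet> u))" for x y
  proof -
    have "x \<bullet> y = x \<bullet> (\<Sum>u\<in>B. (y \<bullet> u) *\<^sub>R u)"
      using orthonormal_basis_expand[OF B(2) B1 _ B(1), of y] span by simp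
    then show ?thesis by (simp add: inner_sum_right mult.commute)
  qed
  from that[OF B(1) B1 \<eta> this] show thesis .
qed

section \<open>Two criteria for null sets\<close>

lemma negligible_if_translates_disjoint:
  fixes S :: "'a::euclidean_space set"
  assumes S: "compact S" and disj: "\<And>p t. p \<in> S \<Longrightarrow> t \<noteq> 0 \<Longrightarrow> p + t *\<^sub>R e \<notin> S"
  shows "negligible S"
proof -
  \<comment> \<open>These translates are pairwise disjoint, have equal measure and lie in one ball,
    so all multiples of the measure of \<open>S\<close> stay below a common bound.\<close>
  define T where "T n = (+) ((1 / real (Suc n)) *\<^sub>R e) ` S" for n
  obtain R where R: "\<And>p. p \<in> S \<Longrightarrow> norm p \<le> R" using compact_imp_bounded[OF S] by (auto simp: bounded_iff)
  have mS: "S \<in> lmeasurable" using S by (rule lmeasurable_compact)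
  have mT: "T n \<in> lmeasurable" for n unfolding T_def by (rule measurable_translation[OF mS])
  have T_sub: "T n \<subseteq> cball 0 (R + norm e)" for n
  proof
    fix q assume "q \<in> T n"
    then obtain p where p: "p \<in> S" "q = (1 / real (Suc n)) *\<^sub>R e + p" by (auto simp: T_def)
    have "norm ((1 / real (Suc n)) *\<^sub>R e) \<le> norm e" 
      by (simp only: norm_scaleR) (simp add: divide_le_eq mult_le_cancel_left1)
    then show "q \<in> cball 0 (R + norm e)"
      using R[OF p(1)] norm_triangle_ineq[of "(1 / real (Suc n)) *\<^sub>R e" p] p(2) by simp
  qed
  have pw: "pairwise (\<lambda>i j. disjnt (T i) (T j)) I" for I
  proof (rule pairwiseI)
    fix i j :: nat assume ij: "i \<noteq> j"
    have False if q: "q \<in> T i" "q \<in> T j" for q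
    proof -
      obtain p p' where p: "p \<in> S" "q = (1 / real (Suc i)) *\<^sub>R e + p" "p' \<in> S" "q = (1 / real (Suc j)) *\<^sub>R e + p'"
        using q unfolding T_def by blast
      have "p' = p + (1 / real (Suc i) - 1 / real (Suc j)) *\<^sub>R e"
        using p(2,4) by (simp add: algebra_simps)
      moreover have "1 / real (Suc i) - 1 / real (Suc j) \<noteq> 0" using ij by (simp del: of_nat_Suc)
      ultimately show False using disj[OF p(1)] p(3) by blast
    qed
    then show "disjnt (T i) (T j)" by (auto simp: disjnt_def)
  qed
  let ?M = "measure lebesgue (cball (0::'a) (R + norm e))"
  have "real N * measure lebesgue S \<le> ?M" for N
  proof -
    have "real N * measure lebesgue S = (\<Sum>n<N. measure lebesgue (T n))"
      by (simp add: T_def measure_translation)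
    also have "\<dots> = measure lebesgue (\<Union>n<N. T n)"
      by (rule measure_UNION'[symmetric]) (auto intro: mT pw)
    also have "\<dots> \<le> ?M"
      by (rule measure_mono_fmeasurable) (use T_sub mT in \<open>auto intro!: fmeasurableD sets.finite_UN\<close>)
    finally show ?thesis .
  qed
  then have "measure lebesgue S \<le> 0"
    using reals_Archimedean3[of "measure lebesgue S"] by (metis linorder_not_less)
  then have "measure lebesgue S = 0" by (simp add: measure_le_0_iff)
  then show ?thesis using mS by (simp add: negligible_iff_measure)
qed

text \<open>The inverse is \<open>K\<close>-Lipschitz on the range of \<open>F\<close>, and
  Lipschitz maps of a Euclidean space into itself preserve null sets. Intersecting \<open>N\<close>
  with the range covers maps that are not surjective.\<close>

lemma negligible_vimage_expansive:
  fixes F :: "'a::euclidean_space \<Rightarrow> 'a"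
  assumes F: "\<And>p q. norm (p - q) \<le> K * norm (F p - F q)" and N: "negligible N"
  shows "negligible (F -` N)"
proof -
  have inj: "inj F"
  proof (rule injI)
    fix p q assume "F p = F q"
    then show "p = q" using F[of p q] by simp
  qed
  have "negligible (inv F ` (N \<inter> range F))"
  proof (rule negligible_locally_Lipschitz_image)
    show "negligible (N \<inter> range F)" using N by (rule negligible_subset) simp
    fix x assume x: "x \<in> N \<inter> range F"
    have "norm (inv F y - inv F x) \<le> K * norm (y - x)" if "y \<in> N \<inter> range F" for y
      using F[of "inv F y" "inv F x"] x that by (simp add: f_inv_into_f)
    then show "\<exists>T B. open T \<and> x \<in> T \<and> (\<forall>y\<in>(N \<inter> range F) \<inter> T. norm (inv F y - inv F x) \<le> B * norm (y - x))"
      by (intro exI[of _ UNIV] exI[of _ K]) auto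
  qed simp
  moreover have "F -` N \<subseteq> inv F ` (N \<inter> range F)"
    using inj by (force simp: image_iff)
  ultimately show ?thesis by (rule negligible_subset)
qed

text \<open>The assumption \<open>strict\<close> compares \<open>F\<close> with \<open>T\<close> on
  all pairs near \<open>z\<close>, not only with \<open>z\<close> itself, as differences of two
  orbits require. The resulting error in the form is quadratic in \<open>p - q\<close> and is
  absorbed by the margin \<open>\<epsilon>\<close>.\<close>

lemma quadratic_form_expansion:
  fixes F T J :: "'a::euclidean_space \<Rightarrow> 'a"
  assumes T: "linear T" and J: "linear J"
    and exp: "\<And>v. \<mu> * (J v \<bullet> v) + \<epsilon> * (norm v)\<^sup>2 \<le> J (T v) \<bullet> T v" and \<epsilon>: "\<epsilon> > 0"
    and strict: "\<And>\<omega>. \<omega> > 0 \<Longrightarrow> \<exists>r>0. \<forall>p\<in>cball z r. \<forall>q\<in>cball z r. norm (F p - F q - T (p - q)) \<le> \<omega> * norm (p - q)"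
  shows "\<exists>r>0. \<forall>p\<in>cball z r. \<forall>q\<in>cball z r. \<mu> * (J (p - q) \<bullet> (p - q)) \<le> J (F p - F q) \<bullet> (F p - F q)"
proof -
  obtain KT where KT: "KT > 0" "\<And>v. norm (T v) \<le> KT * norm v"
    using linear_bounded_pos[OF T] by blast
  obtain KJ where KJ: "KJ > 0" "\<And>v. norm (J v) \<le> KJ * norm v"
    using linear_bounded_pos[OF J] by blast
  \<comment> \<open>A remainder of size \<open>\<omega> * n\<close> changes the form by at most
    \<open>KJ * (2 * KT * \<omega> + \<omega>\<^sup>2) * n\<^sup>2\<close>; the cap at 1 bounds the
    square by \<open>\<omega>\<close>.\<close>
  define \<omega> where "\<omega> = min 1 (\<epsilon> / (KJ * (2 * KT + 1)))"
  have pos: "KJ * (2 * KT + 1) > 0" using KT KJ by simp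
  have \<omega>: "\<omega> > 0" "\<omega> \<le> 1" unfolding \<omega>_def using \<epsilon> pos by auto
  have "\<omega> \<le> \<epsilon> / (KJ * (2 * KT + 1))" by (simp add: \<omega>_def)
  then have \<omega>\<epsilon>: "\<omega> * (KJ * (2 * KT + 1)) \<le> \<epsilon>" using pos by (simp add: pos_le_divide_eq)
  obtain r where r: "r > 0" "\<And>p q. p \<in> cball z r \<Longrightarrow> q \<in> cball z r \<Longrightarrow> norm (F p - F q - T (p - q)) \<le> \<omega> * norm (p - q)"
    using strict[OF \<omega>(1)] by blast
  have "\<mu> * (J (p - q) \<bullet> (p - q)) \<le> J (F p - F q) \<bullet> (F p - F q)" if pq: "p \<in> cball z r" "q \<in> cball z r" for p q
  proof -
    define v w n where "v = T (p - q)" and "w = F p - F q - T (p - q)" and "n = norm (p - q)"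
    have nv: "norm v \<le> KT * n" unfolding v_def n_def by (rule KT(2))
    have nw: "norm w \<le> \<omega> * n" unfolding w_def n_def by (rule r(2)[OF pq])
    have n0: "n \<ge> 0" by (simp add: n_def)
    have b: "\<bar>J a \<bullet> b\<bar> \<le> KJ * (norm a * norm b)" for a b
      using order_trans[OF Cauchy_Schwarz_ineq2[of "J a" b] mult_right_mono[OF KJ(2)[of a] norm_ge_zero[of b]]]
      by (simp add: mult.assoc)
    have vw: "norm v * norm w \<le> KT * \<omega> * n\<^sup>2"
      using mult_mono[OF nv nw] KT(1) n0 by (simp add: power2_eq_square algebra_simps)
    have ww: "norm w * norm w \<le> \<omega> * n\<^sup>2"
    proof -
      have "norm w * norm w \<le> (\<omega> * n) * (\<omega> * n)" using mult_mono[OF nw nw] \<omega>(1) n0 by simp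
      also have "\<dots> = \<omega> * (\<omega> * n\<^sup>2)" by (simp add: power2_eq_square)
      also have "\<dots> \<le> \<omega> * n\<^sup>2" using \<omega> by (simp add: mult_left_le_one_le)
      finally show ?thesis .
    qed
    have "J (v + w) \<bullet> (v + w) = J v \<bullet> v + (J v \<bullet> w + J w \<bullet> v + J w \<bullet> w)"
      by (simp add: linear_add[OF J] inner_add_left inner_add_right)
    moreover have "J v \<bullet> w + J w \<bullet> v + J w \<bullet> w \<ge> - (\<epsilon> * n\<^sup>2)"
    proof -
      have "KJ * (norm v * norm w) + KJ * (norm w * norm v) + KJ * (norm w * norm w)
          \<le> KJ * (KT * \<omega> * n\<^sup>2) + KJ * (KT * \<omega> * n\<^sup>2) + KJ * (\<omega> * n\<^sup>2)"
        using vw ww KJ(1) by (intro add_mono mult_left_mono) (auto simp: mult.commute)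
      also have "\<dots> = \<omega> * (KJ * (2 * KT + 1)) * n\<^sup>2" by (simp add: algebra_simps)
      also have "\<dots> \<le> \<epsilon> * n\<^sup>2" using \<omega>\<epsilon> by (intro mult_right_mono) auto
      finally show ?thesis using b[of v w] b[of w v] b[of w w] by linarith
    qed
    moreover have "v + w = F p - F q" by (simp add: v_def w_def)
    ultimately show ?thesis
      using exp[of "p - q"] unfolding v_def[symmetric] n_def by simp
  qed
  then show ?thesis using r(1) by blast
qed

text \<open>Replaces the center-stable manifold theorem: two orbits that start on a line in the
  direction \<open>e\<close> separate exponentially, so the trapped set meets each such line at most once.\<close>

lemma negligible_trapped_set:
  fixes F J :: "'a::euclidean_space \<Rightarrow> 'a"
  assumes J: "linear J" and contF: "continuous_on UNIV F" and \<mu>: "\<mu> > 1"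
    and exp: "\<And>p q. p \<in> cball z r \<Longrightarrow> q \<in> cball z r \<Longrightarrow>
       \<mu> * (J (p - q) \<bullet> (p - q)) \<le> J (F p - F q) \<bullet> (F p - F q)"
    and e: "J e \<bullet> e > 0"
  shows "negligible {p. \<forall>n. (F ^^ n) p \<in> cball z r}" (is "negligible ?W")
proof (rule negligible_if_translates_disjoint)
  have contn: "continuous_on UNIV (F ^^ n)" for n
  proof (induction n)
    case (Suc n)
    have "continuous_on UNIV (\<lambda>p. F ((F ^^ n) p))"
      by (rule continuous_on_compose2[OF contF Suc]) simp
    then show ?case by (simp add: o_def)
  qed (simp add: id_def)
  have eq: "?W = cball z r \<inter> (\<Inter>n. (F ^^ n) -` cball z r)"
    by (auto dest: spec[where x = 0])
  have "closed (\<Inter>n. (F ^^ n) -` cball z r)"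
    by (intro closed_INT ballI closed_vimage closed_cball contn)
  then show "compact ?W"
    unfolding eq by (intro compact_Int_closed compact_cball)
next
  fix p and t :: real assume p: "p \<in> ?W" and t: "t \<noteq> 0"
  show "p + t *\<^sub>R e \<notin> ?W"
  proof
    assume q: "p + t *\<^sub>R e \<in> ?W"
    define d where "d n = (F ^^ n) (p + t *\<^sub>R e) - (F ^^ n) p" for n
    define Q0 where "Q0 = J (d 0) \<bullet> d 0"
    have "Q0 = t\<^sup>2 * (J e \<bullet> e)"
      by (simp add: Q0_def d_def linear_scale[OF J] power2_eq_square)
    then have Q0: "Q0 > 0" using e t by simp
    have grow: "\<mu> ^ n * Q0 \<le> J (d n) \<bullet> d n" for n
    proof (induction n)
      case (Suc n)
      have "\<mu> ^ Suc n * Q0 \<le> \<mu> * (J (d n) \<bullet> d n)" using Suc \<mu> by simp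
      also have "\<dots> \<le> J (d (Suc n)) \<bullet> d (Suc n)"
        using exp[of "(F ^^ n) (p + t *\<^sub>R e)" "(F ^^ n) p"] p q by (simp add: d_def)
      finally show ?case .
    qed (simp add: Q0_def)
    obtain KJ where KJ: "KJ > 0" "\<And>v. norm (J v) \<le> KJ * norm v"
      using linear_bounded_pos[OF J] by blast
    have upper: "J (d n) \<bullet> d n \<le> KJ * (2 * r)\<^sup>2" for n
    proof -
      have "dist ((F ^^ n) (p + t *\<^sub>R e)) ((F ^^ n) p) \<le> r + r"
      proof -
        have "dist z ((F ^^ n) (p + t *\<^sub>R e)) \<le> r" "dist z ((F ^^ n) p) \<le> r" using p q by auto
        then show ?thesis
          using dist_triangle3[of "(F ^^ n) (p + t *\<^sub>R e)" "(F ^^ n) p" z] by linarith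
      qed
      then have nd: "norm (d n) \<le> 2 * r" by (simp add: d_def dist_norm)
      have "J (d n) \<bullet> d n \<le> norm (J (d n)) * norm (d n)" by (rule norm_cauchy_schwarz)
      also have "\<dots> \<le> KJ * norm (d n) * norm (d n)" using KJ(2) by (rule mult_right_mono) simp
      also have "\<dots> = KJ * (norm (d n))\<^sup>2" by (simp add: power2_eq_square)
      also have "\<dots> \<le> KJ * (2 * r)\<^sup>2" using nd KJ(1) by (intro mult_left_mono power_mono) auto
      finally show ?thesis .
    qed
    obtain n where "KJ * (2 * r)\<^sup>2 / Q0 < \<mu> ^ n"
      using real_arch_pow[OF \<mu>] by blast
    then have "KJ * (2 * r)\<^sup>2 < \<mu> ^ n * Q0" using Q0 by (simp add: divide_less_eq)
    then show False using grow[of n] upper[of n] by linarith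
  qed
qed

section \<open>Linearization at a strict saddle\<close>

definition mode_form :: "real \<Rightarrow> real \<Rightarrow> real \<Rightarrow> real \<Rightarrow> real \<Rightarrow> real" where
  "mode_form \<kappa> \<delta> \<eta> x y = - (\<eta> + \<delta>) / 2 * y\<^sup>2 - \<kappa> * (y - x)\<^sup>2"

text \<open>The form is minus the energy of the method on a one-dimensional quadratic, shifted by
  \<open>\<delta>\<close> to be definite on flat modes; the scale \<open>\<mu> > 1\<close> absorbs modes of modulus one.\<close>

lemma mode_form_expansion:
  assumes h: "h > 0" and \<beta>: "\<beta> \<ge> 0" and c: "c > 0" and L: "L > 0"
    and \<theta>: "hb_theta L h \<beta> c > 0"
    and N: "finite N" "\<And>\<eta>. \<eta> \<in> N \<Longrightarrow> \<bar>\<eta>\<bar> \<le> L" and \<eta>s: "\<eta>s \<in> N" "\<eta>s < 0"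
  shows "\<exists>\<delta> \<mu> \<epsilon>. \<mu> > 1 \<and> \<epsilon> > 0 \<and> \<eta>s + \<delta> < 0 \<and> (\<forall>\<eta>\<in>N. \<forall>x y.
     \<mu> * mode_form (hb_kappa L h \<beta> c) \<delta> \<eta> x y + \<epsilon> * (x\<^sup>2 + y\<^sup>2)
       \<le> mode_form (hb_kappa L h \<beta> c) \<delta> \<eta> y (hb_step (\<lambda>t. \<eta> * t) h \<beta> c x y))"
proof -
  define \<theta> \<kappa> where "\<theta> = hb_theta L h \<beta> c" and "\<kappa> = hb_kappa L h \<beta> c"
  have \<theta>0: "\<theta> > 0" using \<theta> by (simp add: \<theta>_def)
  have \<kappa>0: "\<kappa> > 0"
  proof -
    have "0 < (1 + \<beta> * h * L) / (2 * h\<^sup>2)"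
      using \<beta> h L by (intro divide_pos_pos add_pos_nonneg mult_nonneg_nonneg) auto
    then show ?thesis unfolding \<kappa>_def hb_kappa_def using \<theta> by linarith
  qed
  \<comment> \<open>A gap below zero, available because there are finitely many modes: the negative
    ones satisfy \<open>\<eta> \<le> - \<eta>0\<close>.\<close>
  define \<eta>0 where "\<eta>0 = Min (uminus ` {\<eta>\<in>N. \<eta> < 0})"
  have fin: "finite (uminus ` {\<eta>\<in>N. \<eta> < 0})" using N(1) by simp
  have ne: "uminus ` {\<eta>\<in>N. \<eta> < 0} \<noteq> {}" using \<eta>s by auto
  have \<eta>0: "\<eta>0 > 0" unfolding \<eta>0_def using fin ne by (subst Min_gr_iff) auto
  have \<eta>0_le: "\<eta>0 \<le> - \<eta>" if "\<eta> \<in> N" "\<eta> < 0" for \<eta>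
    unfolding \<eta>0_def by (rule Min_le[OF fin]) (use that in auto)
  define M where "M = (1 + \<beta> * h * L) + (1 + c * h)"
  \<comment> \<open>On negative modes the gradient bound gives \<open>\<eta>0 * h\<^sup>2 *
    \<bar>y\<bar> \<le> M * (\<bar>a\<bar> + \<bar>b\<bar>)\<close> for the increments
    \<open>a\<close> and \<open>b\<close>, hence
    \<open>y\<^sup>2 \<le> Nc * (a\<^sup>2 + b\<^sup>2)\<close>.\<close>
  define Nc where "Nc = 2 * (M / (\<eta>0 * h\<^sup>2))\<^sup>2"
  have Nc: "Nc \<ge> 0" by (simp add: Nc_def)
  \<comment> \<open>The cost per unit of \<open>\<tau>\<close> on negative modes: the first summand
    comes from the shift \<open>\<delta> = \<theta> * \<tau>\<close>, the second from the factor
    \<open>\<mu> = 1 + 2 * \<tau>\<close>.\<close>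
  define D where "D = \<theta> * (Nc / 2 + 1) + L * Nc"
  have "\<theta> * (Nc / 2 + 1) > 0" using \<theta>0 Nc by (intro mult_pos_pos) auto
  moreover have "L * Nc \<ge> 0" using L Nc by simp
  ultimately have D: "D > 0" unfolding D_def by linarith
  \<comment> \<open>The second bound lets the cost \<open>\<tau> * D\<close> use at most half of the
    dissipation \<open>\<theta>\<close>; the third keeps \<open>\<delta>\<close> below
    \<open>\<eta>0 / 2\<close>, so that the shifted form stays positive in the unstable
    direction.\<close>
  define \<tau> where "\<tau> = min 1 (min (\<theta> / 2 / D) (\<eta>0 / (2 * \<theta>)))"
  have \<tau>: "\<tau> > 0" "\<tau> \<le> 1" "\<tau> \<le> \<theta> / 2 / D" "\<tau> \<le> \<eta>0 / (2 * \<theta>)"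
    unfolding \<tau>_def using \<theta>0 D \<eta>0 by auto
  have \<tau>D: "\<tau> * D \<le> \<theta> / 2" using \<tau>(3) D by (simp add: pos_le_divide_eq)
  define \<delta> where "\<delta> = \<theta> * \<tau>"
  have \<delta>: "\<delta> > 0" using \<theta>0 \<tau> by (simp add: \<delta>_def)
  have "\<delta> \<le> \<eta>0 / 2" using \<tau>(4) \<theta>0 by (simp add: \<delta>_def field_simps)
  then have \<delta>\<eta>: "\<eta>s + \<delta> < 0" using \<eta>0_le[OF \<eta>s] \<eta>0 by linarith
  define \<mu> where "\<mu> = 1 + 2 * \<tau>"
  \<comment> \<open>The first two bounds fit \<open>2 * a\<^sup>2 + 3 * y\<^sup>2\<close>, which
    dominates \<open>x\<^sup>2 + y\<^sup>2\<close>, to what is left over on nonnegative modes; the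
    third fits the bound on negative modes, where \<open>Nc\<close> controls
    \<open>y\<^sup>2\<close>.\<close>
  define \<epsilon> where "\<epsilon> = min (min (\<theta> / 2) (\<delta> * \<tau> / 6)) (\<theta> / 2 / (2 + 3 * Nc))"
  have \<epsilon>0: "\<epsilon> > 0" unfolding \<epsilon>_def using \<theta>0 \<delta> \<tau>(1) Nc by auto
  have \<epsilon>: "\<epsilon> \<le> \<theta> / 2" "\<epsilon> \<le> \<delta> * \<tau> / 6" "\<epsilon> \<le> \<theta> / 2 / (2 + 3 * Nc)"
    unfolding \<epsilon>_def by (simp_all only: min_le_iff_disj order_refl simp_thms)
  have "\<mu> * mode_form \<kappa> \<delta> \<eta> x y + \<epsilon> * (x\<^sup>2 + y\<^sup>2) \<le> mode_form \<kappa> \<delta> \<eta> y (hb_step (\<lambda>t. \<eta> * t) h \<beta> c x y)"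
    if \<eta>: "\<eta> \<in> N" for \<eta> x y
  proof -
    define y' where "y' = hb_step (\<lambda>t. \<eta> * t) h \<beta> c x y"
    define a b where "a = y - x" and "b = y' - y"
    have lip: "L-lipschitz_on UNIV (\<lambda>t. \<eta> * t)"
    proof (rule lipschitz_onI)
      fix s t :: real
      show "dist (\<eta> * s) (\<eta> * t) \<le> L * dist s t"
        using N(2)[OF \<eta>] by (simp add: dist_real_def right_diff_distrib[symmetric] abs_mult mult_right_mono)
    qed (use L in simp)
    have grad: "((\<lambda>t. \<eta> / 2 * t\<^sup>2) has_derivative (\<lambda>v. (\<eta> * s) \<bullet> v)) (at s)" for s :: real
      by (auto intro!: derivative_eq_intros simp: fun_eq_iff)
    \<comment> \<open>The energy inequality for the scalar function
      \<open>\<eta> / 2 * t\<^sup>2\<close>; read with opposite sign it says that the unshifted form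
      grows.\<close>
    have energy: "\<eta> / 2 * y'\<^sup>2 + \<kappa> * b\<^sup>2 + \<theta> * (a\<^sup>2 + b\<^sup>2) \<le> \<eta> / 2 * y\<^sup>2 + \<kappa> * a\<^sup>2"
      using hb_step_energy[OF grad lip h \<beta> c order_refl y'_def]
      by (simp add: \<theta>_def \<kappa>_def a_def b_def)
    have x2: "x\<^sup>2 + y\<^sup>2 \<le> 2 * a\<^sup>2 + 3 * y\<^sup>2"
    proof -
      have "2 * a\<^sup>2 + 3 * y\<^sup>2 - (x\<^sup>2 + y\<^sup>2) = (x - 2 * y)\<^sup>2"
        by (simp add: a_def power2_eq_square algebra_simps)
      then show ?thesis using zero_le_power2[of "x - 2 * y"] by linarith
    qed
    have y': "y'\<^sup>2 = y\<^sup>2 + (2 * y * b + b\<^sup>2)" by (simp add: b_def power2_eq_square algebra_simps)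
    define q where "q = mode_form \<kappa> \<delta> \<eta> x y"
    have q: "q = - (\<eta> / 2 * y\<^sup>2) - \<delta> / 2 * y\<^sup>2 - \<kappa> * a\<^sup>2"
      by (simp add: q_def mode_form_def a_def field_simps)
    have q': "mode_form \<kappa> \<delta> \<eta> y y' = - (\<eta> / 2 * y'\<^sup>2) - \<delta> / 2 * y'\<^sup>2 - \<kappa> * b\<^sup>2"
      by (simp add: mode_form_def b_def field_simps)
    have step: "q + \<theta> * (a\<^sup>2 + b\<^sup>2) - \<delta> / 2 * (2 * y * b + b\<^sup>2) \<le> mode_form \<kappa> \<delta> \<eta> y y'"
      using energy unfolding q q' by (simp add: y' algebra_simps)
    \<comment> \<open>On nonnegative modes the form is at most
      \<open>- (\<delta> / 2 * y\<^sup>2)\<close>, so the factor \<open>\<mu>\<close> lowers the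
      left side and produces a gain in \<open>y\<close>. On negative modes the form may be positive,
      and the dissipation pays for both the shift and the factor.\<close>
    have "\<epsilon> * (x\<^sup>2 + y\<^sup>2) \<le> \<theta> * (a\<^sup>2 + b\<^sup>2) - \<delta> / 2 * (2 * y * b + b\<^sup>2) - 2 * \<tau> * q"
    proof (cases "\<eta> \<ge> 0")
      case True
      have "2 * \<tau> * q \<le> - (\<tau> * \<delta> * y\<^sup>2)"
      proof -
        have "0 \<le> \<eta> / 2 * y\<^sup>2" "0 \<le> \<kappa> * a\<^sup>2" using True \<kappa>0 by auto
        then have "q \<le> - (\<delta> / 2 * y\<^sup>2)" unfolding q by linarith
        then have "2 * \<tau> * q \<le> 2 * \<tau> * (- (\<delta> / 2 * y\<^sup>2))" using \<tau>(1) by (intro mult_left_mono) auto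
        then show ?thesis by simp
      qed
      moreover have "\<delta> / 2 * (2 * y * b + b\<^sup>2) \<le> \<delta> * \<tau> / 2 * y\<^sup>2 + \<theta> * b\<^sup>2"
      proof -
        \<comment> \<open>Young's inequality with weight \<open>\<tau>\<close>: the cross term
          caused by the shift consumes half of the gain \<open>\<tau> * \<delta> * y\<^sup>2\<close>
          and the dissipation of \<open>b\<close>.\<close>
        have "0 \<le> (\<tau> * y - b)\<^sup>2" by simp
        then have "2 * y * b * \<tau> \<le> \<tau>\<^sup>2 * y\<^sup>2 + b\<^sup>2" by (simp add: power2_eq_square algebra_simps)
        then have "\<theta> / 2 * (2 * y * b * \<tau>) \<le> \<theta> / 2 * (\<tau>\<^sup>2 * y\<^sup>2 + b\<^sup>2)"
          using \<theta>0 by (intro mult_left_mono) auto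
        moreover have "\<theta> / 2 * (\<tau> * b\<^sup>2) \<le> \<theta> / 2 * b\<^sup>2"
          using \<theta>0 \<tau> by (intro mult_left_mono) (auto intro: mult_left_le_one_le)
        ultimately show ?thesis by (simp add: \<delta>_def power2_eq_square algebra_simps)
      qed
      ultimately have "\<theta> * a\<^sup>2 + \<delta> * \<tau> / 2 * y\<^sup>2 \<le> \<theta> * (a\<^sup>2 + b\<^sup>2) - \<delta> / 2 * (2 * y * b + b\<^sup>2) - 2 * \<tau> * q"
        by (simp add: algebra_simps)
      moreover have "\<epsilon> * (x\<^sup>2 + y\<^sup>2) \<le> \<theta> * a\<^sup>2 + \<delta> * \<tau> / 2 * y\<^sup>2"
      proof -
        have "\<epsilon> * (x\<^sup>2 + y\<^sup>2) \<le> \<epsilon> * (2 * a\<^sup>2 + 3 * y\<^sup>2)" using x2 \<epsilon>0 by (intro mult_left_mono) auto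
        also have "\<dots> = \<epsilon> * (2 * a\<^sup>2) + \<epsilon> * (3 * y\<^sup>2)" by (simp add: distrib_left)
        also have "\<dots> \<le> \<theta> / 2 * (2 * a\<^sup>2) + \<delta> * \<tau> / 6 * (3 * y\<^sup>2)"
          using \<epsilon>(1,2) by (intro add_mono mult_right_mono) auto
        finally show ?thesis by simp
      qed
      ultimately show ?thesis by linarith
    next
      case False
      then have \<eta>neg: "\<eta> < 0" by simp
      have "h\<^sup>2 * norm (\<eta> * y) \<le> (1 + \<beta> * h * L) * norm a + (1 + c * h) * norm b"
        unfolding a_def b_def by (rule hb_step_gradient_bound[OF lip h \<beta> c order_refl y'_def])
      also have "\<dots> \<le> M * norm a + M * norm b"
      proof -
        have "0 \<le> \<beta> * h * L" "0 \<le> c * h" using \<beta> h L c by auto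
        then have "1 + \<beta> * h * L \<le> M" "1 + c * h \<le> M" by (auto simp: M_def)
        then show ?thesis by (intro add_mono mult_right_mono) auto
      qed
      finally have "h\<^sup>2 * (\<bar>\<eta>\<bar> * \<bar>y\<bar>) \<le> M * (\<bar>a\<bar> + \<bar>b\<bar>)" by (simp add: abs_mult distrib_left)
      moreover have "\<eta>0 * h\<^sup>2 * \<bar>y\<bar> \<le> h\<^sup>2 * (\<bar>\<eta>\<bar> * \<bar>y\<bar>)"
      proof -
        have "\<eta>0 \<le> \<bar>\<eta>\<bar>" using \<eta>0_le[OF \<eta> \<eta>neg] by linarith
        then have "h\<^sup>2 * (\<eta>0 * \<bar>y\<bar>) \<le> h\<^sup>2 * (\<bar>\<eta>\<bar> * \<bar>y\<bar>)"
          by (intro mult_left_mono mult_right_mono) auto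
        then show ?thesis by (simp only: mult.assoc mult.left_commute)
      qed
      ultimately have "\<eta>0 * h\<^sup>2 * \<bar>y\<bar> \<le> M * (\<bar>a\<bar> + \<bar>b\<bar>)" by linarith
      then have "\<bar>y\<bar> \<le> M / (\<eta>0 * h\<^sup>2) * (\<bar>a\<bar> + \<bar>b\<bar>)"
        using \<eta>0 h by (simp add: field_simps)
      then have "\<bar>y\<bar>\<^sup>2 \<le> (M / (\<eta>0 * h\<^sup>2) * (\<bar>a\<bar> + \<bar>b\<bar>))\<^sup>2" by (intro power_mono) auto
      also have "\<dots> \<le> (M / (\<eta>0 * h\<^sup>2))\<^sup>2 * (2 * (a\<^sup>2 + b\<^sup>2))"
      proof -
        have "(\<bar>a\<bar> + \<bar>b\<bar>)\<^sup>2 \<le> 2 * (a\<^sup>2 + b\<^sup>2)"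
          using sum_squares_bound[of "\<bar>a\<bar>" "\<bar>b\<bar>"] by (simp add: power2_sum)
        then show ?thesis unfolding power_mult_distrib by (intro mult_left_mono) auto
      qed
      finally have y2: "y\<^sup>2 \<le> Nc * (a\<^sup>2 + b\<^sup>2)"
        by (simp only: Nc_def power2_abs mult.commute[of 2] mult.assoc)
      define s where "s = a\<^sup>2 + b\<^sup>2"
      have s: "b\<^sup>2 \<le> s" "a\<^sup>2 \<le> s" "0 \<le> s" by (auto simp: s_def)
      have "\<delta> / 2 * (2 * y * b + b\<^sup>2) \<le> \<delta> / 2 * (Nc * s + 2 * s)"
      proof (rule mult_left_mono)
        have "2 * y * b \<le> y\<^sup>2 + b\<^sup>2" by (rule sum_squares_bound)
        then show "2 * y * b + b\<^sup>2 \<le> Nc * s + 2 * s" using y2 s unfolding s_def[symmetric] by linarith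
      qed (use \<delta> in simp)
      moreover have "2 * \<tau> * q \<le> 2 * \<tau> * (L / 2 * (Nc * s))"
      proof (rule mult_left_mono)
        have "- (\<eta> / 2 * y\<^sup>2) \<le> L / 2 * y\<^sup>2"
          using N(2)[OF \<eta>] mult_right_mono[of "- \<eta>" L "y\<^sup>2"] by (simp add: abs_le_iff)
        moreover have "0 \<le> \<delta> / 2 * y\<^sup>2" "0 \<le> \<kappa> * a\<^sup>2" using \<delta> \<kappa>0 by auto
        moreover have "L / 2 * y\<^sup>2 \<le> L / 2 * (Nc * s)"
          using y2 L unfolding s_def[symmetric] by (intro mult_left_mono) auto
        ultimately show "q \<le> L / 2 * (Nc * s)" unfolding q by linarith
      qed (use \<tau>(1) in simp)
      moreover have "\<delta> / 2 * (Nc * s + 2 * s) + 2 * \<tau> * (L / 2 * (Nc * s)) = \<tau> * D * s"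
        unfolding \<delta>_def D_def by (simp add: algebra_simps)
      moreover have "\<tau> * D * s \<le> \<theta> / 2 * s" using \<tau>D s(3) by (rule mult_right_mono)
      ultimately have "\<theta> / 2 * s \<le> \<theta> * s - \<delta> / 2 * (2 * y * b + b\<^sup>2) - 2 * \<tau> * q" by linarith
      moreover have "\<epsilon> * (x\<^sup>2 + y\<^sup>2) \<le> \<theta> / 2 * s"
      proof -
        have "x\<^sup>2 + y\<^sup>2 \<le> (2 + 3 * Nc) * s"
          using x2 y2 s unfolding s_def[symmetric] by (simp add: algebra_simps)
        then have "\<epsilon> * (x\<^sup>2 + y\<^sup>2) \<le> \<epsilon> * ((2 + 3 * Nc) * s)" using \<epsilon>0 by (intro mult_left_mono) auto
        also have "\<dots> = (\<epsilon> * (2 + 3 * Nc)) * s" by simp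
        also have "\<dots> \<le> \<theta> / 2 * s"
        proof (rule mult_right_mono[OF _ s(3)])
          have "2 + 3 * Nc > 0" using Nc by simp
          then show "\<epsilon> * (2 + 3 * Nc) \<le> \<theta> / 2" using \<epsilon>(3) by (simp only: pos_le_divide_eq)
        qed
        finally show ?thesis .
      qed
      ultimately show ?thesis unfolding s_def by linarith
    qed
    moreover have "\<mu> * q = q + 2 * \<tau> * q" by (simp add: \<mu>_def distrib_right)
    ultimately show ?thesis
      using step unfolding y'_def[symmetric] q_def[symmetric] by linarith
  qed
  then show ?thesis
    using \<delta>\<eta> \<epsilon>0 \<tau>(1) unfolding \<kappa>_def[symmetric]
    by (intro exI[of _ \<delta>] exI[of _ \<mu>] exI[of _ \<epsilon>]) (auto simp: \<mu>_def)
qed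

text \<open>The iteration as a self-map of pairs. With a linear \<open>A\<close> in place of
  \<open>g\<close> the same formula gives its linearization.\<close>

definition hb_map :: "('a::real_vector \<Rightarrow> 'a) \<Rightarrow> real \<Rightarrow> real \<Rightarrow> real \<Rightarrow> 'a \<times> 'a \<Rightarrow> 'a \<times> 'a" where
  "hb_map g h \<beta> c p = (snd p, hb_step g h \<beta> c (fst p) (snd p))"

lemma linear_hb_map: "linear A \<Longrightarrow> linear (hb_map A h \<beta> c)"
  by (rule linearI)
    (auto simp: hb_map_def hb_step_def linear_add linear_scale algebra_simps scaleR_diff_right scaleR_add_right)

text \<open>In an orthonormal eigenbasis of \<open>A\<close> the linearized map acts separately on
  the pair of coefficients of each eigenvector, so the scalar estimates can be summed.\<close>

lemma hb_map_quadratic_form: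
  fixes A :: "'a::euclidean_space \<Rightarrow> 'a"
  assumes h: "h > 0" and \<beta>: "\<beta> \<ge> 0" and c: "c > 0" and L: "L > 0"
    and \<theta>: "hb_theta L h \<beta> c > 0"
    and A: "linear A" and sym: "\<And>x y. A x \<bullet> y = x \<bullet> A y"
    and A_le: "\<And>v. norm (A v) \<le> L * norm v"
    and w: "w \<noteq> 0" "A w = \<eta>s *\<^sub>R w" "\<eta>s < 0"
  shows "\<exists>J e \<mu> \<epsilon>. linear J \<and> \<mu> > 1 \<and> \<epsilon> > 0 \<and> J e \<bullet> e > 0 \<and>
    (\<forall>v. \<mu> * (J v \<bullet> v) + \<epsilon> * (norm v)\<^sup>2 \<le> J (hb_map A h \<beta> c v) \<bullet> hb_map A h \<beta> c v)"
proof -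
  obtain B \<eta> where B: "finite B" "\<And>u. u \<in> B \<Longrightarrow> norm u = 1" "\<And>u. u \<in> B \<Longrightarrow> A u = \<eta> u *\<^sub>R u"
    "\<And>x y. x \<bullet> y = (\<Sum>u\<in>B. (x \<bullet> u) * (y \<bullet> u))"
    using symmetric_eigenbasis[OF A sym] by blast
  have Au: "A x \<bullet> u = \<eta> u * (x \<bullet> u)" if "u \<in> B" for x u
    using sym[of x u] B(3)[OF that] by simp
  have bound: "\<bar>\<eta> u\<bar> \<le> L" if "u \<in> B" for u
    using A_le[of u] B(2,3)[OF that] by simp
  \<comment> \<open>Otherwise \<open>w\<close> would be orthogonal to the whole basis, because
    eigenvectors of different eigenvalues are orthogonal.\<close>
  have "\<exists>u\<in>B. \<eta> u = \<eta>s"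
  proof (rule ccontr)
    assume n: "\<not> (\<exists>u\<in>B. \<eta> u = \<eta>s)"
    have "w \<bullet> u = 0" if "u \<in> B" for u
      using Au[OF that, of w] w(2) n that by auto
    then have "w \<bullet> w = 0" by (subst B(4)) simp
    then show False using w(1) by simp
  qed
  then obtain us where us: "us \<in> B" "\<eta> us = \<eta>s" by blast
  define \<kappa> where "\<kappa> = hb_kappa L h \<beta> c"
  have fin: "finite (\<eta> ` B)" and bd: "\<And>\<zeta>. \<zeta> \<in> \<eta> ` B \<Longrightarrow> \<bar>\<zeta>\<bar> \<le> L" and mem: "\<eta>s \<in> \<eta> ` B"
    using B(1) bound us by auto
  obtain \<delta> \<mu> \<epsilon> where \<mu>: "\<mu> > 1" and \<epsilon>: "\<epsilon> > 0" and \<delta>: "\<eta>s + \<delta> < 0"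
    and form: "\<And>u x y. u \<in> B \<Longrightarrow> \<mu> * mode_form \<kappa> \<delta> (\<eta> u) x y + \<epsilon> * (x\<^sup>2 + y\<^sup>2)
       \<le> mode_form \<kappa> \<delta> (\<eta> u) y (hb_step (\<lambda>t. \<eta> u * t) h \<beta> c x y)"
    using mode_form_expansion[OF h \<beta> c L \<theta> fin bd mem w(3)]
    unfolding \<kappa>_def[symmetric] by blast
  \<comment> \<open>Half the gradient of the form \<open>- 1 / 2 * (A y \<bullet> y) - \<delta> / 2
    * (y \<bullet> y) - \<kappa> * ((y - x) \<bullet> (y - x))\<close> at the pair of
    \<open>x\<close> and \<open>y\<close>.\<close>
  define J :: "'a \<times> 'a \<Rightarrow> 'a \<times> 'a" where
    "J p = (\<kappa> *\<^sub>R (snd p - fst p), (- 1 / 2) *\<^sub>R A (snd p) - (\<delta> / 2) *\<^sub>R snd p - \<kappa> *\<^sub>R (snd p - fst p))" for p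
  have linJ: "linear J"
    by (rule linearI)
      (auto simp: J_def linear_add[OF A] linear_scale[OF A] algebra_simps scaleR_diff_right scaleR_add_right)
  have J_sum: "J p \<bullet> p = (\<Sum>u\<in>B. mode_form \<kappa> \<delta> (\<eta> u) (fst p \<bullet> u) (snd p \<bullet> u))" for p
  proof -
    have "J p \<bullet> p = - 1 / 2 * (A (snd p) \<bullet> snd p) - \<delta> / 2 * (snd p \<bullet> snd p) - \<kappa> * ((snd p - fst p) \<bullet> (snd p - fst p))"
      by (simp add: J_def inner_prod_def inner_diff_left inner_diff_right inner_commute algebra_simps)
    also have "\<dots> = (\<Sum>u\<in>B. mode_form \<kappa> \<delta> (\<eta> u) (fst p \<bullet> u) (snd p \<bullet> u))"
      unfolding B(4)[of "A (snd p)" "snd p"] B(4)[of "snd p" "snd p"] B(4)[of "snd p - fst p" "snd p - fst p"]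
        sum_distrib_left sum_subtractf[symmetric]
      by (rule sum.cong) (auto simp: mode_form_def Au inner_diff_left power2_eq_square field_simps)
    finally show ?thesis .
  qed
  have norm_sum: "(norm p)\<^sup>2 = (\<Sum>u\<in>B. (fst p \<bullet> u)\<^sup>2 + (snd p \<bullet> u)\<^sup>2)" for p :: "'a \<times> 'a"
    unfolding power2_norm_eq_inner inner_prod_def B(4)[of "fst p" "fst p"] B(4)[of "snd p" "snd p"]
    by (simp add: sum.distrib power2_eq_square)
  have step_u: "hb_step A h \<beta> c x y \<bullet> u = hb_step (\<lambda>t. \<eta> u * t) h \<beta> c (x \<bullet> u) (y \<bullet> u)" if "u \<in> B" for x y u
    by (simp add: hb_step_def inner_diff_left inner_add_left Au[OF that])
  have main: "\<mu> * (J v \<bullet> v) + \<epsilon> * (norm v)\<^sup>2 \<le> J (hb_map A h \<beta> c v) \<bullet> hb_map A h \<beta> c v" for v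
  proof -
    have "\<mu> * (J v \<bullet> v) + \<epsilon> * (norm v)\<^sup>2
        = (\<Sum>u\<in>B. \<mu> * mode_form \<kappa> \<delta> (\<eta> u) (fst v \<bullet> u) (snd v \<bullet> u) + \<epsilon> * ((fst v \<bullet> u)\<^sup>2 + (snd v \<bullet> u)\<^sup>2))"
      unfolding J_sum norm_sum sum_distrib_left by (rule sum.distrib[symmetric])
    also have "\<dots> \<le> (\<Sum>u\<in>B. mode_form \<kappa> \<delta> (\<eta> u) (snd v \<bullet> u) (hb_step (\<lambda>t. \<eta> u * t) h \<beta> c (fst v \<bullet> u) (snd v \<bullet> u)))"
      by (intro sum_mono form)
    also have "\<dots> = J (hb_map A h \<beta> c v) \<bullet> hb_map A h \<beta> c v"
      unfolding J_sum by (intro sum.cong) (auto simp: hb_map_def step_u)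
    finally show ?thesis .
  qed
  \<comment> \<open>On a constant pair the increment vanishes, so only the shifted potential part of
    the form remains.\<close>
  have "J (us, us) \<bullet> (us, us) = - (\<eta>s + \<delta>) / 2"
    using B(2)[OF us(1)] B(3)[OF us(1)] us(2)
    by (simp add: J_def inner_diff_left dot_square_norm field_simps)
  then have "J (us, us) \<bullet> (us, us) > 0" using \<delta> by simp
  then show ?thesis using linJ \<mu> \<epsilon> main by blast
qed

text \<open>The linear parts of the step cancel in the difference; what remains are three remainders
  of \<open>g\<close> with total weight \<open>K\<close>.\<close>

lemma hb_map_strict_derivative:
  fixes g A :: "'a::real_normed_vector \<Rightarrow> 'a"
  assumes h: "h > 0" and \<beta>: "\<beta> \<ge> 0" and c: "c > 0" and A: "linear A"
    and strict: "\<And>\<omega>. \<omega> > 0 \<Longrightarrow> \<exists>r>0. \<forall>y\<in>cball z r. \<forall>y'\<in>cball z r. norm (g y - g y' - A (y - y')) \<le> \<omega> * norm (y - y')"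
    and \<omega>: "\<omega> > 0"
  shows "\<exists>r>0. \<forall>p\<in>cball (z, z) r. \<forall>q\<in>cball (z, z) r.
     norm (hb_map g h \<beta> c p - hb_map g h \<beta> c q - hb_map A h \<beta> c (p - q)) \<le> \<omega> * norm (p - q)"
proof -
  define \<alpha> where "\<alpha> = 1 / (1 + c * h)"
  have \<alpha>: "\<alpha> > 0" unfolding \<alpha>_def using c h by (intro divide_pos_pos add_pos_pos) auto
  define K where "K = \<beta> * h * \<alpha> + \<beta> * h * \<alpha> + h\<^sup>2 * \<alpha>"
  have K: "K > 0" unfolding K_def using \<alpha> \<beta> h by (intro add_nonneg_pos) auto
  obtain r where r: "r > 0" "\<And>y y'. y \<in> cball z r \<Longrightarrow> y' \<in> cball z r \<Longrightarrow> norm (g y - g y' - A (y - y')) \<le> \<omega> / K * norm (y - y')"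
    using strict[of "\<omega> / K"] \<omega> K by (meson divide_pos_pos)
  have "norm (hb_map g h \<beta> c p - hb_map g h \<beta> c q - hb_map A h \<beta> c (p - q)) \<le> \<omega> * norm (p - q)"
    if p: "p \<in> cball (z, z) r" and q: "q \<in> cball (z, z) r" for p q
  proof -
    define x y x' y' where "x = fst p" and "y = snd p" and "x' = fst q" and "y' = snd q"
    have pq: "p = (x, y)" "q = (x', y')" by (auto simp: x_def y_def x'_def y'_def)
    have dist: "dist z x \<le> r" "dist z y \<le> r" "dist z x' \<le> r" "dist z y' \<le> r"
      using p q dist_fst_le[of "(z, z)" p] dist_snd_le[of "(z, z)" p]
        dist_fst_le[of "(z, z)" q] dist_snd_le[of "(z, z)" q] by (auto simp: pq)
    define u v where "u = g x - g x' - A (x - x')" and "v = g y - g y' - A (y - y')"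
    have nx: "norm (x - x') \<le> norm (p - q)" and ny: "norm (y - y') \<le> norm (p - q)"
      using norm_fst_le[of "x - x'" "y - y'"] norm_snd_le[of "y - y'" "x - x'"] by (auto simp: pq)
    have nu: "norm u \<le> \<omega> / K * norm (p - q)" and nv: "norm v \<le> \<omega> / K * norm (p - q)"
      unfolding u_def v_def
      using order_trans[OF r(2)[of x x'] mult_left_mono[OF nx]] order_trans[OF r(2)[of y y'] mult_left_mono[OF ny]]
        dist \<omega> K by auto
    have "hb_map g h \<beta> c p - hb_map g h \<beta> c q - hb_map A h \<beta> c (p - q)
        = (0, (\<beta> * h * \<alpha>) *\<^sub>R u - (\<beta> * h * \<alpha>) *\<^sub>R v - (h\<^sup>2 * \<alpha>) *\<^sub>R v)"
      by (simp add: hb_map_def hb_step_def pq \<alpha>_def[symmetric] u_def v_def scaleR_diff_right scaleR_add_right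
          linear_diff[OF A])
    then have "norm (hb_map g h \<beta> c p - hb_map g h \<beta> c q - hb_map A h \<beta> c (p - q))
        = norm ((\<beta> * h * \<alpha>) *\<^sub>R u - (\<beta> * h * \<alpha>) *\<^sub>R v - (h\<^sup>2 * \<alpha>) *\<^sub>R v)"
      by (simp add: norm_Pair)
    also have "\<dots> \<le> norm ((\<beta> * h * \<alpha>) *\<^sub>R u) + norm ((\<beta> * h * \<alpha>) *\<^sub>R v) + norm ((h\<^sup>2 * \<alpha>) *\<^sub>R v)"
      by (meson add_mono norm_triangle_ineq4 order_refl order_trans)
    also have "\<dots> = \<beta> * h * \<alpha> * norm u + \<beta> * h * \<alpha> * norm v + h\<^sup>2 * \<alpha> * norm v"
      using \<beta> h \<alpha> by simp
    also have "\<dots> \<le> \<beta> * h * \<alpha> * (\<omega> / K * norm (p - q)) + \<beta> * h * \<alpha> * (\<omega> / K * norm (p - q)) + h\<^sup>2 * \<alpha> * (\<omega> / K * norm (p - q))"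
      using nu nv \<beta> h \<alpha> by (intro add_mono mult_left_mono) auto
    also have "\<dots> = K * (\<omega> / K * norm (p - q))" by (simp only: K_def distrib_right)
    also have "\<dots> = \<omega> * norm (p - q)" using K by simp
    finally show ?thesis .
  qed
  then show ?thesis using r(1) by blast
qed

text \<open>The image pair contains \<open>y\<close> and the next point, and the recursion then
  determines \<open>x - (\<beta> * h) *\<^sub>R g x\<close>. Since
  \<open>\<beta> * h * L < 1\<close>, distances of \<open>x\<close> are controlled by distances of
  that vector.\<close>

lemma hb_map_expansive:
  fixes g :: "'a::real_normed_vector \<Rightarrow> 'a"
  assumes lip: "L-lipschitz_on UNIV g" and h: "h > 0" and \<beta>: "\<beta> \<ge> 0" and c: "c > 0"
    and small: "\<beta> * h * L < 1"
  shows "\<exists>K. \<forall>p q. norm (p - q) \<le> K * norm (hb_map g h \<beta> c p - hb_map g h \<beta> c q)"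
proof -
  have L: "L \<ge> 0" using lip by (rule lipschitz_on_nonneg)
  define M where "M = 1 + \<beta> * h * L + h\<^sup>2 * L + (1 + c * h) + (1 + c * h)"
  have M: "M \<ge> 0" unfolding M_def using \<beta> h L c by auto
  define m where "m = 1 - \<beta> * h * L"
  have m: "m > 0" using small by (simp add: m_def)
  have "norm (p - q) \<le> (M / m + 1) * norm (hb_map g h \<beta> c p - hb_map g h \<beta> c q)" for p q
  proof -
    define x y x' y' where "x = fst p" and "y = snd p" and "x' = fst q" and "y' = snd q"
    have pq: "p = (x, y)" "q = (x', y')" by (auto simp: x_def y_def x'_def y'_def)
    define b b' where "b = hb_step g h \<beta> c x y" and "b' = hb_step g h \<beta> c x' y'"
    define n where "n = norm (hb_map g h \<beta> c p - hb_map g h \<beta> c q)"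
    have n: "norm (y - y') \<le> n" "norm (b - b') \<le> n"
      using norm_fst_le[of "y - y'" "b - b'"] norm_snd_le[of "b - b'" "y - y'"]
      by (auto simp: n_def hb_map_def pq b_def b'_def)
    have ch: "1 + c * h > 0" using c h by (intro add_pos_pos) auto
    have incr: "(1 + c * h) *\<^sub>R (b - y) = (y - x) - (\<beta> * h) *\<^sub>R (g y - g x) - h\<^sup>2 *\<^sub>R g y"
      "(1 + c * h) *\<^sub>R (b' - y') = (y' - x') - (\<beta> * h) *\<^sub>R (g y' - g x') - h\<^sup>2 *\<^sub>R g y'"
      unfolding b_def b'_def using ch by (auto intro!: hb_step_increment)
    have lipn: "norm (g s - g t) \<le> L * norm (s - t)" for s t
      using lipschitz_onD[OF lip, of s t] by (simp add: dist_norm)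
    have "y - x = (1 + c * h) *\<^sub>R (b - y) + (\<beta> * h) *\<^sub>R (g y - g x) + h\<^sup>2 *\<^sub>R g y"
      "y' - x' = (1 + c * h) *\<^sub>R (b' - y') + (\<beta> * h) *\<^sub>R (g y' - g x') + h\<^sup>2 *\<^sub>R g y'"
      unfolding incr by simp_all
    moreover have "x - x' = (y - y') - ((y - x) - (y' - x'))" by simp
    ultimately have "x - x' = (\<beta> * h) *\<^sub>R (g x - g x') + ((y - y') - (\<beta> * h) *\<^sub>R (g y - g y') - h\<^sup>2 *\<^sub>R (g y - g y')
        + (1 + c * h) *\<^sub>R (y - y') - (1 + c * h) *\<^sub>R (b - b'))"
      by (simp only: scaleR_diff_right) (simp add: algebra_simps)
    then have "norm (x - x') \<le> norm ((\<beta> * h) *\<^sub>R (g x - g x')) + norm ((y - y') - (\<beta> * h) *\<^sub>R (g y - g y') - h\<^sup>2 *\<^sub>R (g y - g y')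
        + (1 + c * h) *\<^sub>R (y - y') - (1 + c * h) *\<^sub>R (b - b'))"
      by (metis norm_triangle_ineq)
    also have "\<dots> \<le> norm ((\<beta> * h) *\<^sub>R (g x - g x')) + (norm (y - y') + norm ((\<beta> * h) *\<^sub>R (g y - g y')) + norm (h\<^sup>2 *\<^sub>R (g y - g y'))
        + norm ((1 + c * h) *\<^sub>R (y - y')) + norm ((1 + c * h) *\<^sub>R (b - b')))"
      by (intro add_mono order_refl order_trans[OF norm_triangle_ineq4] order_trans[OF norm_triangle_ineq])
    also have "\<dots> = \<beta> * h * norm (g x - g x') + (norm (y - y') + \<beta> * h * norm (g y - g y') + h\<^sup>2 * norm (g y - g y')
        + (1 + c * h) * norm (y - y') + (1 + c * h) * norm (b - b'))"
      using \<beta> h ch by simp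
    also have "\<dots> \<le> \<beta> * h * (L * norm (x - x')) + (n + \<beta> * h * (L * n) + h\<^sup>2 * (L * n) + (1 + c * h) * n + (1 + c * h) * n)"
      using \<beta> h ch n lipn[of x x'] order_trans[OF lipn[of y y'] mult_left_mono[OF n(1) L]]
      by (intro add_mono mult_left_mono) auto
    also have "\<dots> = \<beta> * h * L * norm (x - x') + M * n" by (simp add: M_def algebra_simps)
    finally have "m * norm (x - x') \<le> M * n" by (simp add: m_def algebra_simps)
    then have "norm (x - x') \<le> M / m * n" using m by (simp add: field_simps)
    moreover have "norm (p - q) \<le> norm (x - x') + norm (y - y')"
      using norm_Pair_le[of "x - x'" "y - y'"] by (simp add: pq)
    ultimately show ?thesis using n(1) unfolding n_def[symmetric] by (simp add: distrib_right)
  qed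
  then show ?thesis by blast
qed

section \<open>Avoidance of strict saddles\<close>

text \<open>Bounds the Hessian eigenvalues by the same \<open>L\<close> that enters the energy
  constants.\<close>

lemma lipschitz_derivative_bound:
  fixes g :: "'a::real_normed_vector \<Rightarrow> 'b::real_normed_vector"
  assumes A: "(g has_derivative A) (at z)" and lip: "L-lipschitz_on UNIV g"
  shows "norm (A v) \<le> L * norm v"
proof (cases "v = 0")
  case True
  then show ?thesis using linear_0[OF has_derivative_linear[OF A]] by simp
next
  case False
  show ?thesis
  proof (rule field_le_epsilon)
    fix e :: real assume e: "e > 0"
    have nv: "norm v > 0" using False by simp
    then have "e / norm v > 0" using e by simp
    then obtain d where d: "d > 0" "\<And>y. norm (y - z) < d \<Longrightarrow> norm (g y - g z - A (y - z)) \<le> e / norm v * norm (y - z)"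
      using A unfolding has_derivative_at_alt by blast
    define t where "t = d / (2 * norm v)"
    have t: "t > 0" unfolding t_def using d(1) nv by simp
    have "norm (t *\<^sub>R v) < d" using t nv d(1) by (simp add: t_def)
    then have "norm (g (z + t *\<^sub>R v) - g z - A (t *\<^sub>R v)) \<le> e / norm v * norm (t *\<^sub>R v)"
      using d(2)[of "z + t *\<^sub>R v"] by simp
    also have "\<dots> = t * e" using t nv by simp
    finally have "norm (A (t *\<^sub>R v)) \<le> norm (g (z + t *\<^sub>R v) - g z) + t * e"
      using norm_triangle_sub[of "A (t *\<^sub>R v)" "g (z + t *\<^sub>R v) - g z"]
      by (simp add: norm_minus_commute)
    also have "\<dots> \<le> L * norm (t *\<^sub>R v) + t * e"
      using lipschitz_onD[OF lip, of "z + t *\<^sub>R v" z] by (simp add: dist_norm)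
    also have "\<dots> = t * (L * norm v + e)" using t by (simp add: algebra_simps)
    finally have "t * norm (A v) \<le> t * (L * norm v + e)"
      using t by (simp add: linear_scale[OF has_derivative_linear[OF A]])
    then show "norm (A v) \<le> L * norm v + e" using t by simp
  qed
qed

text \<open>The mean value inequality on a ball, applied to \<open>g\<close> minus its linear part
  at \<open>z\<close>, whose derivative is small there by continuity of \<open>H\<close>.\<close>

lemma continuous_derivative_imp_strict:
  fixes g :: "real^'n \<Rightarrow> real^'n" and H :: "real^'n \<Rightarrow> real^'n^'n"
  assumes hess: "\<And>x. (g has_derivative (\<lambda>v. H x *v v)) (at x)"
    and cont: "continuous_on UNIV H" and \<omega>: "\<omega> > 0"
  shows "\<exists>r>0. \<forall>y\<in>cball z r. \<forall>y'\<in>cball z r. norm (g y - g y' - H z *v (y - y')) \<le> \<omega> * norm (y - y')"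
proof -
  \<comment> \<open>The number of matrix entries: the operator norm is at most \<open>N\<close>
    times a bound on the entries.\<close>
  define N where "N = real CARD('n) * real CARD('n)"
  have N: "N > 0" by (simp add: N_def)
  have "isCont H z" using cont by (simp add: continuous_on_eq_continuous_at)
  then obtain s where s: "s > 0" "\<And>x. dist x z < s \<Longrightarrow> dist (H x) (H z) < \<omega> / N"
    using \<omega> N unfolding continuous_at_eps_delta by (metis divide_pos_pos)
  have "norm (g y - g y' - H z *v (y - y')) \<le> \<omega> * norm (y - y')"
    if y: "y \<in> cball z (s / 2)" "y' \<in> cball z (s / 2)" for y y'
  proof -
    have "norm ((g y - H z *v y) - (g y' - H z *v y')) \<le> \<omega> * norm (y - y')"
    proof (rule differentiable_bound[OF convex_cball _ _ y])
      fix x assume x: "x \<in> cball z (s / 2)"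
      show "((\<lambda>y. g y - H z *v y) has_derivative (\<lambda>v. (H x - H z) *v v)) (at x within cball z (s / 2))"
      proof (rule has_derivative_at_withinI)
        have "((\<lambda>y. g y - H z *v y) has_derivative (\<lambda>v. H x *v v - H z *v v)) (at x)"
          by (intro has_derivative_diff hess bounded_linear_imp_has_derivative matrix_vector_mul_bounded_linear)
        then show "((\<lambda>y. g y - H z *v y) has_derivative (\<lambda>v. (H x - H z) *v v)) (at x)"
          by (simp add: matrix_vector_mult_diff_rdistrib)
      qed
      have "dist x z < s" using x s(1) by (simp add: dist_commute)
      then have le: "norm (H x - H z) \<le> \<omega> / N" using s(2)[of x] by (simp add: dist_norm)
      have "\<bar>(H x - H z) $ i $ j\<bar> \<le> \<omega> / N" for i j
        using component_le_norm_cart[of "(H x - H z) $ i" j] Finite_Cartesian_Product.norm_nth_le[of "H x - H z" i] le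
        by linarith
      then have "onorm ((*v) (H x - H z)) \<le> N * (\<omega> / N)"
        unfolding N_def by (rule onorm_le_matrix_component)
      then show "onorm (\<lambda>v. (H x - H z) *v v) \<le> \<omega>" using N by simp
    qed
    then show ?thesis by (simp add: matrix_vector_mult_diff_distrib algebra_simps)
  qed
  then show ?thesis using s(1) by (intro exI[of _ "s / 2"]) auto
qed

text \<open>\<open>lambda_min\<close> is a \<open>Min\<close>, which is attained once the set of
  eigenvalues is finite and nonempty; an orthonormal eigenbasis supplies both.\<close>

lemma lambda_min_negative_eigenvector:
  fixes A :: "real^'n^'n"
  assumes sym: "\<And>x y. (A *v x) \<bullet> y = x \<bullet> (A *v y)" and neg: "lambda_min A < 0"
  obtains w \<eta> where "w \<noteq> 0" "A *v w = \<eta> *\<^sub>R w" "\<eta> < 0"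
proof -
  obtain B \<eta> where B: "finite B" "\<And>u. u \<in> B \<Longrightarrow> norm u = 1" "\<And>u. u \<in> B \<Longrightarrow> A *v u = \<eta> u *\<^sub>R u"
    and parseval: "\<And>x y. x \<bullet> y = (\<Sum>u\<in>B. (x \<bullet> u) * (y \<bullet> u))"
    by (rule symmetric_eigenbasis[OF matrix_vector_mul_linear sym]) blast
  have "mat_eigenvalues A \<subseteq> \<eta> ` B"
  proof
    fix \<mu> assume "\<mu> \<in> mat_eigenvalues A"
    then obtain v where v: "v \<noteq> 0" "A *v v = \<mu> *\<^sub>R v" by (auto simp: mat_eigenvalues_def)
    have "\<exists>u\<in>B. v \<bullet> u \<noteq> 0"
    proof (rule ccontr)
      assume "\<not> ?thesis"
      then have "v \<bullet> v = 0" by (subst parseval) simp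
      then show False using v(1) by simp
    qed
    then obtain u where u: "u \<in> B" "v \<bullet> u \<noteq> 0" by blast
    have "\<mu> * (v \<bullet> u) = \<eta> u * (v \<bullet> u)" using sym[of v u] v(2) B(3)[OF u(1)] by simp
    then show "\<mu> \<in> \<eta> ` B" using u by auto
  qed
  then have fin: "finite (mat_eigenvalues A)" using B(1) finite_surj by blast
  have "mat_eigenvalues A \<noteq> {}"
  proof -
    have "B \<noteq> {}"
    proof
      assume "B = {}"
      then have "(axis undefined 1 :: real^'n) \<bullet> axis undefined 1 = 0" by (subst parseval) simp
      then show False by simp
    qed
    then obtain u where u: "u \<in> B" by blast
    have "u \<noteq> 0" using B(2)[OF u] by auto
    then show ?thesis using B(3)[OF u] by (auto simp: mat_eigenvalues_def)
  qed
  then have "lambda_min A \<in> mat_eigenvalues A" unfolding lambda_min_def by (rule Min_in[OF fin])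
  then show thesis using that neg by (auto simp: mat_eigenvalues_def)
qed

lemma hb_pair_funpow:
  assumes "\<And>k. \<gamma> k = c"
  shows "hb_pair g h \<beta> \<gamma> x0 x1 k = (hb_map g h \<beta> c ^^ k) (x0, x1)"
  by (induction k) (simp_all add: assms hb_map_def hb_step_def Let_def split_beta)

text \<open>Strict saddles need not be isolated or countable, so countably many neighbourhoods are
  extracted from the cover by trapping balls. An orbit converging to a saddle finally stays in one
  of them, which places its start in an iterated preimage of a null set.\<close>

lemma negligible_converging_to_saddle:
  fixes f :: "real^'n \<Rightarrow> real" and g :: "real^'n \<Rightarrow> real^'n" and H :: "real^'n \<Rightarrow> real^'n^'n"
  assumes grad: "\<And>x. (f has_derivative (\<lambda>v. g x \<bullet> v)) (at x)"
    and hess: "\<And>x. (g has_derivative (\<lambda>v. H x *v v)) (at x)"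
    and hess_cont: "continuous_on UNIV H"
    and L: "L > 0" and lip: "L-lipschitz_on UNIV g"
    and h: "h > 0" and \<beta>: "\<beta> \<ge> 0" and c: "0 < c" and \<gamma>: "\<And>k. \<gamma> k = c"
    and step: "\<beta> + h / 2 < c / L" and small: "\<beta> * h * L < 1"
  shows "negligible {p. \<exists>z. hb_seq g h \<beta> \<gamma> (fst p) (snd p) \<longlonglongrightarrow> z \<and> strict_saddle g H z}"
proof -
  define F where "F = hb_map g h \<beta> c"
  define Z where "Z = {z. strict_saddle g H z}"
  have \<theta>: "hb_theta L h \<beta> c > 0"
    unfolding hb_theta_def using step L h by (intro divide_pos_pos) (auto simp: field_simps)
  have contg: "continuous_on UNIV g" using lip by (rule lipschitz_on_continuous_on)
  have contF: "continuous_on UNIV F"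
    unfolding F_def hb_map_def hb_step_def
    by (intro continuous_intros continuous_on_compose2[OF contg]) auto
  have trap: "\<exists>r>0. negligible {p. \<forall>n. (F ^^ n) p \<in> cball (z, z) r}" if z: "z \<in> Z" for z
  proof -
    define A where "A = (\<lambda>v. H z *v v)"
    have A: "linear A" unfolding A_def by (rule matrix_vector_mul_linear)
    have dA: "(g has_derivative A) (at z)" unfolding A_def by (rule hess)
    have sym: "A x \<bullet> y = x \<bullet> A y" for x y by (rule symmetric_second_derivative[OF grad dA])
    have "lambda_min (H z) < 0" using z by (simp add: Z_def strict_saddle_def)
    then obtain w \<eta> where w: "w \<noteq> 0" "A w = \<eta> *\<^sub>R w" "\<eta> < 0"
      using lambda_min_negative_eigenvector[of "H z"] sym unfolding A_def by blast
    obtain J e \<mu> \<epsilon> where J: "linear J" "\<mu> > 1" "\<epsilon> > 0" "J e \<bullet> e > 0"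
      and exp: "\<And>v. \<mu> * (J v \<bullet> v) + \<epsilon> * (norm v)\<^sup>2 \<le> J (hb_map A h \<beta> c v) \<bullet> hb_map A h \<beta> c v"
      using hb_map_quadratic_form[OF h \<beta> c L \<theta> A sym lipschitz_derivative_bound[OF dA lip] w] by blast
    have strict: "\<exists>r>0. \<forall>p\<in>cball (z, z) r. \<forall>q\<in>cball (z, z) r. norm (F p - F q - hb_map A h \<beta> c (p - q)) \<le> \<omega> * norm (p - q)"
      if "\<omega> > 0" for \<omega>
      unfolding F_def
    proof (rule hb_map_strict_derivative[OF h \<beta> c A _ that])
      fix \<omega> :: real assume "\<omega> > 0"
      then show "\<exists>r>0. \<forall>y\<in>cball z r. \<forall>y'\<in>cball z r. norm (g y - g y' - A (y - y')) \<le> \<omega> * norm (y - y')"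
        unfolding A_def by (rule continuous_derivative_imp_strict[OF hess hess_cont])
    qed
    obtain r where r: "r > 0" "\<And>p q. p \<in> cball (z, z) r \<Longrightarrow> q \<in> cball (z, z) r \<Longrightarrow>
        \<mu> * (J (p - q) \<bullet> (p - q)) \<le> J (F p - F q) \<bullet> (F p - F q)"
      using quadratic_form_expansion[OF linear_hb_map[OF A] J(1) exp J(3) strict] by blast
    have "negligible {p. \<forall>n. (F ^^ n) p \<in> cball (z, z) r}"
      by (rule negligible_trapped_set[OF J(1) contF J(2) r(2) J(4)])
    then show ?thesis using r(1) by blast
  qed
  then have "\<exists>r. \<forall>z\<in>Z. r z > 0 \<and> negligible {p. \<forall>n. (F ^^ n) p \<in> cball (z, z) (r z)}"
    by (intro bchoice) blast
  then obtain r where r: "\<And>z. z \<in> Z \<Longrightarrow> r z > 0"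
    and W: "\<And>z. z \<in> Z \<Longrightarrow> negligible {p. \<forall>n. (F ^^ n) p \<in> cball (z, z) (r z)}" by blast
  \<comment> \<open>Trapped sets use the closed ball and the cover the open one: the limit point is
    interior to some ball of the countable subcover, usually centred at another saddle.\<close>
  define T where "T z = {p. \<forall>n. (F ^^ n) p \<in> cball (z, z) (r z)}" for z
  define U where "U z = ball (z, z) (r z)" for z
  have U: "open X" if "X \<in> U ` Z" for X using that by (auto simp: U_def)
  obtain \<F> where \<F>: "\<F> \<subseteq> U ` Z" "countable \<F>" "\<Union>\<F> = \<Union>(U ` Z)"
    using Lindelof[OF U] .
  then obtain Z0 where Z0: "countable Z0" "Z0 \<subseteq> Z" "\<F> = U ` Z0"
    using countable_subset_image[of \<F> U Z] by blast
  obtain K where K: "\<And>p q. norm (p - q) \<le> K * norm (F p - F q)"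
    using hb_map_expansive[OF lip h \<beta> c small] unfolding F_def by blast
  have pre: "negligible ((F ^^ n) -` X)" if "negligible X" for n X
    using that
  proof (induction n arbitrary: X)
    case (Suc n)
    have "negligible ((F ^^ n) -` (F -` X))"
      by (rule Suc.IH[OF negligible_vimage_expansive[OF K Suc.prems]])
    then show ?case by (simp add: vimage_def)
  qed simp
  have "negligible (\<Union>n. (F ^^ n) -` T z)" if "z \<in> Z0" for z
  proof (rule negligible_countable_Union)
    have "negligible (T z)" using W that Z0(2) unfolding T_def by blast
    then show "negligible X" if "X \<in> range (\<lambda>n. (F ^^ n) -` T z)" for X using that pre by blast
  qed simp
  then have "negligible (\<Union>z\<in>Z0. \<Union>n. (F ^^ n) -` T z)"
    by (intro negligible_countable_Union) (use Z0(1) in auto)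
  then show ?thesis
  proof (rule negligible_subset)
    show "{p. \<exists>z. hb_seq g h \<beta> \<gamma> (fst p) (snd p) \<longlonglongrightarrow> z \<and> strict_saddle g H z}
        \<subseteq> (\<Union>z\<in>Z0. \<Union>n. (F ^^ n) -` T z)"
    proof
      fix p assume "p \<in> {p. \<exists>z. hb_seq g h \<beta> \<gamma> (fst p) (snd p) \<longlonglongrightarrow> z \<and> strict_saddle g H z}"
      then obtain z where lim: "hb_seq g h \<beta> \<gamma> (fst p) (snd p) \<longlonglongrightarrow> z" and z: "z \<in> Z"
        by (auto simp: Z_def)
      have orbit: "(F ^^ k) p = (hb_seq g h \<beta> \<gamma> (fst p) (snd p) k, hb_seq g h \<beta> \<gamma> (fst p) (snd p) (Suc k))" for k
      proof -
        have "hb_pair g h \<beta> \<gamma> (fst p) (snd p) k = (hb_map g h \<beta> c ^^ k) (fst p, snd p)"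
          by (rule hb_pair_funpow) (rule \<gamma>)
        then show ?thesis
          unfolding hb_pair_eq[symmetric] by (simp add: F_def hb_seq_def)
      qed
      have "(\<lambda>k. (F ^^ k) p) \<longlonglongrightarrow> (z, z)"
        unfolding orbit by (intro tendsto_Pair lim LIMSEQ_Suc)
      moreover have "(z, z) \<in> U z" using r[OF z] by (simp add: U_def)
      then have "(z, z) \<in> \<Union>\<F>" unfolding \<F>(3) using z by blast
      then obtain z0 where z0: "z0 \<in> Z0" "(z, z) \<in> ball (z0, z0) (r z0)" using Z0(3) by (auto simp: U_def)
      ultimately have "eventually (\<lambda>k. (F ^^ k) p \<in> ball (z0, z0) (r z0)) sequentially"
        by (metis open_ball topological_tendstoD)
      then obtain n where n: "\<And>k. k \<ge> n \<Longrightarrow> (F ^^ k) p \<in> ball (z0, z0) (r z0)"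
        by (auto simp: eventually_sequentially)
      have "(F ^^ m) ((F ^^ n) p) \<in> cball (z0, z0) (r z0)" for m
        using n[of "m + n"] ball_subset_cball by (auto simp: funpow_add)
      then have "(F ^^ n) p \<in> T z0" by (simp add: T_def)
      then show "p \<in> (\<Union>z\<in>Z0. \<Union>n. (F ^^ n) -` T z)"
        using z0(1) by blast
    qed
  qed
qed

theorem mainTheorem6:
  fixes f :: "real^'n \<Rightarrow> real"
    and g :: "real^'n \<Rightarrow> real^'n"
    and H :: "real^'n \<Rightarrow> real^'n^'n"
    and L h \<beta> c C :: real
    and \<gamma> :: "nat \<Rightarrow> real"
  assumes grad: "\<And>x. (f has_derivative (\<lambda>v. g x \<bullet> v)) (at x)"
    and hess: "\<And>x. (g has_derivative (\<lambda>v. H x *v v)) (at x)"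
    and hess_cont: "continuous_on UNIV H"
    and bdd: "bdd_below (range f)"
    and L_pos: "L > 0"
    and lip: "L-lipschitz_on UNIV g"
    and h_pos: "h > 0"
    and beta_nonneg: "\<beta> \<ge> 0"
    and c_pos: "0 < c" and cC: "c \<le> C"
    and gamma_bounds: "\<And>k. c \<le> \<gamma> k \<and> \<gamma> k \<le> C"
  shows
    "(\<beta> + h / 2 < c / L \<longrightarrow>
        (\<forall>x0 x1. summable (\<lambda>k. (norm (g (hb_seq g h \<beta> \<gamma> x0 x1 k)))\<^sup>2) \<and>
                 summable (\<lambda>k. (norm (hb_seq g h \<beta> \<gamma> x0 x1 (Suc k) - hb_seq g h \<beta> \<gamma> x0 x1 k))\<^sup>2) \<and>
                 (\<lambda>k. norm (g (hb_seq g h \<beta> \<gamma> x0 x1 k))) \<longlonglongrightarrow> 0))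
     \<and> (\<beta> + h / 2 < c / L \<and> definable f \<longrightarrow>
        (\<forall>x0 x1. bounded (range (hb_seq g h \<beta> \<gamma> x0 x1)) \<longrightarrow>
           summable (\<lambda>k. norm (hb_seq g h \<beta> \<gamma> x0 x1 (Suc k) - hb_seq g h \<beta> \<gamma> x0 x1 k)) \<and>
           (\<exists>z. hb_seq g h \<beta> \<gamma> x0 x1 \<longlonglongrightarrow> z \<and> g z = 0)))
     \<and> ((\<forall>k. \<gamma> k = c) \<and> 0 < \<beta> \<and> \<beta> < c / L \<and> \<beta> \<noteq> 1 / c \<and>
         h < min (2 * (c / L - \<beta>)) (1 / (L * \<beta>)) \<longrightarrow>
        {p :: (real^'n) \<times> (real^'n). \<exists>z. hb_seq g h \<beta> \<gamma> (fst p) (snd p) \<longlonglongrightarrow> z \<and> strict_saddle g H z}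
           \<in> null_sets lebesgue
        \<and> (definable f \<and> (AE p in lebesgue. bounded (range (hb_seq g h \<beta> \<gamma> (fst p) (snd p)))) \<longrightarrow>
             (AE p in lebesgue. \<exists>z. hb_seq g h \<beta> \<gamma> (fst p) (snd p) \<longlonglongrightarrow> z \<and> g z = 0 \<and>
                                     \<not> strict_saddle g H z)
             \<and> (strict_saddle_property g H \<longrightarrow>
                 (AE p in lebesgue. \<exists>z. hb_seq g h \<beta> \<gamma> (fst p) (snd p) \<longlonglongrightarrow> z \<and> local_min_pt g H z))))"
proof -
  have hb: "heavy_ball f g L h \<beta> c C \<gamma> (hb_seq g h \<beta> \<gamma> x0 x1)" if "\<beta> + h / 2 < c / L" for x0 x1
    by (rule heavy_ball.intro) (fact grad bdd L_pos lip h_pos beta_nonneg c_pos gamma_bounds that hb_seq_recursion)+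
  have part1: "summable (\<lambda>k. (norm (g (hb_seq g h \<beta> \<gamma> x0 x1 k)))\<^sup>2)"
    "summable (\<lambda>k. (norm (hb_seq g h \<beta> \<gamma> x0 x1 (Suc k) - hb_seq g h \<beta> \<gamma> x0 x1 k))\<^sup>2)"
    "(\<lambda>k. norm (g (hb_seq g h \<beta> \<gamma> x0 x1 k))) \<longlonglongrightarrow> 0" if "\<beta> + h / 2 < c / L" for x0 x1
    using heavy_ball.summable_gradient_sq[OF hb[OF that]] heavy_ball.gradient_tendsto_zero[OF hb[OF that]]
      heavy_ball.summable_incr_sq[OF hb[OF that]] heavy_ball.incr_def[OF hb[OF that]] by simp_all
  have part2: "summable (\<lambda>k. norm (hb_seq g h \<beta> \<gamma> x0 x1 (Suc k) - hb_seq g h \<beta> \<gamma> x0 x1 k))"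
    "\<exists>z. hb_seq g h \<beta> \<gamma> x0 x1 \<longlonglongrightarrow> z \<and> g z = 0"
    if step: "\<beta> + h / 2 < c / L" and "definable f" and bd: "bounded (range (hb_seq g h \<beta> \<gamma> x0 x1))" for x0 x1
  proof -
    interpret heavy_ball f g L h \<beta> c C \<gamma> "hb_seq g h \<beta> \<gamma> x0 x1" by (rule hb[OF step])
    obtain S where S: "o_minimal_structure S" "definable_in S f"
      using \<open>definable f\<close> by (auto simp: definable_def)
    have om: "o_minimal S" using S(1) by (rule o_minimal.intro)
    have s: "summable incr"
      by (rule summable_incr_if_definable[OF om o_minimal.def_fun_of_definable_in[OF om S(2)] bd])
    then show "summable (\<lambda>k. norm (hb_seq g h \<beta> \<gamma> x0 x1 (Suc k) - hb_seq g h \<beta> \<gamma> x0 x1 k))"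
      by (simp add: incr_def[abs_def])
    show "\<exists>z. hb_seq g h \<beta> \<gamma> x0 x1 \<longlonglongrightarrow> z \<and> g z = 0"
      by (rule converges_if_summable_incr[OF s])
  qed
  let ?N = "{p :: (real^'n) \<times> (real^'n). \<exists>z. hb_seq g h \<beta> \<gamma> (fst p) (snd p) \<longlonglongrightarrow> z \<and> strict_saddle g H z}"
  have part3: "?N \<in> null_sets lebesgue \<and> (definable f \<and> (AE p in lebesgue. bounded (range (hb_seq g h \<beta> \<gamma> (fst p) (snd p)))) \<longrightarrow>
             (AE p in lebesgue. \<exists>z. hb_seq g h \<beta> \<gamma> (fst p) (snd p) \<longlonglongrightarrow> z \<and> g z = 0 \<and>
                                     \<not> strict_saddle g H z)
             \<and> (strict_saddle_property g H \<longrightarrow>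
                 (AE p in lebesgue. \<exists>z. hb_seq g h \<beta> \<gamma> (fst p) (snd p) \<longlonglongrightarrow> z \<and> local_min_pt g H z)))"
    if \<gamma>: "\<forall>k. \<gamma> k = c" and \<beta>: "0 < \<beta>" and h: "h < min (2 * (c / L - \<beta>)) (1 / (L * \<beta>))"
  proof (intro conjI impI)
    \<comment> \<open>The first bound on \<open>h\<close> is the step condition of part (i); the
      second makes the iteration map injective with Lipschitz inverse.\<close>
    have step: "\<beta> + h / 2 < c / L" using h by (simp add: field_simps)
    have "h < 1 / (L * \<beta>)" using h by simp
    then have small: "\<beta> * h * L < 1" using \<beta> L_pos by (simp add: field_simps)
    have "negligible ?N"
      by (rule negligible_converging_to_saddle[OF grad hess hess_cont L_pos lip h_pos beta_nonneg c_pos _ step small])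
        (use \<gamma> in simp)
    then show N: "?N \<in> null_sets lebesgue" by (simp add: negligible_iff_null_sets)
    assume asm: "definable f \<and> (AE p in lebesgue. bounded (range (hb_seq g h \<beta> \<gamma> (fst p) (snd p))))"
    then have "AE p in lebesgue. bounded (range (hb_seq g h \<beta> \<gamma> (fst p) (snd p)))" ..
    then show ae: "AE p in lebesgue. \<exists>z. hb_seq g h \<beta> \<gamma> (fst p) (snd p) \<longlonglongrightarrow> z \<and> g z = 0 \<and> \<not> strict_saddle g H z"
      using AE_not_in[OF N]
    proof eventually_elim
      case (elim p)
      then show ?case using part2(2)[OF step conjunct1[OF asm] elim(1)] by blast
    qed
    assume "strict_saddle_property g H"
    then show "AE p in lebesgue. \<exists>z. hb_seq g h \<beta> \<gamma> (fst p) (snd p) \<longlonglongrightarrow> z \<and> local_min_pt g H z"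
      using ae unfolding strict_saddle_property_def by (auto elim!: eventually_mono)
  qed
  show ?thesis
    by (rule conjI, use part1 in blast, rule conjI, use part2 in blast, rule impI, elim conjE, rule part3)
qed

end
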